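(* Let $R$ be a ring with unitization $R^+=\mathbb{Z}\oplus R$, and let $\psi\colon\mathrm{CP}(R^+)\to\mathrm{S}(R^+)$ be the isomorphism given by $\psi([P])=[(x_i)]$ whenever $P\cong\varinjlim_i((R^+)^{n_i},x_i\cdot)$ with $x_i\in M_{n_{i+1}\times n_i}(R^+)$ such that for each $i$ there is $y_{i+1}\in M_{n_{i+1}\times n_{i+2}}(R^+)$ with $y_{i+1}x_{i+1}x_i=x_i$. Then there is an isomorphism $\mathrm{CP}(R)\cong\mathrm{S}(R)$, given by the restriction $\psi|_{\mathrm{CP}(R)}$, such that the diagram $$\begin{array}{ccc}\mathrm{CP}(R)&\xrightarrow{\ \psi|_{\mathrm{CP}(R)}\ }&\mathrm{S}(R)\\ \downarrow&&\downarrow\\ \mathrm{CP}(R^+)&\xrightarrow{\ \ \psi\ \ }&\mathrm{S}(R^+)\end{array}$$ is commutative, where the vertical maps are the canonical inclusions.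
   Context: Rings are associative and not necessarily unital; modules are right modules. $\mathrm{CP}$. For any ring $R$, $\mathcal{CP}(R)$ is the class of countably generated projective unital right $R^+$-modules $P$ with $P=PR$; for a unital ring such as $R^+$, $\mathcal{CP}(R^+)$ is the class of countably generated projective unital right $R^+$-modules. For $P,Q$ in such a class, $P\precsim Q$ means: for every finitely generated submodule $X\subseteq P$ there are module homomorphisms $\alpha\colon X\to Q$, $\beta\colon Q\to P$ such that $\beta\alpha$ is the inclusion $X\hookrightarrow P$. $\mathrm{CP}(R)$ (resp. $\mathrm{CP}(R^+)$) is the quotient by the antisymmetrization of $\precsim$, with the induced order and addition $[P]+[Q]=[P\oplus Q]$. The order on $\mathrm{CP}(R)$ is by definition inherited from $\mathrm{CP}(R^+)$, so $\mathrm{CP}(R)$ order-embeds in $\mathrm{CP}(R^+)$. $\mathrm{S}$. $M_\infty(R)$ is the ring of $\mathbb{N}\times\mathbb{N}$ matrices over $R$ with finitely many nonzero entries; finite rectangular matrices are identified with their extensions by zeros; $x\oplus y=\begin{pmatrix}x&0\\0&y\end{pmatrix}$. Write $a\precsim_1b$ if $a=rbt$ for some $r,t\in M_\infty(R)$. $\mathcal{S}(R)$ is the set of sequences $(x_n)$ in $M_\infty(R)$ such that for all $n$ there is $y_{n+1}\in M_\infty(R)$ with $y_{n+1}x_{n+1}x_n=x_n$; $(a_n)\precsim(b_n)$ if for every $n$ there is $m$ with $a_n\precsim_1b_m$; $\mathrm{S}(R)$ is $\mathcal{S}(R)$ modulo the antisymmetrization of $\precsim$, with the induced order and addition $[(u_n)]+[(u_n')]=[(u_n\oplus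 u_n')]$ for representatives by finite matrices $u_n\in M_{k_{n+1}\times k_n}(R)$ with $u_n=v_{n+1}u_{n+1}u_n$, $v_{n+1}\in M_{k_{n+1}\times k_{n+2}}(R)$ (and similarly $u_n'$). $\mathrm{S}(R)$ order-embeds in $\mathrm{S}(R^+)$ by viewing matrices over $R$ as matrices over $R^+$. Every countably generated projective $R^+$-module is isomorphic to a direct limit of the form appearing in the definition of $\psi$, and $\psi$ is a well-defined isomorphism of ordered monoids. *)

theory Defs
  imports
    Main
    "HOL-Algebra.Generated_Groups"
    "HOL-Library.Groups_Big_Fun"
    "HOL-Library.Countable_Set"
begin

section \<open>The unitization of a ring\<close>

text \<open>The type class \<^class>\<open>ring\<close> is the class of associative, not necessarily unital rings.\<close>

definition zscale :: "int \<Rightarrow> 'a::ring \<Rightarrow> 'a" where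
  "zscale m r = (if 0 \<le> m then (\<Sum>i<nat m. r) else - (\<Sum>i<nat (- m). r))"

lemma zscale_0 [simp]: "zscale 0 r = 0"
  by (simp add: zscale_def)

lemma zscale_1 [simp]: "zscale 1 r = r"
  by (simp add: zscale_def)

lemma zscale_plus1: "zscale (m + 1) r = zscale m r + r"
proof -
  consider "0 \<le> m" | "m = -1" | "m < -1" by linarith
  then show ?thesis
  proof cases
    case 1
    then have "nat (m + 1) = Suc (nat m)" by simp
    with 1 show ?thesis by (simp add: zscale_def)
  next
    case 2
    then show ?thesis by (simp add: zscale_def)
  next
    case 3
    then have "nat (- m) = Suc (nat (- (m + 1)))" by simp
    with 3 show ?thesis by (simp add: zscale_def)
  qed
qed

lemma zscale_minus1: "zscale (m - 1) r = zscale m r - r"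
  using zscale_plus1 [of "m - 1" r] by simp

lemma zscale_add_left: "zscale (m + n) r = zscale m r + zscale n r"
proof (induction n rule: int_induct [where k = 0])
  case (step1 i)
  then show ?case using zscale_plus1 [of "m + i" r] zscale_plus1 [of i r]
    by (simp add: add.assoc)
next
  case (step2 i)
  then show ?case using zscale_minus1 [of "m + i" r] zscale_minus1 [of i r]
    by (simp add: add_diff_eq)
qed simp

lemma zscale_add_right: "zscale m (r + s) = zscale m r + zscale m s"
  by (induction m rule: int_induct [where k = 0])
    (simp_all add: zscale_plus1 zscale_minus1 algebra_simps)

lemma zscale_minus_right: "zscale m (- r) = - zscale m r"
  by (induction m rule: int_induct [where k = 0])
    (simp_all add: zscale_plus1 zscale_minus1)

lemma zscale_zero_right [simp]: "zscale m 0 = 0"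
  by (induction m rule: int_induct [where k = 0])
    (simp_all add: zscale_plus1 zscale_minus1)

lemma zscale_diff_left: "zscale (m - n) r = zscale m r - zscale n r"
  using zscale_add_left [of "m - n" n r] by simp

lemma zscale_mult: "zscale (m * n) r = zscale m (zscale n r)"
  by (induction m rule: int_induct [where k = 0])
    (simp_all add: zscale_plus1 zscale_minus1 zscale_add_left zscale_diff_left distrib_right
      left_diff_distrib)

lemma zscale_mult_left: "zscale m r * s = zscale m (r * s)"
  by (induction m rule: int_induct [where k = 0])
    (simp_all add: zscale_plus1 zscale_minus1 algebra_simps)

lemma zscale_mult_right: "r * zscale m s = zscale m (r * s)"
  by (induction m rule: int_induct [where k = 0])
    (simp_all add: zscale_plus1 zscale_minus1 algebra_simps)

text \<open>The unitization \<open>\<int> \<oplus> R\<close>; the pair \<open>Unitization m r\<close> stands for \<open>m + r\<close>.\<close>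

datatype 'a unitization = Unitization (int_part: int) (ring_part: 'a)

instantiation unitization :: (ring) ring_1
begin

definition "0 = Unitization 0 0"
definition "1 = Unitization 1 0"
definition "x + y = Unitization (int_part x + int_part y) (ring_part x + ring_part y)"
definition "- x = Unitization (- int_part x) (- ring_part x)"
definition "x - y = Unitization (int_part x - int_part y) (ring_part x - ring_part y)"
definition "x * y = Unitization (int_part x * int_part y)
  (zscale (int_part x) (ring_part y) + zscale (int_part y) (ring_part x)
    + ring_part x * ring_part y)"

instance
proof
  fix a b c :: "'a unitization"
  show "a * b * c = a * (b * c)"
  proof -
    have "zscale (int_part a * int_part c) (ring_part b)
        = zscale (int_part c) (zscale (int_part a) (ring_part b))"
      by (simp add: zscale_mult [symmetric] mult.commute)
    moreover have "zscale (int_part b * int_part c) (ring_part a)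
        = zscale (int_part c) (zscale (int_part b) (ring_part a))"
      by (simp add: zscale_mult [symmetric] mult.commute)
    ultimately show ?thesis
      by (simp add: times_unitization_def zscale_mult zscale_add_right zscale_mult_left
          zscale_mult_right distrib_left distrib_right mult.assoc add.assoc)
  qed
qed (simp_all add: zero_unitization_def one_unitization_def plus_unitization_def
    uminus_unitization_def minus_unitization_def times_unitization_def
    zscale_add_left zscale_add_right algebra_simps)

end

definition emb :: "'a::ring \<Rightarrow> 'a unitization" where
  "emb r = Unitization 0 r"


section \<open>Ordered monoids\<close>

record 'c ord_monoid = "'c monoid" +
  leq :: "'c \<Rightarrow> 'c \<Rightarrow> bool"

definition ord_monoid_iso ::
    "('c, 'e) ord_monoid_scheme \<Rightarrow> ('d, 'f) ord_monoid_scheme \<Rightarrow> ('c \<Rightarrow> 'd) \<Rightarrow> bool" where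
  "ord_monoid_iso A B f \<longleftrightarrow> f \<in> iso A B \<and> f \<one>\<^bsub>A\<^esub> = \<one>\<^bsub>B\<^esub> \<and>
    (\<forall>a\<in>carrier A. \<forall>b\<in>carrier A. leq A a b \<longleftrightarrow> leq B (f a) (f b))"


section \<open>Right modules\<close>

record ('r, 'm) rmodule = "'m partial_object" +
  madd :: "'m \<Rightarrow> 'm \<Rightarrow> 'm"
  mzero :: 'm
  act :: "'m \<Rightarrow> 'r \<Rightarrow> 'm"

definition add_group :: "('r, 'm) rmodule \<Rightarrow> 'm monoid" where
  "add_group M = \<lparr>carrier = carrier M, mult = madd M, one = mzero M\<rparr>"

definition right_module :: "('r::ring_1, 'm) rmodule \<Rightarrow> bool" where
  "right_module M \<longleftrightarrow> comm_group (add_group M) \<and>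
    (\<forall>p\<in>carrier M. \<forall>r. act M p r \<in> carrier M) \<and>
    (\<forall>p\<in>carrier M. \<forall>q\<in>carrier M. \<forall>r. act M (madd M p q) r = madd M (act M p r) (act M q r)) \<and>
    (\<forall>p\<in>carrier M. \<forall>r s. act M p (r + s) = madd M (act M p r) (act M p s)) \<and>
    (\<forall>p\<in>carrier M. \<forall>r s. act M p (r * s) = act M (act M p r) s) \<and>
    (\<forall>p\<in>carrier M. act M p 1 = p)"

definition mod_hom :: "('r, 'm) rmodule \<Rightarrow> ('r, 'n) rmodule \<Rightarrow> ('m \<Rightarrow> 'n) set" where
  "mod_hom M N = {f. f \<in> carrier M \<rightarrow> carrier N \<and>
    (\<forall>p\<in>carrier M. \<forall>q\<in>carrier M. f (madd M p q) = madd N (f p) (f q)) \<and>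
    (\<forall>p\<in>carrier M. \<forall>r. f (act M p r) = act N (f p) r)}"

definition mod_isomorphic :: "('r, 'm) rmodule \<Rightarrow> ('r, 'n) rmodule \<Rightarrow> bool" where
  "mod_isomorphic M N \<longleftrightarrow> (\<exists>f\<in>mod_hom M N. bij_betw f (carrier M) (carrier N))"

definition is_submodule :: "('r, 'm) rmodule \<Rightarrow> 'm set \<Rightarrow> bool" where
  "is_submodule M X \<longleftrightarrow> X \<subseteq> carrier M \<and> mzero M \<in> X \<and>
    (\<forall>p\<in>X. \<forall>q\<in>X. madd M p q \<in> X) \<and> (\<forall>p\<in>X. \<forall>r. act M p r \<in> X)"

definition mspan :: "('r, 'm) rmodule \<Rightarrow> 'm set \<Rightarrow> 'm set" where
  "mspan M G = \<Inter>{X. is_submodule M X \<and> G \<subseteq> X}"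

definition fg_submodule :: "('r, 'm) rmodule \<Rightarrow> 'm set \<Rightarrow> bool" where
  "fg_submodule M X \<longleftrightarrow> (\<exists>G\<subseteq>carrier M. finite G \<and> X = mspan M G)"

definition countably_generated :: "('r, 'm) rmodule \<Rightarrow> bool" where
  "countably_generated M \<longleftrightarrow> (\<exists>G\<subseteq>carrier M. countable G \<and> mspan M G = carrier M)"

text \<open>
  Projectivity is the lifting property against surjections. A definition cannot quantify
  over types, so the test modules \<open>B\<close> and \<open>A\<close> range over the types \<open>'m\<close> and \<open>'m \<Rightarrow> 'r\<close>. This
  loses nothing: the type \<open>'m \<Rightarrow> 'r\<close> contains the free module on the elements of \<open>P\<close>, and
  lifting the identity of \<open>P\<close> along the canonical surjection from it makes \<open>P\<close> a direct
  summand of a free module, whence the lifting property against all surjections.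
\<close>

definition projective :: "('r::ring_1, 'm) rmodule \<Rightarrow> bool" where
  "projective P \<longleftrightarrow> (\<forall>(A :: ('r, 'm \<Rightarrow> 'r) rmodule) (B :: ('r, 'm) rmodule).
    right_module A \<longrightarrow> right_module B \<longrightarrow>
    (\<forall>g\<in>mod_hom A B. \<forall>f\<in>mod_hom P B. g ` carrier A = carrier B \<longrightarrow>
      (\<exists>h\<in>mod_hom P A. \<forall>p\<in>carrier P. g (h p) = f p)))"

definition direct_sum :: "('r, 'm) rmodule \<Rightarrow> ('r, 'n) rmodule \<Rightarrow> ('r, 'm \<times> 'n) rmodule" where
  "direct_sum P Q = \<lparr>carrier = carrier P \<times> carrier Q,
    madd = (\<lambda>(p, q) (p', q'). (madd P p p', madd Q q q')),
    mzero = (mzero P, mzero Q),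
    act = (\<lambda>(p, q) r. (act P p r, act Q q r))\<rparr>"

definition zero_module :: "('r, unit) rmodule" where
  "zero_module = \<lparr>carrier = {()}, madd = (\<lambda>_ _. ()), mzero = (), act = (\<lambda>_ _. ())\<rparr>"

text \<open>\<open>PR\<close> for a right \<open>R\<^sup>+\<close>-module \<open>P\<close>: the finite sums of products \<open>pr\<close> with \<open>r \<in> R\<close>.\<close>

definition mod_times_ring :: "('a::ring unitization, 'm) rmodule \<Rightarrow> 'm set" where
  "mod_times_ring P = generate (add_group P) {act P p (emb r) | p r. p \<in> carrier P}"


section \<open>The ordered monoids of countably generated projective modules\<close>

definition cp_le :: "('r, 'm) rmodule \<Rightarrow> ('r, 'n) rmodule \<Rightarrow> bool" where
  "cp_le P Q \<longleftrightarrow> (\<forall>X. fg_submodule P X \<longrightarrow>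
    (\<exists>\<alpha>\<in>mod_hom (P\<lparr>carrier := X\<rparr>) Q. \<exists>\<beta>\<in>mod_hom Q P. \<forall>p\<in>X. \<beta> (\<alpha> p) = p))"

text \<open>
  The proper class of all countably generated modules is cut down to the modules whose
  underlying set consists of sequences in the ring. Being a quotient of the free module of
  countable rank, every countably generated module has an isomorphic copy of this kind.
\<close>

type_synonym 'r seq_module = "('r, nat \<Rightarrow> 'r) rmodule"

definition CP_unital_objs :: "'r::ring_1 seq_module set" where
  "CP_unital_objs = {P. right_module P \<and> countably_generated P \<and> projective P}"

definition CP_objs :: "'a::ring unitization seq_module set" where
  "CP_objs = {P \<in> CP_unital_objs. mod_times_ring P = carrier P}"

text \<open>
  The class of \<open>P\<close> among the modules in \<open>K\<close>. The elements of \<open>P\<close> may come from another type;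
  this is needed for direct sums, whose elements are pairs.
\<close>

definition cp_class :: "'r seq_module set \<Rightarrow> ('r, 'm) rmodule \<Rightarrow> 'r seq_module set" where
  "cp_class K P = {Q \<in> K. cp_le P Q \<and> cp_le Q P}"

definition cp_monoid :: "'r seq_module set \<Rightarrow> 'r seq_module set ord_monoid" where
  "cp_monoid K = \<lparr>carrier = cp_class K ` K,
    mult = (\<lambda>C D. THE E. \<exists>P\<in>C. \<exists>Q\<in>D. E = cp_class K (direct_sum P Q)),
    one = cp_class K zero_module,
    leq = (\<lambda>C D. \<exists>P\<in>C. \<exists>Q\<in>D. cp_le P Q)\<rparr>"

definition CP_unital :: "'r::ring_1 seq_module set ord_monoid" where
  "CP_unital = cp_monoid CP_unital_objs"

definition CP :: "'a::ring unitization seq_module set ord_monoid" where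
  "CP = cp_monoid CP_objs"

definition CP_incl :: "'a::ring unitization seq_module set \<Rightarrow> 'a unitization seq_module set" where
  "CP_incl C = (THE D. \<exists>P\<in>C. D = cp_class CP_unital_objs P)"


section \<open>The ordered monoid of sequences of matrices\<close>

type_synonym 'a mat = "nat \<Rightarrow> nat \<Rightarrow> 'a"

definition M_infty :: "'a::ring mat set" where
  "M_infty = {x. finite {(i, j). x i j \<noteq> 0}}"

definition mat_mult :: "'a::ring mat \<Rightarrow> 'a mat \<Rightarrow> 'a mat"  (infixl "\<odot>" 70) where
  "x \<odot> y = (\<lambda>i j. Sum_any (\<lambda>k. x i k * y k j))"

text \<open>\<open>k \<times> l\<close> matrices, extended by zeros.\<close>

definition rect :: "nat \<Rightarrow> nat \<Rightarrow> 'a::ring mat set" where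
  "rect k l = {x. \<forall>i j. x i j \<noteq> 0 \<longrightarrow> i < k \<and> j < l}"

definition s_le1 :: "'a::ring mat \<Rightarrow> 'a mat \<Rightarrow> bool" where
  "s_le1 a b \<longleftrightarrow> (\<exists>r\<in>M_infty. \<exists>t\<in>M_infty. a = r \<odot> b \<odot> t)"

definition S_objs :: "(nat \<Rightarrow> 'a::ring mat) set" where
  "S_objs = {x. (\<forall>n. x n \<in> M_infty) \<and> (\<forall>n. \<exists>y\<in>M_infty. y \<odot> x (Suc n) \<odot> x n = x n)}"

definition s_le :: "(nat \<Rightarrow> 'a::ring mat) \<Rightarrow> (nat \<Rightarrow> 'a mat) \<Rightarrow> bool" where
  "s_le a b \<longleftrightarrow> (\<forall>n. \<exists>m. s_le1 (a n) (b m))"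

definition s_class :: "(nat \<Rightarrow> 'a::ring mat) \<Rightarrow> (nat \<Rightarrow> 'a mat) set" where
  "s_class a = {b \<in> S_objs. s_le a b \<and> s_le b a}"

text \<open>
  Sequences of finite matrices \<open>x i\<close> of size \<open>k (i + 1) \<times> k i\<close>, with the witness for
  \<open>x i = y x (i + 1) x i\<close> of size \<open>k (i + 1) \<times> k (i + 2)\<close>.
\<close>

definition sized_seq :: "(nat \<Rightarrow> nat) \<Rightarrow> (nat \<Rightarrow> 'a::ring mat) \<Rightarrow> bool" where
  "sized_seq k x \<longleftrightarrow> (\<forall>i. x i \<in> rect (k (Suc i)) (k i)) \<and>
    (\<forall>i. \<exists>y\<in>rect (k (Suc i)) (k (Suc (Suc i))). y \<odot> x (Suc i) \<odot> x i = x i)"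

text \<open>The block sum \<open>x \<oplus> y\<close>, where \<open>x\<close> is regarded as a \<open>k \<times> l\<close> matrix.\<close>

definition block_sum :: "nat \<Rightarrow> nat \<Rightarrow> 'a::ring mat \<Rightarrow> 'a mat \<Rightarrow> 'a mat" where
  "block_sum k l x y = (\<lambda>i j. if i < k \<and> j < l then x i j
    else if k \<le> i \<and> l \<le> j then y (i - k) (j - l) else 0)"

definition S_mon :: "(nat \<Rightarrow> 'a::ring mat) set ord_monoid" where
  "S_mon = \<lparr>carrier = s_class ` S_objs,
    mult = (\<lambda>C D. THE E. \<exists>k k' u u'. u \<in> C \<and> sized_seq k u \<and> u' \<in> D \<and> sized_seq k' u' \<and>
      E = s_class (\<lambda>n. block_sum (k (Suc n)) (k n) (u n) (u' n))),
    one = s_class (\<lambda>_ _ _. 0),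
    leq = (\<lambda>C D. \<exists>a\<in>C. \<exists>b\<in>D. s_le a b)\<rparr>"

definition S_incl :: "(nat \<Rightarrow> 'a::ring mat) set \<Rightarrow> (nat \<Rightarrow> 'a unitization mat) set" where
  "S_incl C = (THE D. \<exists>u\<in>C. D = s_class (\<lambda>n i j. emb (u n i j)))"


section \<open>Direct limits\<close>

primrec push :: "(nat \<Rightarrow> 'm \<Rightarrow> 'm) \<Rightarrow> nat \<Rightarrow> nat \<Rightarrow> 'm \<Rightarrow> 'm" where
  "push f i 0 p = p"
| "push f i (Suc d) p = f (i + d) (push f i d p)"

text \<open>
  The limit of \<open>M 0 \<longrightarrow> M 1 \<longrightarrow> \<dots>\<close> along the homomorphisms \<open>f i\<close> from \<open>M i\<close> to \<open>M (i + 1)\<close>: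
  the disjoint union of the \<open>M i\<close>, in which elements are identified when they have
  the same image in some later \<open>M k\<close>.
\<close>

definition dirlim_rel ::
    "(nat \<Rightarrow> ('r, 'm) rmodule) \<Rightarrow> (nat \<Rightarrow> 'm \<Rightarrow> 'm) \<Rightarrow> ((nat \<times> 'm) \<times> (nat \<times> 'm)) set" where
  "dirlim_rel M f = {((i, p), (j, q)). p \<in> carrier (M i) \<and> q \<in> carrier (M j) \<and>
    (\<exists>c d. i + c = j + d \<and> push f i c p = push f j d q)}"

definition dirlim ::
    "(nat \<Rightarrow> ('r, 'm) rmodule) \<Rightarrow> (nat \<Rightarrow> 'm \<Rightarrow> 'm) \<Rightarrow> ('r, (nat \<times> 'm) set) rmodule" where
  "dirlim M f = \<lparr>carrier = (SIGMA i:UNIV. carrier (M i)) // dirlim_rel M f,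
    madd = (\<lambda>C D. THE E. \<exists>i p q. (i, p) \<in> C \<and> (i, q) \<in> D \<and>
      E = dirlim_rel M f `` {(i, madd (M i) p q)}),
    mzero = dirlim_rel M f `` {(0, mzero (M 0))},
    act = (\<lambda>C r. THE E. \<exists>i p. (i, p) \<in> C \<and> E = dirlim_rel M f `` {(i, act (M i) p r)})\<rparr>"

text \<open>The right module of columns of length \<open>k\<close>, again extended by zeros.\<close>

definition free_module :: "nat \<Rightarrow> 'r::ring_1 seq_module" where
  "free_module k = \<lparr>carrier = {v. \<forall>i\<ge>k. v i = 0},
    madd = (\<lambda>v w i. v i + w i), mzero = (\<lambda>_. 0), act = (\<lambda>v r i. v i * r)\<rparr>"

definition mat_vec :: "'a::ring mat \<Rightarrow> (nat \<Rightarrow> 'a) \<Rightarrow> (nat \<Rightarrow> 'a)" where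
  "mat_vec x v = (\<lambda>i. Sum_any (\<lambda>j. x i j * v j))"

definition mat_lim ::
    "(nat \<Rightarrow> nat) \<Rightarrow> (nat \<Rightarrow> 'r::ring_1 mat) \<Rightarrow> ('r, (nat \<times> (nat \<Rightarrow> 'r)) set) rmodule" where
  "mat_lim n x = dirlim (\<lambda>i. free_module (n i)) (\<lambda>i. mat_vec (x i))"


section \<open>The isomorphism and its restriction\<close>

definition psi :: "'r::ring_1 seq_module set \<Rightarrow> (nat \<Rightarrow> 'r mat) set" where
  "psi C = (THE s. \<exists>P\<in>C. \<exists>n x. sized_seq n x \<and> mod_isomorphic P (mat_lim n x) \<and> s = s_class x)"

text \<open>
  The restriction of \<^const>\<open>psi\<close> to \<open>CP(R)\<close>, both \<open>CP(R)\<close> and \<open>S(R)\<close> being identified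
  with their images over the unitization.
\<close>

definition psi_restr :: "'a::ring unitization seq_module set \<Rightarrow> (nat \<Rightarrow> 'a mat) set" where
  "psi_restr C = inv_into (carrier S_mon) S_incl (psi (CP_incl C))"

end

theory Submission
  imports Defs
begin

text \<open>
  A module \<open>P\<close> is a direct limit along matrices \<open>x i\<close> exactly when it carries a cocone of maps
  \<open>\<phi> i\<close> from the free modules to \<open>P\<close> that are jointly surjective and whose equalities hold already at a
  finite stage. The witnesses \<open>y i\<close> with \<open>y i x (i + 1) x i = x i\<close> provide maps
  \<open>a\<close> from \<open>P\<close> back to a free module with \<open>a (\<phi> i v) = x i v\<close>; these translate factorizations
  \<open>x i = r z t\<close> into factorizations of inclusions of finitely generated submodules, and conversely
  such module maps lift to matrices. They also make every such limit projective. Conversely, a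
  countably generated projective \<open>P\<close> is cut out of the free module of countable rank by an idempotent
  matrix \<open>e = s \<pi>\<close>, and is the limit of finite corners of \<open>e\<close>.

  If \<open>P = PR\<close>, then \<open>s\<close> maps \<open>P = PR\<close> to vectors over the ideal \<open>R\<close>, so \<open>e\<close>, and with it the \<open>x i\<close>
  and \<open>y i\<close>, have entries in \<open>R\<close>. Conversely, if the \<open>x i\<close> have entries in \<open>R\<close>, then
  \<open>\<phi> i v = \<phi> (i + 1) (x i v)\<close> lies in \<open>PR\<close>. So the image of \<open>CP(R)\<close> under \<open>\<psi>\<close> is that of \<open>S(R)\<close>.
\<close>

section \<open>Modules and homomorphisms\<close>

text \<open>The predicate \<open>represents\<close> carries the argument between the two sides: for
  represented modules over arbitrary types, \<open>cp_le\<close> is \<open>s_le\<close> of the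
  sequences. So \<open>cp_le\<close> inherits transitivity and compatibility with direct sums from
  matrices, where both are computations with finite blocks. The freedom of types is essential:
  limits consist of equivalence classes and direct sums of pairs, while the objects of the monoids
  are modules of sequences. A limit enters the monoid only after a section of a surjection from the
  free module of countable rank has copied it into sequences.

  The isomorphism and its restriction come from one lemma, \<open>cp_monoid_iso\<close>, about a set
  \<open>K\<close> of modules and a map \<open>e\<close> of coefficients: all countably generated
  projective modules with the identity, and those with \<open>P = PR\<close> with
  \<open>emb\<close>. The delicate point of the restriction is that the order on S(R) asks for
  factors over R, while comparing modules yields factors over the unitization; these are moved into
  R by absorbing a witness \<open>y\<close> on the left and a term \<open>u n\<close> on the
  right.\<close>

lemma add_group_simps [simp]:
  "carrier (add_group M) = carrier M" "mult (add_group M) = madd M" "one (add_group M) = mzero M"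
  by (simp_all add: add_group_def)

context
  fixes M :: "('r::ring_1, 'm) rmodule"
  assumes M: "right_module M"
begin

interpretation G: comm_group "add_group M"
  using M by (simp add: right_module_def)

lemma madd_closed [simp]: "p \<in> carrier M \<Longrightarrow> q \<in> carrier M \<Longrightarrow> madd M p q \<in> carrier M"
  using G.m_closed by simp

lemma mzero_closed [simp]: "mzero M \<in> carrier M"
  using G.one_closed by simp

lemma madd_assoc: "p \<in> carrier M \<Longrightarrow> q \<in> carrier M \<Longrightarrow> r \<in> carrier M \<Longrightarrow>
    madd M (madd M p q) r = madd M p (madd M q r)"
  using G.m_assoc by simp

lemma madd_comm: "p \<in> carrier M \<Longrightarrow> q \<in> carrier M \<Longrightarrow> madd M p q = madd M q p"
  using G.m_comm by simp

lemma madd_lcomm: "p \<in> carrier M \<Longrightarrow> q \<in> carrier M \<Longrightarrow> r \<in> carrier M \<Longrightarrow>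
    madd M p (madd M q r) = madd M q (madd M p r)"
  using G.m_lcomm by simp

lemma mzero_left [simp]: "p \<in> carrier M \<Longrightarrow> madd M (mzero M) p = p"
  using G.l_one by simp

lemma mzero_right [simp]: "p \<in> carrier M \<Longrightarrow> madd M p (mzero M) = p"
  using G.r_one by simp

lemma madd_idem_imp_mzero: "p \<in> carrier M \<Longrightarrow> madd M p p = p \<Longrightarrow> p = mzero M"
  using G.l_cancel_one' [of p p] by simp

lemma act_closed [simp]: "p \<in> carrier M \<Longrightarrow> act M p r \<in> carrier M"
  using M by (simp add: right_module_def)

lemma act_madd: "p \<in> carrier M \<Longrightarrow> q \<in> carrier M \<Longrightarrow>
    act M (madd M p q) r = madd M (act M p r) (act M q r)"
  using M by (simp add: right_module_def)

lemma act_add: "p \<in> carrier M \<Longrightarrow> act M p (r + s) = madd M (act M p r) (act M p s)"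
  using M by (simp add: right_module_def)

lemma act_mult: "p \<in> carrier M \<Longrightarrow> act M p (r * s) = act M (act M p r) s"
  using M by (simp add: right_module_def)

lemma act_one [simp]: "p \<in> carrier M \<Longrightarrow> act M p 1 = p"
  using M by (simp add: right_module_def)

lemma act_zero [simp]: "p \<in> carrier M \<Longrightarrow> act M p 0 = mzero M"
  using madd_idem_imp_mzero [of "act M p 0"] act_add [of p 0 0] by simp

lemma act_mzero [simp]: "act M (mzero M) r = mzero M"
  using madd_idem_imp_mzero [of "act M (mzero M) r"] act_madd [of "mzero M" "mzero M" r] by simp

lemma madd_uminus [simp]:
  "p \<in> carrier M \<Longrightarrow> madd M p (act M p (- 1)) = mzero M"
  "p \<in> carrier M \<Longrightarrow> madd M (act M p (- 1)) p = mzero M"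
  using act_add [of p 1 "- 1"] act_add [of p "- 1" 1] by simp_all

text \<open>The record of a module has no negation. Acting by \<open>-1\<close> replaces it, also
  where \<open>generate\<close> brings in group inverses.\<close>

lemma add_group_inv: "p \<in> carrier M \<Longrightarrow> m_inv (add_group M) p = act M p (- 1)"
  using G.inv_equality [of "act M p (- 1)" p] by simp

end

text \<open>Asking that the scalar \<open>0\<close> acts as zero replaces the existence of inverses:
  \<open>p (-1) + p = p (-1 + 1) = p 0\<close>.\<close>

lemma right_moduleI:
  fixes M :: "('r::ring_1, 'm) rmodule"
  assumes "\<And>p q. p \<in> carrier M \<Longrightarrow> q \<in> carrier M \<Longrightarrow> madd M p q \<in> carrier M"
    and "mzero M \<in> carrier M"
    and "\<And>p q r. p \<in> carrier M \<Longrightarrow> q \<in> carrier M \<Longrightarrow> r \<in> carrier M \<Longrightarrow>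
      madd M (madd M p q) r = madd M p (madd M q r)"
    and "\<And>p q. p \<in> carrier M \<Longrightarrow> q \<in> carrier M \<Longrightarrow> madd M p q = madd M q p"
    and "\<And>p. p \<in> carrier M \<Longrightarrow> madd M (mzero M) p = p"
    and "\<And>p r. p \<in> carrier M \<Longrightarrow> act M p r \<in> carrier M"
    and "\<And>p q r. p \<in> carrier M \<Longrightarrow> q \<in> carrier M \<Longrightarrow>
      act M (madd M p q) r = madd M (act M p r) (act M q r)"
    and act_add: "\<And>p r s. p \<in> carrier M \<Longrightarrow> act M p (r + s) = madd M (act M p r) (act M p s)"
    and "\<And>p r s. p \<in> carrier M \<Longrightarrow> act M p (r * s) = act M (act M p r) s"
    and act_1: "\<And>p. p \<in> carrier M \<Longrightarrow> act M p 1 = p"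
    and act_0: "\<And>p. p \<in> carrier M \<Longrightarrow> act M p 0 = mzero M"
  shows "right_module M"
proof -
  have "madd M (act M p (- 1)) p = mzero M" if "p \<in> carrier M" for p
    using act_add [OF that, of "- 1" 1] act_0 [OF that] act_1 [OF that] by simp
  then have inv: "\<exists>q\<in>carrier M. madd M q p = mzero M" if "p \<in> carrier M" for p
    using that assms(6) by blast
  have group: "comm_group (add_group M)"
    by (rule comm_groupI; unfold add_group_simps) (rule assms(1-5) inv; assumption)+
  show ?thesis
    unfolding right_module_def
    by (intro conjI ballI allI group) (rule assms(6-10); assumption)+
qed

lemma mod_homI:
  assumes "\<And>p. p \<in> carrier M \<Longrightarrow> f p \<in> carrier N"
    and "\<And>p q. p \<in> carrier M \<Longrightarrow> q \<in> carrier M \<Longrightarrow> f (madd M p q) = madd N (f p) (f q)"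
    and "\<And>p r. p \<in> carrier M \<Longrightarrow> f (act M p r) = act N (f p) r"
  shows "f \<in> mod_hom M N"
  using assms by (auto simp: mod_hom_def)

lemma mod_hom_closed: "f \<in> mod_hom M N \<Longrightarrow> p \<in> carrier M \<Longrightarrow> f p \<in> carrier N"
  by (auto simp: mod_hom_def)

lemma mod_hom_madd:
  "f \<in> mod_hom M N \<Longrightarrow> p \<in> carrier M \<Longrightarrow> q \<in> carrier M \<Longrightarrow> f (madd M p q) = madd N (f p) (f q)"
  by (auto simp: mod_hom_def)

lemma mod_hom_act: "f \<in> mod_hom M N \<Longrightarrow> p \<in> carrier M \<Longrightarrow> f (act M p r) = act N (f p) r"
  by (auto simp: mod_hom_def)

text \<open>Zero equals \<open>act M (mzero M) 0\<close>, and acting by the scalar \<open>0\<close>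
  gives zero in \<open>N\<close> as well.\<close>

lemma mod_hom_mzero:
  assumes "right_module M" "right_module N" "f \<in> mod_hom M N"
  shows "f (mzero M) = mzero N"
proof -
  have "f (mzero M) = f (act M (mzero M) 0)"
    using assms by simp
  also have "\<dots> = mzero N"
    using assms by (simp add: mod_hom_act mod_hom_closed del: act_zero act_mzero)
      (simp add: mod_hom_closed)
  finally show ?thesis .
qed

lemma mod_hom_id: "(\<lambda>p. p) \<in> mod_hom M M"
  by (simp add: mod_hom_def)

lemma mod_hom_comp:
  "f \<in> mod_hom M N \<Longrightarrow> g \<in> mod_hom N L \<Longrightarrow> (\<lambda>p. g (f p)) \<in> mod_hom M L"
  by (auto simp: mod_hom_def Pi_iff)

lemma mod_hom_diff:
  assumes N: "right_module N" and f: "f \<in> mod_hom M N" and g: "g \<in> mod_hom M N"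
  shows "(\<lambda>p. madd N (f p) (act N (g p) (- 1))) \<in> mod_hom M N"
proof (rule mod_homI)
  fix p q r assume p: "p \<in> carrier M"
  note c = N mod_hom_closed [OF f] mod_hom_closed [OF g]
  show "madd N (f p) (act N (g p) (- 1)) \<in> carrier N" using p c by simp
  \<comment> \<open>The scalar \<open>-1\<close> is central, so it commutes with the action of
    \<open>r\<close>.\<close>
  have "act N (act N (g p) r) (- 1) = act N (act N (g p) (- 1)) r"
    using p c by (simp flip: act_mult)
  then show "madd N (f (act M p r)) (act N (g (act M p r)) (- 1))
    = act N (madd N (f p) (act N (g p) (- 1))) r"
    using p c by (simp add: mod_hom_act [OF f] mod_hom_act [OF g] act_madd)
  assume q: "q \<in> carrier M"
  show "madd N (f (madd M p q)) (act N (g (madd M p q)) (- 1))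
    = madd N (madd N (f p) (act N (g p) (- 1))) (madd N (f q) (act N (g q) (- 1)))"
    using p q c
    by (simp add: mod_hom_madd [OF f] mod_hom_madd [OF g] act_madd madd_assoc madd_lcomm)
qed

lemma mod_hom_add:
  assumes N: "right_module N" and f: "f \<in> mod_hom M N" and g: "g \<in> mod_hom M N"
  shows "(\<lambda>p. madd N (f p) (g p)) \<in> mod_hom M N"
  using assms mod_hom_closed [OF f] mod_hom_closed [OF g]
  by (intro mod_homI)
    (simp_all add: mod_hom_madd [OF f] mod_hom_madd [OF g] act_madd madd_assoc madd_lcomm
      mod_hom_act [OF f] mod_hom_act [OF g])

lemma mod_hom_restrict: "f \<in> mod_hom M N \<Longrightarrow> X \<subseteq> carrier M \<Longrightarrow> f \<in> mod_hom (M\<lparr>carrier := X\<rparr>) N"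
  by (auto simp: mod_hom_def subset_iff)

section \<open>Linear combinations of finitely many elements\<close>

primrec lin_comb :: "('r, 'm) rmodule \<Rightarrow> (nat \<Rightarrow> 'm) \<Rightarrow> (nat \<Rightarrow> 'r) \<Rightarrow> nat \<Rightarrow> 'm" where
  "lin_comb M g v 0 = mzero M"
| "lin_comb M g v (Suc n) = madd M (lin_comb M g v n) (act M (g n) (v n))"

lemma lin_comb_cong:
  "(\<And>j. j < n \<Longrightarrow> g j = g' j) \<Longrightarrow> (\<And>j. j < n \<Longrightarrow> v j = v' j) \<Longrightarrow>
    lin_comb M g v n = lin_comb M g' v' n"
  by (induction n) simp_all

lemma lin_comb_closed:
  "right_module M \<Longrightarrow> (\<And>j. j < n \<Longrightarrow> g j \<in> carrier M) \<Longrightarrow> lin_comb M g v n \<in> carrier M"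
  by (induction n) simp_all

lemma lin_comb_in_submodule:
  "is_submodule M X \<Longrightarrow> (\<And>j. j < n \<Longrightarrow> g j \<in> X) \<Longrightarrow> lin_comb M g v n \<in> X"
  by (induction n) (simp_all add: is_submodule_def)

lemma lin_comb_add:
  assumes "right_module M" "\<And>j. j < n \<Longrightarrow> g j \<in> carrier M"
  shows "lin_comb M g (\<lambda>j. v j + w j) n = madd M (lin_comb M g v n) (lin_comb M g w n)"
  using assms(2)
proof (induction n)
  case (Suc n)
  then show ?case
    using assms(1) by (simp add: act_add lin_comb_closed madd_assoc madd_lcomm)
qed (simp add: assms(1))

lemma lin_comb_act:
  assumes "right_module M" "\<And>j. j < n \<Longrightarrow> g j \<in> carrier M"
  shows "lin_comb M g (\<lambda>j. v j * r) n = act M (lin_comb M g v n) r"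
  using assms(2)
proof (induction n)
  case (Suc n)
  then show ?case
    using assms(1) by (simp add: act_mult act_madd lin_comb_closed)
qed (simp add: assms(1))

text \<open>Makes the value on a finitely supported sequence independent of the length at which the
  combination is cut off.\<close>

lemma lin_comb_extend:
  assumes "right_module M" "\<And>j. g j \<in> carrier M" "\<And>j. n \<le> j \<Longrightarrow> v j = 0" "n \<le> m"
  shows "lin_comb M g v m = lin_comb M g v n"
  using assms(4) by (induction m rule: dec_induct) (simp_all add: assms lin_comb_closed)

lemma mod_hom_lin_comb:
  assumes "right_module M" "right_module N" "f \<in> mod_hom M N" "\<And>j. j < n \<Longrightarrow> g j \<in> carrier M"
  shows "f (lin_comb M g v n) = lin_comb N (\<lambda>j. f (g j)) v n"
  using assms(4)
proof (induction n)
  case 0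
  then show ?case using assms by (simp add: mod_hom_mzero)
next
  case (Suc n)
  then show ?case
    using assms by (simp add: mod_hom_madd lin_comb_closed mod_hom_act)
qed

section \<open>Modules of functions\<close>

text \<open>One construction with pointwise operations for several later modules: finite free
  modules, the free module of countable rank, its submodules, and the test module for
  projectivity.\<close>

definition fun_module :: "('b \<Rightarrow> 'r::ring_1) set \<Rightarrow> ('r, 'b \<Rightarrow> 'r) rmodule" where
  "fun_module V = \<lparr>carrier = V, madd = (\<lambda>v w i. v i + w i), mzero = (\<lambda>_. 0), act = (\<lambda>v r i. v i * r)\<rparr>"

lemma fun_module_simps [simp]:
  "carrier (fun_module V) = V" "madd (fun_module V) = (\<lambda>v w i. v i + w i)"
  "mzero (fun_module V) = (\<lambda>_. 0)" "act (fun_module V) = (\<lambda>v r i. v i * r)"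
  by (simp_all add: fun_module_def)

lemma right_module_fun_module:
  assumes "\<And>v w. v \<in> V \<Longrightarrow> w \<in> V \<Longrightarrow> (\<lambda>i. v i + w i) \<in> V" "(\<lambda>_. 0) \<in> V"
    "\<And>v r. v \<in> V \<Longrightarrow> (\<lambda>i. v i * r) \<in> V"
  shows "right_module (fun_module V)"
  by (rule right_moduleI) (use assms in \<open>simp_all add: algebra_simps\<close>)

lemma lin_comb_fun_module: "lin_comb (fun_module V) g v n = (\<lambda>i. \<Sum>j<n. g j i * v j)"
  by (induction n) simp_all

section \<open>Finite free modules and their bases\<close>

lemma free_module_eq: "free_module k = fun_module {v. \<forall>i\<ge>k. v i = 0}"
  by (simp add: free_module_def fun_module_def)

lemma free_module_simps [simp]:
  "madd (free_module k) = (\<lambda>v w i. v i + w i)"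
  "mzero (free_module k) = (\<lambda>_. 0)" "act (free_module k) = (\<lambda>v r i. v i * r)"
  by (simp_all add: free_module_def)

lemma carrier_free_module: "v \<in> carrier (free_module k) \<longleftrightarrow> (\<forall>i\<ge>k. v i = 0)"
  by (simp add: free_module_def)

lemma right_module_free_module [simp]: "right_module (free_module k)"
  unfolding free_module_eq by (rule right_module_fun_module) auto

definition unit_vec :: "nat \<Rightarrow> nat \<Rightarrow> 'r::ring_1" where
  "unit_vec j i = (if i = j then 1 else 0)"

lemma unit_vec_closed [simp]: "j < n \<Longrightarrow> unit_vec j \<in> carrier (free_module n)"
  by (simp add: carrier_free_module unit_vec_def)

lemma lin_comb_unit_vec:
  assumes "v \<in> carrier (free_module n)"
  shows "lin_comb (free_module n) unit_vec v n = v"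
proof
  fix i
  have "(\<Sum>j<n. unit_vec j i * v j) = (\<Sum>j<n. if j = i then v j else 0)"
    by (rule sum.cong) (auto simp: unit_vec_def)
  also have "\<dots> = v i"
    using assms by (auto simp: carrier_free_module)
  finally show "lin_comb (free_module n) unit_vec v n i = v i"
    by (simp add: free_module_eq lin_comb_fun_module)
qed

lemma mod_hom_free_module_expand:
  assumes "right_module M" "f \<in> mod_hom (free_module n) M" "v \<in> carrier (free_module n)"
  shows "f v = lin_comb M (\<lambda>j. f (unit_vec j)) v n"
  using mod_hom_lin_comb [of "free_module n" M f n unit_vec v] lin_comb_unit_vec [of v n] assms
  by simp

lemma mod_hom_free_module_eqI:
  assumes "right_module M" "f \<in> mod_hom (free_module n) M" "g \<in> mod_hom (free_module n) M"
    "\<And>j. j < n \<Longrightarrow> f (unit_vec j) = g (unit_vec j)" "v \<in> carrier (free_module n)"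
  shows "f v = g v"
  using assms by (simp add: mod_hom_free_module_expand [of M _ n v] cong: lin_comb_cong)

lemma mod_hom_lin_comb_free:
  assumes "right_module M" "\<And>j. j < n \<Longrightarrow> g j \<in> carrier M"
  shows "(\<lambda>v. lin_comb M g v n) \<in> mod_hom (free_module n) M"
  using assms by (intro mod_homI) (simp_all add: lin_comb_closed lin_comb_add lin_comb_act)

lemma lin_comb_at_unit_vec:
  assumes "right_module M" "\<And>j. j < n \<Longrightarrow> g j \<in> carrier M" "j < n"
  shows "lin_comb M g (unit_vec j) n = g j"
proof -
  have "lin_comb M g (unit_vec j) m = (if j < m then g j else mzero M)" if "m \<le> n" for m
    using that assms by (induction m) (auto simp: unit_vec_def less_Suc_eq)
  then show ?thesis using assms by simp
qed

text \<open>Choose preimages of the images of the basis vectors. The modules \<open>A\<close> and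
  \<open>B\<close> may have any element types here, unlike in \<open>projective\<close>; that is
  what lets limits in other types be lifted against.\<close>

lemma lift_free_module:
  fixes A :: "('r::ring_1, 'm) rmodule"
  assumes A: "right_module A" and B: "right_module B" and g: "g \<in> mod_hom A B"
    and surj: "g ` carrier A = carrier B"
    and f: "f \<in> mod_hom (free_module n) B"
  shows "\<exists>h\<in>mod_hom (free_module n) A. \<forall>v\<in>carrier (free_module n). g (h v) = f v"
proof -
  have "\<forall>j. \<exists>a. j < n \<longrightarrow> a \<in> carrier A \<and> g a = f (unit_vec j)"
    using surj mod_hom_closed [OF f unit_vec_closed] by (metis imageE)
  then obtain a where a: "\<And>j. j < n \<Longrightarrow> a j \<in> carrier A" "\<And>j. j < n \<Longrightarrow> g (a j) = f (unit_vec j)"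
    by metis
  have h: "(\<lambda>v. lin_comb A a v n) \<in> mod_hom (free_module n) A"
    by (rule mod_hom_lin_comb_free) (use A a in auto)
  show ?thesis
  proof (intro bexI [OF _ h] ballI)
    fix v :: "nat \<Rightarrow> 'r" assume v: "v \<in> carrier (free_module n)"
    show "g (lin_comb A a v n) = f v"
      using mod_hom_free_module_eqI [OF B mod_hom_comp [OF h g] f _ v] a A
      by (simp add: lin_comb_at_unit_vec)
  qed
qed

section \<open>Matrices\<close>

lemma rect_mono: "x \<in> rect k l \<Longrightarrow> k \<le> k' \<Longrightarrow> l \<le> l' \<Longrightarrow> x \<in> rect k' l'"
  by (force simp: rect_def)

lemma rect_zero: "x \<in> rect k l \<Longrightarrow> k \<le> i \<or> l \<le> j \<Longrightarrow> x i j = 0"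
  by (force simp: rect_def)

lemma rectI: "(\<And>i j. k \<le> i \<or> l \<le> j \<Longrightarrow> x i j = 0) \<Longrightarrow> x \<in> rect k l"
  by (auto simp: rect_def not_le [symmetric])

lemma rect_imp_M_infty:
  assumes "x \<in> rect k l"
  shows "x \<in> M_infty"
proof -
  have "{(i, j). x i j \<noteq> 0} \<subseteq> {..<k} \<times> {..<l}"
    using assms by (auto simp: rect_def)
  then show ?thesis
    unfolding M_infty_def using finite_subset by blast
qed

lemma M_infty_imp_rect:
  assumes "x \<in> M_infty"
  obtains k where "x \<in> rect k k"
proof -
  let ?S = "{(i, j). x i j \<noteq> 0}"
  let ?T = "fst ` ?S \<union> snd ` ?S"
  have "finite ?T"
    using assms by (simp add: M_infty_def)
  then obtain k where k: "\<forall>i\<in>?T. i < k"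
    unfolding finite_nat_set_iff_bounded by blast
  have "i < k \<and> j < k" if "x i j \<noteq> 0" for i j
  proof -
    have "(i, j) \<in> ?S" using that by simp
    then have "fst (i, j) \<in> ?T" "snd (i, j) \<in> ?T" by blast+
    then show ?thesis using k by auto
  qed
  then have "x \<in> rect k k"
    by (simp add: rect_def)
  then show ?thesis by (rule that)
qed

text \<open>A size bound on one factor turns \<open>Sum_any\<close> into an ordinary finite sum over
  the inner index.\<close>

lemma mat_mult_left_rect: "x \<in> rect a b \<Longrightarrow> (x \<odot> y) i j = (\<Sum>k<b. x i k * y k j)"
  unfolding mat_mult_def by (rule Sum_any.expand_superset) (auto simp: rect_zero not_le [symmetric])

lemma mat_mult_right_rect: "y \<in> rect b c \<Longrightarrow> (x \<odot> y) i j = (\<Sum>k<b. x i k * y k j)"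
  unfolding mat_mult_def by (rule Sum_any.expand_superset) (auto simp: rect_zero not_le [symmetric])

lemma mat_vec_rect: "x \<in> rect a b \<Longrightarrow> mat_vec x v i = (\<Sum>j<b. x i j * v j)"
  unfolding mat_vec_def by (rule Sum_any.expand_superset) (auto simp: rect_zero not_le [symmetric])

lemma mat_mult_rect [intro]:
  assumes "x \<in> rect a b" "y \<in> rect c d"
  shows "x \<odot> y \<in> rect a d"
  by (rule rectI) (auto simp: mat_mult_left_rect [OF assms(1)] rect_zero [OF assms(1)]
      rect_zero [OF assms(2)])

text \<open>\<open>Sum_any\<close> is zero on infinite supports, so associativity depends on
  finiteness. A bound on the middle factor makes both inner summations finite, and they can be
  swapped.\<close>

lemma mat_mult_assoc:
  assumes y: "y \<in> rect b c"
  shows "x \<odot> y \<odot> z = x \<odot> (y \<odot> z)"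
proof (intro ext)
  fix i j
  have "(x \<odot> y \<odot> z) i j = (\<Sum>k<c. (x \<odot> y) i k * z k j)"
    unfolding mat_mult_def [of "x \<odot> y"]
    by (rule Sum_any.expand_superset) (auto simp: mat_mult_right_rect [OF y] rect_zero [OF y] not_le [symmetric])
  also have "\<dots> = (\<Sum>k<c. \<Sum>l<b. x i l * y l k * z k j)"
    by (simp add: mat_mult_right_rect [OF y] sum_distrib_right)
  also have "\<dots> = (\<Sum>l<b. \<Sum>k<c. x i l * (y l k * z k j))"
    by (subst sum.swap) (simp add: mult.assoc)
  also have "\<dots> = (\<Sum>l<b. x i l * (y \<odot> z) l j)"
    by (simp add: mat_mult_left_rect [OF y] sum_distrib_left)
  also have "\<dots> = (x \<odot> (y \<odot> z)) i j"
    unfolding mat_mult_def [of x]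
    by (rule Sum_any.expand_superset [symmetric])
      (auto simp: mat_mult_left_rect [OF y] rect_zero [OF y] not_le [symmetric])
  finally show "(x \<odot> y \<odot> z) i j = (x \<odot> (y \<odot> z)) i j" .
qed

lemma mat_vec_mat_mult:
  assumes y: "y \<in> rect b c"
  shows "mat_vec (x \<odot> y) v = mat_vec x (mat_vec y v)"
proof -
  \<comment> \<open>A vector is read as the matrix all of whose columns are \<open>v\<close>, so
    that the claim becomes associativity of the matrix product.\<close>
  have "mat_vec x v = (\<lambda>i. (x \<odot> (\<lambda>i j. v i)) i 0)" for x and v :: "nat \<Rightarrow> 'a"
    by (simp add: mat_vec_def mat_mult_def)
  moreover have "(\<lambda>i j. (y \<odot> (\<lambda>i j. v i)) i 0) = y \<odot> (\<lambda>i j. v i)"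
    by (simp add: mat_mult_def)
  ultimately show ?thesis
    by (simp add: mat_mult_assoc [OF y])
qed

definition mat_trunc :: "nat \<Rightarrow> nat \<Rightarrow> 'a::ring mat \<Rightarrow> 'a mat" where
  "mat_trunc k l x = (\<lambda>i j. if i < k \<and> j < l then x i j else 0)"

lemma mat_trunc_rect: "mat_trunc k l x \<in> rect k l"
  by (simp add: rect_def mat_trunc_def)

text \<open>In the double sum for \<open>r b t\<close>, entries of \<open>r\<close> and
  \<open>t\<close> that face zeros of \<open>b\<close> contribute nothing, and rows of
  \<open>r\<close> or columns of \<open>t\<close> outside the size of \<open>a\<close> only produce
  zeros of \<open>a\<close>. Cutting them off leaves the product unchanged.\<close>

lemma s_le1_rect:
  assumes "s_le1 a b" and a: "a \<in> rect k l" and b: "b \<in> rect k' l'"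
  obtains r t where "r \<in> rect k k'" "t \<in> rect l' l" "a = r \<odot> b \<odot> t"
proof -
  obtain r t where rt: "r \<in> M_infty" "t \<in> M_infty" "a = r \<odot> b \<odot> t"
    using assms(1) by (auto simp: s_le1_def)
  let ?r = "mat_trunc k k' r" and ?t = "mat_trunc l' l t"
  have eq: "(r \<odot> b \<odot> t) i j = (\<Sum>q<l'. \<Sum>p<k'. r i p * b p q * t q j)" for r t i j
  proof -
    have "(r \<odot> b \<odot> t) i j = (\<Sum>q<l'. (r \<odot> b) i q * t q j)"
      unfolding mat_mult_def [of "r \<odot> b"]
      by (rule Sum_any.expand_superset)
        (auto simp: mat_mult_right_rect [OF b] rect_zero [OF b] not_le [symmetric])
    then show ?thesis
      by (simp add: mat_mult_right_rect [OF b] sum_distrib_right)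
  qed
  have "a i j = (?r \<odot> b \<odot> ?t) i j" for i j
  proof (cases "i < k \<and> j < l")
    case True
    then show ?thesis
      unfolding rt(3) eq by (simp add: mat_trunc_def)
  next
    case False
    then show ?thesis
      unfolding eq using rect_zero [OF a, of i j] by (auto simp: mat_trunc_def)
  qed
  then have "a = ?r \<odot> b \<odot> ?t"
    by (intro ext) simp
  then show ?thesis
    using that mat_trunc_rect by blast
qed

section \<open>Matrices as homomorphisms of free modules\<close>

lemma mat_vec_hom:
  assumes "x \<in> rect k n"
  shows "mat_vec x \<in> mod_hom (free_module n) (free_module k)"
  by (rule mod_homI)
    (auto simp: carrier_free_module mat_vec_rect [OF assms] rect_zero [OF assms] fun_eq_iff
      distrib_left sum.distrib sum_distrib_right mult.assoc)

lemma mat_vec_unit_vec: "mat_vec x (unit_vec j) = (\<lambda>i. x i j)"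
proof
  fix i
  have "mat_vec x (unit_vec j) i = (\<Sum>l\<in>{j}. x i l * unit_vec j l)"
    unfolding mat_vec_def by (rule Sum_any.expand_superset) (auto simp: unit_vec_def)
  then show "mat_vec x (unit_vec j) i = x i j"
    by (simp add: unit_vec_def)
qed

text \<open>Evaluation at unit vectors reads off columns. This turns identities of matrices into
  identities of maps, in which the cocones can be used.\<close>

lemma rect_eqI:
  assumes "x \<in> rect k n" "y \<in> rect k' n"
    "\<And>v. v \<in> carrier (free_module n) \<Longrightarrow> mat_vec x v = mat_vec y v"
  shows "x = y"
proof (intro ext)
  fix i j
  show "x i j = y i j"
  proof (cases "j < n")
    case True
    then show ?thesis
      using assms(3) [of "unit_vec j"] by (simp add: mat_vec_unit_vec fun_eq_iff)
  next
    case False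
    then show ?thesis
      using assms(1,2) by (simp add: rect_zero)
  qed
qed

lemma mat_of_columns:
  assumes "\<And>j. j < n \<Longrightarrow> w j \<in> carrier (free_module k)"
  shows "(\<lambda>i j. if j < n then w j i else 0) \<in> rect k n"
    and "mat_vec (\<lambda>i j. if j < n then w j i else 0) v = lin_comb (free_module k) w v n"
proof -
  show r: "(\<lambda>i j. if j < n then w j i else 0) \<in> rect k n"
    using assms by (intro rectI) (auto simp: carrier_free_module)
  show "mat_vec (\<lambda>i j. if j < n then w j i else 0) v = lin_comb (free_module k) w v n"
    by (simp add: free_module_eq lin_comb_fun_module mat_vec_rect [OF r] fun_eq_iff)
qed

section \<open>Direct limits\<close>

definition directed_system :: "(nat \<Rightarrow> ('r::ring_1, 'm) rmodule) \<Rightarrow> (nat \<Rightarrow> 'm \<Rightarrow> 'm) \<Rightarrow> bool" where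
  "directed_system M f \<longleftrightarrow> (\<forall>i. right_module (M i) \<and> f i \<in> mod_hom (M i) (M (Suc i)))"

lemma push_add: "push f i (c + d) p = push f (i + c) d (push f i c p)"
  by (induction d) (simp_all add: add.assoc)

lemma push_eq_push_later:
  assumes "push f i c p = push f j d q" "i + c = j + d"
  shows "push f i (c + e) p = push f j (d + e) q"
  using assms by (simp add: push_add)

context
  fixes M :: "nat \<Rightarrow> ('r::ring_1, 'm) rmodule" and f
  assumes sys: "directed_system M f"
begin

lemma system_module [simp]: "right_module (M i)"
  using sys by (simp add: directed_system_def)

lemma push_hom: "push f i d \<in> mod_hom (M i) (M (i + d))"
proof (induction d)
  case 0
  then show ?case by (simp add: mod_hom_def)
next
  case (Suc d)
  have "f (i + d) \<in> mod_hom (M (i + d)) (M (Suc (i + d)))"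
    using sys by (simp add: directed_system_def)
  from mod_hom_comp [OF Suc this] show ?case
    by simp
qed

lemma push_closed [simp]: "p \<in> carrier (M i) \<Longrightarrow> push f i d p \<in> carrier (M (i + d))"
  by (rule mod_hom_closed [OF push_hom])

lemma equiv_dirlim_rel: "equiv (SIGMA i:UNIV. carrier (M i)) (dirlim_rel M f)"
proof (rule equivI)
  show "dirlim_rel M f \<subseteq> (SIGMA i:UNIV. carrier (M i)) \<times> (SIGMA i:UNIV. carrier (M i))"
    by (auto simp: dirlim_rel_def)
  show "refl_on (SIGMA i:UNIV. carrier (M i)) (dirlim_rel M f)"
    by (auto simp: refl_on_def dirlim_rel_def)
  show "sym (dirlim_rel M f)"
  proof (rule symI)
    fix a b assume "(a, b) \<in> dirlim_rel M f"
    then show "(b, a) \<in> dirlim_rel M f"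
      unfolding dirlim_rel_def by (clarsimp, metis)
  qed
  show "trans (dirlim_rel M f)"
  proof (rule transI, clarify)
    fix i p j q l r
    assume "((i, p), (j, q)) \<in> dirlim_rel M f" "((j, q), (l, r)) \<in> dirlim_rel M f"
    then obtain c d c' d' where c: "p \<in> carrier (M i)" "r \<in> carrier (M l)"
        "i + c = j + d" "push f i c p = push f j d q"
        "j + c' = l + d'" "push f j c' q = push f l d' r"
      by (auto simp: dirlim_rel_def)
    \<comment> \<open>The first equality holds at stage \<open>j + d\<close>, the second at
      \<open>j + c'\<close>; both are pushed on to stage \<open>j + d + c'\<close>.\<close>
    have "push f i (c + c') p = push f j (d + c') q"
      using c by (intro push_eq_push_later)
    also have "\<dots> = push f j (c' + d) q"
      by (simp add: add.commute)
    also have "\<dots> = push f l (d' + d) r"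
      using c by (intro push_eq_push_later)
    finally have "push f i (c + c') p = push f l (d' + d) r" .
    moreover have "i + (c + c') = l + (d' + d)"
      using c by simp
    ultimately show "((i, p), (l, r)) \<in> dirlim_rel M f"
      by (simp add: dirlim_rel_def c(1,2)) blast
  qed
qed

abbreviation lim_class where "lim_class i p \<equiv> dirlim_rel M f `` {(i, p)}"

lemma lim_class_eq_iff:
  assumes "p \<in> carrier (M i)" "q \<in> carrier (M j)"
  shows "lim_class i p = lim_class j q \<longleftrightarrow> (\<exists>c d. i + c = j + d \<and> push f i c p = push f j d q)"
  using eq_equiv_class_iff [OF equiv_dirlim_rel, of "(i, p)" "(j, q)"] assms
  by (simp add: dirlim_rel_def)

lemma lim_class_eq_same_iff:
  assumes "p \<in> carrier (M i)" "q \<in> carrier (M i)"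
  shows "lim_class i p = lim_class i q \<longleftrightarrow> (\<exists>d. push f i d p = push f i d q)"
  unfolding lim_class_eq_iff [OF assms] by auto

lemma lim_class_push:
  assumes "p \<in> carrier (M i)"
  shows "lim_class (i + d) (push f i d p) = lim_class i p"
proof -
  have "i + d + 0 = i + d \<and> push f (i + d) 0 (push f i d p) = push f i d p"
    by simp
  then show ?thesis
    using assms lim_class_eq_iff [of "push f i d p" "i + d" p i] push_closed by blast
qed

lemma mem_lim_class_iff:
  "p \<in> carrier (M i) \<Longrightarrow> (j, q) \<in> lim_class i p \<longleftrightarrow>
    q \<in> carrier (M j) \<and> (\<exists>c d. i + c = j + d \<and> push f i c p = push f j d q)"
  by (auto simp: dirlim_rel_def)

lemma dirlim_carrier: "carrier (dirlim M f) = {lim_class i p | i p. p \<in> carrier (M i)}"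
  by (auto simp: dirlim_def quotient_def)

text \<open>Associativity involves three classes, which are all moved to stage
  \<open>i + j + k\<close>; two classes are treated by repeating one of them.\<close>

lemma dirlim_carrierE:
  assumes "C \<in> carrier (dirlim M f)" "D \<in> carrier (dirlim M f)" "E \<in> carrier (dirlim M f)"
  obtains i p q r where "p \<in> carrier (M i)" "q \<in> carrier (M i)" "r \<in> carrier (M i)"
    "C = lim_class i p" "D = lim_class i q" "E = lim_class i r"
proof -
  obtain i p j q k r where p: "p \<in> carrier (M i)" "q \<in> carrier (M j)" "r \<in> carrier (M k)"
    "C = lim_class i p" "D = lim_class j q" "E = lim_class k r"
    using assms unfolding dirlim_carrier by blast
  have ex: "\<exists>p' \<in> carrier (M (i + j + k)). lim_class l p = lim_class (i + j + k) p'"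
    if "p \<in> carrier (M l)" "l \<le> i + j + k" for l p
    using that lim_class_push [of p l "i + j + k - l"] push_closed [of p l "i + j + k - l"]
    by (intro bexI [of _ "push f l (i + j + k - l) p"]) simp_all
  show ?thesis
    using ex [OF p(1)] ex [OF p(2)] ex [OF p(3)] p(4-6) that by auto
qed

lemma dirlim_madd:
  assumes p: "p \<in> carrier (M i)" and q: "q \<in> carrier (M i)"
  shows "madd (dirlim M f) (lim_class i p) (lim_class i q) = lim_class i (madd (M i) p q)"
proof -
  have "(THE E. \<exists>j p' q'. (j, p') \<in> lim_class i p \<and> (j, q') \<in> lim_class i q \<and>
      E = lim_class j (madd (M j) p' q')) = lim_class i (madd (M i) p q)"
  proof (rule the_equality)
    have "(i, p) \<in> lim_class i p" "(i, q) \<in> lim_class i q"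
      unfolding mem_lim_class_iff [OF p] mem_lim_class_iff [OF q] using p q by blast+
    then show "\<exists>j p' q'. (j, p') \<in> lim_class i p \<and> (j, q') \<in> lim_class i q \<and>
        lim_class i (madd (M i) p q) = lim_class j (madd (M j) p' q')"
      by blast
  next
    fix E assume "\<exists>j p' q'. (j, p') \<in> lim_class i p \<and> (j, q') \<in> lim_class i q \<and>
      E = lim_class j (madd (M j) p' q')"
    then obtain j p' q' c d c' d' where E: "E = lim_class j (madd (M j) p' q')"
      and p': "p' \<in> carrier (M j)" "i + c = j + d" "push f i c p = push f j d p'"
      and q': "q' \<in> carrier (M j)" "i + c' = j + d'" "push f i c' q = push f j d' q'"
      unfolding mem_lim_class_iff [OF p] mem_lim_class_iff [OF q] by blast
    \<comment> \<open>The representatives of the two classes merge after different numbers of steps.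
      Pushing each equality on by the other's amount brings both to the stage
      \<open>j + (d + c') = i + (c + c')\<close>, where the sums can be compared.\<close>
    have "push f j (d + c') p' = push f i (c + c') p"
      using p' by (intro push_eq_push_later) auto
    moreover have "push f j (d' + c) q' = push f i (c' + c) q"
      using q' by (intro push_eq_push_later) auto
    moreover have "d' + c = d + c'" "c' + c = c + c'"
      using p' q' by linarith+
    ultimately have "push f j (d + c') (madd (M j) p' q') = push f i (c + c') (madd (M i) p q)"
      using p' q' p q
      by (simp add: mod_hom_madd [OF push_hom]) (metis add.assoc)
    moreover have "j + (d + c') = i + (c + c')"
      using p' by simp
    moreover have mem: "madd (M j) p' q' \<in> carrier (M j)" "madd (M i) p q \<in> carrier (M i)"
      using p q p' q' by simp_all
    ultimately show "E = lim_class i (madd (M i) p q)"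
      unfolding E lim_class_eq_iff [OF mem] by blast
  qed
  then show ?thesis
    by (simp add: dirlim_def)
qed

lemma dirlim_act:
  assumes p: "p \<in> carrier (M i)"
  shows "act (dirlim M f) (lim_class i p) r = lim_class i (act (M i) p r)"
proof -
  have "(THE E. \<exists>j p'. (j, p') \<in> lim_class i p \<and>
      E = lim_class j (act (M j) p' r)) = lim_class i (act (M i) p r)"
  proof (rule the_equality)
    have "(i, p) \<in> lim_class i p"
      unfolding mem_lim_class_iff [OF p] using p by blast
    then show "\<exists>j p'. (j, p') \<in> lim_class i p \<and>
        lim_class i (act (M i) p r) = lim_class j (act (M j) p' r)"
      by blast
  next
    fix E assume "\<exists>j p'. (j, p') \<in> lim_class i p \<and> E = lim_class j (act (M j) p' r)"
    then obtain j p' c d where E: "E = lim_class j (act (M j) p' r)"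
      and p': "p' \<in> carrier (M j)" "i + c = j + d" "push f i c p = push f j d p'"
      unfolding mem_lim_class_iff [OF p] by blast
    have "push f j d (act (M j) p' r) = push f i c (act (M i) p r)"
      using p' p by (simp add: mod_hom_act [OF push_hom])
    moreover have mem: "act (M j) p' r \<in> carrier (M j)" "act (M i) p r \<in> carrier (M i)"
      using p p' by simp_all
    ultimately show "E = lim_class i (act (M i) p r)"
      unfolding E lim_class_eq_iff [OF mem] using p'(2) by metis
  qed
  then show ?thesis
    by (simp add: dirlim_def)
qed

lemma dirlim_mzero: "mzero (dirlim M f) = lim_class i (mzero (M i))"
proof -
  have "lim_class 0 (mzero (M 0)) = lim_class i (push f 0 i (mzero (M 0)))"
    using lim_class_push [of "mzero (M 0)" 0 i] by simp
  also have "push f 0 i (mzero (M 0)) = mzero (M i)"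
    using mod_hom_mzero [OF _ _ push_hom [of 0 i]] by simp
  finally show ?thesis
    by (simp add: dirlim_def)
qed

lemma right_module_dirlim: "right_module (dirlim M f)"
proof (rule right_moduleI)
  let ?L = "dirlim M f"
  fix C D E r s
  have lim_mem: "lim_class i p \<in> carrier ?L" if "p \<in> carrier (M i)" for i p
    using that by (auto simp: dirlim_carrier)
  show "mzero ?L \<in> carrier ?L"
    unfolding dirlim_mzero [of 0] by (simp add: lim_mem)
  assume C: "C \<in> carrier ?L"
  then obtain i p where p: "p \<in> carrier (M i)" "C = lim_class i p"
    by (auto simp: dirlim_carrier)
  show "madd ?L (mzero ?L) C = C"
    unfolding dirlim_mzero [of i] using p by (simp add: dirlim_madd)
  show "act ?L C r \<in> carrier ?L" "act ?L C (r + s) = madd ?L (act ?L C r) (act ?L C s)"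
    "act ?L C (r * s) = act ?L (act ?L C r) s" "act ?L C 1 = C"
    using p by (simp_all add: dirlim_act dirlim_madd act_add act_mult lim_mem)
  show "act ?L C 0 = mzero ?L"
    unfolding dirlim_mzero [of i] using p by (simp add: dirlim_act)
  assume D: "D \<in> carrier ?L"
  obtain i p q where pq: "p \<in> carrier (M i)" "q \<in> carrier (M i)" "C = lim_class i p" "D = lim_class i q"
    using dirlim_carrierE [OF C D D] by metis
  show "madd ?L C D \<in> carrier ?L" "madd ?L C D = madd ?L D C"
    "act ?L (madd ?L C D) r = madd ?L (act ?L C r) (act ?L D r)"
    using pq by (simp_all add: dirlim_madd dirlim_act lim_mem act_madd madd_comm)
  assume E: "E \<in> carrier ?L"
  obtain i p q t where "p \<in> carrier (M i)" "q \<in> carrier (M i)" "t \<in> carrier (M i)"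
    "C = lim_class i p" "D = lim_class i q" "E = lim_class i t"
    using dirlim_carrierE [OF C D E] by metis
  then show "madd ?L (madd ?L C D) E = madd ?L C (madd ?L D E)"
    by (simp add: dirlim_madd madd_assoc)
qed

end

text \<open>\<open>dirlim\<close> has elements of one particular type. This predicate applies to
  modules of any type and is transported along isomorphisms, so the construction by equivalence
  classes is not looked into again.\<close>

definition is_dirlim ::
    "('r::ring_1, 'p) rmodule \<Rightarrow> (nat \<Rightarrow> ('r, 'm) rmodule) \<Rightarrow> (nat \<Rightarrow> 'm \<Rightarrow> 'm) \<Rightarrow>
      (nat \<Rightarrow> 'm \<Rightarrow> 'p) \<Rightarrow> bool" where
  "is_dirlim P M f \<phi> \<longleftrightarrow> right_module P \<and> directed_system M f \<and>
    (\<forall>i. \<phi> i \<in> mod_hom (M i) P) \<and>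
    (\<forall>i. \<forall>v\<in>carrier (M i). \<phi> (Suc i) (f i v) = \<phi> i v) \<and>
    (\<forall>p\<in>carrier P. \<exists>i. \<exists>v\<in>carrier (M i). \<phi> i v = p) \<and>
    (\<forall>i. \<forall>v\<in>carrier (M i). \<forall>w\<in>carrier (M i). \<phi> i v = \<phi> i w \<longrightarrow>
      (\<exists>d. push f i d v = push f i d w))"

lemma is_dirlimI:
  assumes "right_module P" "directed_system M f" "\<And>i. \<phi> i \<in> mod_hom (M i) P"
    "\<And>i v. v \<in> carrier (M i) \<Longrightarrow> \<phi> (Suc i) (f i v) = \<phi> i v"
    "\<And>p. p \<in> carrier P \<Longrightarrow> \<exists>i. \<exists>v\<in>carrier (M i). \<phi> i v = p"
    "\<And>i v w. v \<in> carrier (M i) \<Longrightarrow> w \<in> carrier (M i) \<Longrightarrow> \<phi> i v = \<phi> i w \<Longrightarrow>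
      \<exists>d. push f i d v = push f i d w"
  shows "is_dirlim P M f \<phi>"
  unfolding is_dirlim_def using assms by blast

lemma is_dirlim_dirlim:
  assumes sys: "directed_system M f"
  shows "is_dirlim (dirlim M f) M f (\<lambda>i p. dirlim_rel M f `` {(i, p)})"
proof (rule is_dirlimI)
  fix i
  show "(\<lambda>p. dirlim_rel M f `` {(i, p)}) \<in> mod_hom (M i) (dirlim M f)"
    using sys by (intro mod_homI) (auto simp: dirlim_carrier dirlim_madd dirlim_act)
  fix v assume v: "v \<in> carrier (M i)"
  show "dirlim_rel M f `` {(Suc i, f i v)} = dirlim_rel M f `` {(i, v)}"
    using lim_class_push [OF sys v, of 1] by simp
  fix w assume w: "w \<in> carrier (M i)"
    and "dirlim_rel M f `` {(i, v)} = dirlim_rel M f `` {(i, w)}"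
  then show "\<exists>d. push f i d v = push f i d w"
    using lim_class_eq_same_iff [OF sys v w] by simp
next
  fix p assume "p \<in> carrier (dirlim M f)"
  then show "\<exists>i. \<exists>v\<in>carrier (M i). dirlim_rel M f `` {(i, v)} = p"
    using sys by (auto simp: dirlim_carrier)
qed (use sys in \<open>simp_all add: right_module_dirlim\<close>)

context
  fixes P :: "('r::ring_1, 'p) rmodule" and M :: "nat \<Rightarrow> ('r, 'm) rmodule" and f \<phi>
  assumes lim: "is_dirlim P M f \<phi>"
begin

lemma is_dirlim_module: "right_module P"
  using lim by (simp add: is_dirlim_def)

lemma is_dirlim_system: "directed_system M f"
  using lim by (simp add: is_dirlim_def)

lemma is_dirlim_hom: "\<phi> i \<in> mod_hom (M i) P"
  using lim by (simp add: is_dirlim_def)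

lemma is_dirlim_closed: "v \<in> carrier (M i) \<Longrightarrow> \<phi> i v \<in> carrier P"
  using mod_hom_closed [OF is_dirlim_hom] .

lemma is_dirlim_compat: "v \<in> carrier (M i) \<Longrightarrow> \<phi> (Suc i) (f i v) = \<phi> i v"
  using lim by (simp add: is_dirlim_def)

lemma is_dirlim_push: "v \<in> carrier (M i) \<Longrightarrow> \<phi> (i + d) (push f i d v) = \<phi> i v"
proof (induction d)
  case (Suc d)
  then show ?case
    using is_dirlim_compat [OF push_closed [OF is_dirlim_system], of v i d] by simp
qed simp

text \<open>The claim covers all late stages, so that finitely many elements can be represented at a
  common one.\<close>

lemma is_dirlim_eventually_mem:
  assumes "p \<in> carrier P"
  obtains i where "\<And>k. i \<le> k \<Longrightarrow> \<exists>v\<in>carrier (M k). \<phi> k v = p"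
proof -
  obtain i v where v: "v \<in> carrier (M i)" "\<phi> i v = p"
    using lim assms unfolding is_dirlim_def by blast
  have "\<exists>v\<in>carrier (M k). \<phi> k v = p" if "i \<le> k" for k
    using is_dirlim_push [OF v(1), of "k - i"] push_closed [OF is_dirlim_system v(1), of "k - i"] v(2) that
    by (intro bexI [of _ "push f i (k - i) v"]) simp_all
  then show ?thesis
    by (rule that)
qed

lemma is_dirlim_eventually_eq:
  assumes "v \<in> carrier (M i)" "w \<in> carrier (M i)" "\<phi> i v = \<phi> i w"
  obtains d where "\<And>e. d \<le> e \<Longrightarrow> push f i e v = push f i e w"
proof -
  obtain d where d: "push f i d v = push f i d w"
    using lim assms unfolding is_dirlim_def by blast
  have "push f i e v = push f i e w" if "d \<le> e" for e
    using push_eq_push_later [OF d, of "e - d"] that by simp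
  then show ?thesis
    by (rule that)
qed

lemma is_dirlim_eventually_mem2:
  assumes "p \<in> carrier P" "q \<in> carrier P"
  obtains i v w where "i0 \<le> i" "v \<in> carrier (M i)" "w \<in> carrier (M i)" "\<phi> i v = p" "\<phi> i w = q"
proof -
  obtain i where i: "\<And>k. i \<le> k \<Longrightarrow> \<exists>v\<in>carrier (M k). \<phi> k v = p"
    using is_dirlim_eventually_mem [OF assms(1)] by blast
  obtain j where j: "\<And>k. j \<le> k \<Longrightarrow> \<exists>v\<in>carrier (M k). \<phi> k v = q"
    using is_dirlim_eventually_mem [OF assms(2)] by blast
  show ?thesis
    using i [of "max i0 (max i j)"] j [of "max i0 (max i j)"] that [of "max i0 (max i j)"]
    by (auto simp: max.coboundedI1 max.coboundedI2)
qed

text \<open>The universal property, for maps given only from stage \<open>i0\<close> on: every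
  element has a representative that late. This form is what \<open>limit_partial_inverse\<close>
  uses, whose maps begin at stage \<open>i\<close>.\<close>

lemma is_dirlim_induced:
  assumes h: "\<And>i. i0 \<le> i \<Longrightarrow> h i \<in> mod_hom (M i) A"
    and compat: "\<And>i v. i0 \<le> i \<Longrightarrow> v \<in> carrier (M i) \<Longrightarrow> h (Suc i) (f i v) = h i v"
  shows "\<exists>H\<in>mod_hom P A. \<forall>i\<ge>i0. \<forall>v\<in>carrier (M i). H (\<phi> i v) = h i v"
proof -
  note sys = is_dirlim_system
  have h_push: "h (i + d) (push f i d v) = h i v" if "i0 \<le> i" "v \<in> carrier (M i)" for i v d
  proof (induction d)
    case (Suc d)
    then show ?case
      using compat [of "i + d" "push f i d v"] push_closed [OF sys that(2)] that by simp
  qed simp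
  \<comment> \<open>Both representatives are pushed to stage \<open>i + j\<close>, and from there to
    a stage where they coincide; \<open>h\<close> is constant along the way.\<close>
  have unique: "h i v = h j w"
    if i: "i0 \<le> i" "v \<in> carrier (M i)" and j: "i0 \<le> j" "w \<in> carrier (M j)"
      and eq: "\<phi> i v = \<phi> j w" for i j v w
  proof -
    define v' w' where "v' = push f i j v" and "w' = push f j i w"
    have mem: "v' \<in> carrier (M (i + j))" "w' \<in> carrier (M (i + j))"
      using push_closed [OF sys i(2), of j] push_closed [OF sys j(2), of i]
      by (simp_all add: v'_def w'_def add.commute)
    have "\<phi> (i + j) v' = \<phi> (i + j) w'"
      using is_dirlim_push [OF i(2), of j] is_dirlim_push [OF j(2), of i] eq
      by (simp add: v'_def w'_def add.commute)
    then obtain d where d: "push f (i + j) d v' = push f (i + j) d w'"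
      using is_dirlim_eventually_eq [OF mem] by blast
    have "h i v = h (i + j) v'"
      using h_push [OF i, of j] by (simp add: v'_def)
    also have "\<dots> = h (i + j) w'"
      using h_push [OF _ mem(1), of d] h_push [OF _ mem(2), of d] d i by simp
    also have "\<dots> = h j w"
      using h_push [OF j, of i] by (simp add: w'_def add.commute)
    finally show ?thesis .
  qed
  define H where "H p = (THE a. \<exists>i\<ge>i0. \<exists>v\<in>carrier (M i). \<phi> i v = p \<and> a = h i v)" for p
  have H: "H (\<phi> i v) = h i v" if "i0 \<le> i" "v \<in> carrier (M i)" for i v
    unfolding H_def by (rule the_equality) (use that unique in blast)+
  have "H \<in> mod_hom P A"
  proof (rule mod_homI)
    fix p q r assume p: "p \<in> carrier P"
    obtain i v where v: "i0 \<le> i" "v \<in> carrier (M i)" "\<phi> i v = p"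
      using is_dirlim_eventually_mem2 [OF p p] by metis
    show "H p \<in> carrier A"
      using H [OF v(1,2)] mod_hom_closed [OF h [OF v(1)] v(2)] v(3) by simp
    have "act P p r = \<phi> i (act (M i) v r)"
      using mod_hom_act [OF is_dirlim_hom v(2)] v(3) by simp
    then show "H (act P p r) = act A (H p) r"
      using H [OF v(1,2)] H [OF v(1), of "act (M i) v r"] mod_hom_act [OF h [OF v(1)] v(2)] v
        system_module [OF sys, of i] by simp
    assume q: "q \<in> carrier P"
    obtain i v w where v: "i0 \<le> i" "v \<in> carrier (M i)" "w \<in> carrier (M i)" "\<phi> i v = p" "\<phi> i w = q"
      using is_dirlim_eventually_mem2 [OF p q] by metis
    have "madd P p q = \<phi> i (madd (M i) v w)"
      using mod_hom_madd [OF is_dirlim_hom v(2,3)] v(4,5) by simp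
    then show "H (madd P p q) = madd A (H p) (H q)"
      using H [OF v(1,2)] H [OF v(1,3)] H [OF v(1), of "madd (M i) v w"]
        mod_hom_madd [OF h [OF v(1)] v(2,3)] v system_module [OF sys, of i] by simp
  qed
  with H show ?thesis
    by blast
qed

lemma is_dirlim_iso:
  assumes g: "g \<in> mod_hom P Q" and bij: "bij_betw g (carrier P) (carrier Q)" and Q: "right_module Q"
  shows "is_dirlim Q M f (\<lambda>i v. g (\<phi> i v))"
proof (rule is_dirlimI)
  fix i
  show "(\<lambda>v. g (\<phi> i v)) \<in> mod_hom (M i) Q"
    by (rule mod_hom_comp [OF is_dirlim_hom g])
  fix v assume v: "v \<in> carrier (M i)"
  show "g (\<phi> (Suc i) (f i v)) = g (\<phi> i v)"
    by (simp add: is_dirlim_compat v)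
  fix w assume w: "w \<in> carrier (M i)" and "g (\<phi> i v) = g (\<phi> i w)"
  then have "\<phi> i v = \<phi> i w"
    using bij v is_dirlim_closed by (auto simp: bij_betw_def inj_on_def)
  then show "\<exists>d. push f i d v = push f i d w"
    using is_dirlim_eventually_eq [OF v w] by blast
next
  fix q assume "q \<in> carrier Q"
  then obtain p where p: "p \<in> carrier P" "g p = q"
    using bij by (metis bij_betw_def imageE)
  then show "\<exists>i. \<exists>v\<in>carrier (M i). g (\<phi> i v) = q"
    using is_dirlim_eventually_mem [OF p(1)] by blast
qed (use Q is_dirlim_system in auto)

text \<open>The induced map is injective because elements with equal images in \<open>Q\<close>
  become equal at a finite stage, hence are equal in \<open>P\<close>; it is surjective because the
  \<open>\<chi> i\<close> are jointly surjective.\<close>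

lemma is_dirlim_unique:
  assumes lim': "is_dirlim Q M f \<chi>"
  shows "mod_isomorphic P Q"
proof -
  obtain H where H: "H \<in> mod_hom P Q" "\<And>i v. v \<in> carrier (M i) \<Longrightarrow> H (\<phi> i v) = \<chi> i v"
    using is_dirlim_induced [of 0 \<chi> Q] lim' by (auto simp: is_dirlim_def)
  have "inj_on H (carrier P)"
  proof (rule inj_onI)
    fix p q assume "p \<in> carrier P" "q \<in> carrier P" and eq: "H p = H q"
    then obtain i v w where v: "v \<in> carrier (M i)" "w \<in> carrier (M i)" "\<phi> i v = p" "\<phi> i w = q"
      using is_dirlim_eventually_mem2 by metis
    then have "\<chi> i v = \<chi> i w"
      using eq H(2) by metis
    then obtain d where "push f i d v = push f i d w"
      using lim' v unfolding is_dirlim_def by blast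
    then show "p = q"
      using is_dirlim_push [of v i d] is_dirlim_push [of w i d] v by simp
  qed
  moreover have "H ` carrier P = carrier Q"
  proof
    show "H ` carrier P \<subseteq> carrier Q"
      using mod_hom_closed [OF H(1)] by blast
    show "carrier Q \<subseteq> H ` carrier P"
    proof
      fix q assume "q \<in> carrier Q"
      then obtain i v where "v \<in> carrier (M i)" "\<chi> i v = q"
        using lim' unfolding is_dirlim_def by blast
      then show "q \<in> H ` carrier P"
        using H(2) [of v i] is_dirlim_closed [of v i] by (metis image_eqI)
    qed
  qed
  ultimately show ?thesis
    unfolding mod_isomorphic_def bij_betw_def using H(1) by blast
qed

end

text \<open>The given isomorphism leads from \<open>P\<close> to the limit, so the canonical cocone
  is carried to \<open>P\<close> by the inverse bijection \<open>k\<close>, which is first shown to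
  be a homomorphism.\<close>

lemma mod_isomorphic_dirlim_iff:
  assumes P: "right_module P" and sys: "directed_system M f"
  shows "mod_isomorphic P (dirlim M f) \<longleftrightarrow> (\<exists>\<phi>. is_dirlim P M f \<phi>)"
proof
  assume "\<exists>\<phi>. is_dirlim P M f \<phi>"
  then show "mod_isomorphic P (dirlim M f)"
    using is_dirlim_unique [OF _ is_dirlim_dirlim [OF sys]] by blast
next
  let ?L = "dirlim M f"
  assume "mod_isomorphic P ?L"
  then obtain g where g: "g \<in> mod_hom P ?L" "bij_betw g (carrier P) (carrier ?L)"
    by (auto simp: mod_isomorphic_def)
  define k where "k = inv_into (carrier P) g"
  note L = right_module_dirlim [OF sys]
  have k: "bij_betw k (carrier ?L) (carrier P)"
    unfolding k_def by (rule bij_betw_inv_into [OF g(2)])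
  have gk: "g (k x) = x" "k x \<in> carrier P" if "x \<in> carrier ?L" for x
    using that k g(2) by (auto simp: k_def bij_betw_inv_into_right bij_betw_def)
  have kg: "k (g x) = x" if "x \<in> carrier P" for x
    using that g(2) by (simp add: k_def bij_betw_inv_into_left)
  have "k \<in> mod_hom ?L P"
  proof (rule mod_homI)
    fix x y r assume x: "x \<in> carrier ?L"
    show "k x \<in> carrier P" by (rule gk [OF x])
    have "k (g (act P (k x) r)) = act P (k x) r"
      using gk [OF x] P by (simp add: kg)
    then show "k (act ?L x r) = act P (k x) r"
      using mod_hom_act [OF g(1)] gk [OF x] by simp
    assume y: "y \<in> carrier ?L"
    have "k (g (madd P (k x) (k y))) = madd P (k x) (k y)"
      using gk [OF x] gk [OF y] P by (simp add: kg)
    then show "k (madd ?L x y) = madd P (k x) (k y)"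
      using mod_hom_madd [OF g(1)] gk [OF x] gk [OF y] by simp
  qed
  then show "\<exists>\<phi>. is_dirlim P M f \<phi>"
    using is_dirlim_iso [OF is_dirlim_dirlim [OF sys] _ k P] by blast
qed

section \<open>Limits of free modules along matrices\<close>

lemma sized_seqE:
  assumes "sized_seq n x"
  obtains y where "\<And>i. x i \<in> rect (n (Suc i)) (n i)"
    "\<And>i. y i \<in> rect (n (Suc i)) (n (Suc (Suc i)))" "\<And>i. y i \<odot> x (Suc i) \<odot> x i = x i"
  using assms unfolding sized_seq_def by metis

lemma matrix_system:
  assumes "sized_seq n x"
  shows "directed_system (\<lambda>i. free_module (n i)) (\<lambda>i. mat_vec (x i))"
  using assms by (auto simp: directed_system_def sized_seq_def intro: mat_vec_hom)

text \<open>Leaves the element type of \<open>P\<close> free, so that it also covers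
  \<open>zero_module\<close>, direct sums and the limits themselves.\<close>

definition represents :: "('r::ring_1, 'p) rmodule \<Rightarrow> (nat \<Rightarrow> nat) \<Rightarrow> (nat \<Rightarrow> 'r mat) \<Rightarrow> bool" where
  "represents P n x \<longleftrightarrow> sized_seq n x \<and>
    (\<exists>\<phi>. is_dirlim P (\<lambda>i. free_module (n i)) (\<lambda>i. mat_vec (x i)) \<phi>)"

lemma represents_iff_mat_lim:
  "right_module P \<Longrightarrow> represents P n x \<longleftrightarrow> sized_seq n x \<and> mod_isomorphic P (mat_lim n x)"
  unfolding represents_def mat_lim_def using mod_isomorphic_dirlim_iff matrix_system by blast

lemma finite_uniform_bound:
  assumes "finite G" "\<And>g. g \<in> G \<Longrightarrow> \<exists>i. \<forall>k\<ge>i. Q g k"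
  shows "\<exists>i. \<forall>k\<ge>(i::nat). \<forall>g\<in>G. Q g k"
  using assms
proof (induction rule: finite_induct)
  case (insert g G)
  then obtain i j where "\<forall>k\<ge>i. \<forall>g\<in>G. Q g k" "\<forall>k\<ge>j. Q g k"
    by blast
  then have "\<forall>k\<ge>max i j. \<forall>g\<in>insert g G. Q g k"
    by auto
  then show ?case by blast
qed simp

lemma image_submodule:
  assumes "right_module M" "right_module N" "f \<in> mod_hom M N"
  shows "is_submodule N (f ` carrier M)"
proof -
  have "mzero N \<in> f ` carrier M"
    using mod_hom_mzero [OF assms] assms(1) by (metis image_eqI mzero_closed)
  then show ?thesis
    using assms mod_hom_closed [OF assms(3)]
    by (auto simp: is_submodule_def simp flip: mod_hom_madd [OF assms(3)] mod_hom_act [OF assms(3)])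
qed

lemma mspan_subset: "is_submodule M X \<Longrightarrow> G \<subseteq> X \<Longrightarrow> mspan M G \<subseteq> X"
  by (auto simp: mspan_def)

lemma free_module_hom_image_mspan:
  assumes "right_module M" "f \<in> mod_hom (free_module n) M" "v \<in> carrier (free_module n)"
    "\<And>j. j < n \<Longrightarrow> f (unit_vec j) \<in> G"
  shows "f v \<in> mspan M G"
proof -
  have "f v \<in> X" if "is_submodule M X" "G \<subseteq> X" for X
    unfolding mod_hom_free_module_expand [OF assms(1-3)]
    by (rule lin_comb_in_submodule [OF that(1)]) (use assms(4) that(2) in blast)
  then show ?thesis
    by (simp add: mspan_def)
qed

lemma push_shift: "push f (Suc i) d (f i v) = push f i (Suc d) v"
  using push_add [of f i 1 d v] by simp

definition id_mat :: "nat \<Rightarrow> 'r::ring_1 mat" where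
  "id_mat n i j = (if i = j \<and> i < n then 1 else 0)"

lemma id_mat_rect: "id_mat n \<in> rect n n"
  by (simp add: rect_def id_mat_def)

lemma mat_vec_id_mat: "v \<in> carrier (free_module n) \<Longrightarrow> mat_vec (id_mat n) v = v"
proof
  fix i assume v: "v \<in> carrier (free_module n)"
  have "mat_vec (id_mat n) v i = (\<Sum>j<n. if j = i then v j else 0)"
    unfolding mat_vec_rect [OF id_mat_rect] by (rule sum.cong) (auto simp: id_mat_def)
  then show "mat_vec (id_mat n) v i = v i"
    using v by (auto simp: carrier_free_module)
qed

context
  fixes n and x :: "nat \<Rightarrow> 'r::ring_1 mat"
  assumes sized: "sized_seq n x"
begin

lemma sized_rect: "x i \<in> rect (n (Suc i)) (n i)"
  using sized by (simp add: sized_seq_def)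

lemma sized_mat_vec_hom: "mat_vec (x i) \<in> mod_hom (free_module (n i)) (free_module (n (Suc i)))"
  by (rule mat_vec_hom [OF sized_rect])

text \<open>The matrix identity read as maps: \<open>y i\<close> undoes \<open>x (i + 1)\<close> on
  the image of \<open>x i\<close>.\<close>

lemma sized_retraction:
  obtains y where "\<And>i. y i \<in> rect (n (Suc i)) (n (Suc (Suc i)))"
    "\<And>i v. mat_vec (y i) (mat_vec (x (Suc i)) (mat_vec (x i) v)) = mat_vec (x i) v"
proof -
  obtain y where "\<And>i. y i \<in> rect (n (Suc i)) (n (Suc (Suc i)))" "\<And>i. y i \<odot> x (Suc i) \<odot> x i = x i"
    using sized_seqE [OF sized] by metis
  then show ?thesis
    using that by (metis mat_vec_mat_mult sized_rect)
qed

text \<open>Transition maps are matrices, hence can be used as factors in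
  \<open>s_le1\<close>.\<close>

lemma push_matrix:
  "\<exists>D\<in>rect (n (i + d)) (n i). \<forall>v\<in>carrier (free_module (n i)). mat_vec D v = push (\<lambda>i. mat_vec (x i)) i d v"
proof (induction d)
  case 0
  show ?case
    by (rule bexI [of _ "id_mat (n i)"]) (simp_all add: id_mat_rect mat_vec_id_mat)
next
  case (Suc d)
  then obtain D where D: "D \<in> rect (n (i + d)) (n i)"
    "\<forall>v\<in>carrier (free_module (n i)). mat_vec D v = push (\<lambda>i. mat_vec (x i)) i d v"
    by blast
  show ?case
    by (rule bexI [of _ "x (i + d) \<odot> D"])
      (use D sized_rect [of "i + d"] in \<open>auto simp: mat_vec_mat_mult [OF D(1)]\<close>)
qed

text \<open>The product \<open>y i y (i + 1) ... y (i + d - 1)\<close> undoes \<open>d\<close>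
  further transitions on the image of \<open>x i\<close>.\<close>

lemma push_retraction:
  "\<exists>Y\<in>rect (n (Suc i)) (n (Suc i + d)). \<forall>v\<in>carrier (free_module (n i)).
    mat_vec Y (push (\<lambda>i. mat_vec (x i)) (Suc i) d (mat_vec (x i) v)) = mat_vec (x i) v"
proof (induction d)
  case 0
  show ?case
    by (rule bexI [of _ "id_mat (n (Suc i))"])
      (simp_all add: id_mat_rect mat_vec_id_mat mod_hom_closed [OF sized_mat_vec_hom])
next
  case (Suc d)
  then obtain Y where Y: "Y \<in> rect (n (Suc i)) (n (Suc i + d))"
    "\<And>v. v \<in> carrier (free_module (n i)) \<Longrightarrow>
      mat_vec Y (push (\<lambda>i. mat_vec (x i)) (Suc i) d (mat_vec (x i) v)) = mat_vec (x i) v"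
    by blast
  obtain y where y: "\<And>i. y i \<in> rect (n (Suc i)) (n (Suc (Suc i)))"
    "\<And>i v. mat_vec (y i) (mat_vec (x (Suc i)) (mat_vec (x i) v)) = mat_vec (x i) v"
    using sized_retraction by metis
  have "Y \<odot> y (i + d) \<in> rect (n (Suc i)) (n (Suc i + Suc d))"
    using mat_mult_rect [OF Y(1) y(1), of "i + d"] by simp
  moreover have "mat_vec (Y \<odot> y (i + d)) (push (\<lambda>i. mat_vec (x i)) (Suc i) (Suc d) (mat_vec (x i) v))
      = mat_vec (x i) v" if "v \<in> carrier (free_module (n i))" for v
  proof -
    \<comment> \<open>The vector before the last transition lies in the image of
      \<open>x (i + d)\<close>; there \<open>y (i + d)\<close> undoes
      \<open>x (i + d + 1)\<close>.\<close>
    have "push (\<lambda>i. mat_vec (x i)) (Suc i) d (mat_vec (x i) v)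
        = mat_vec (x (i + d)) (push (\<lambda>i. mat_vec (x i)) i d v)"
      using push_shift [of "\<lambda>i. mat_vec (x i)" i d v] by simp
    then show ?thesis
      using Y(2) [OF that] y(2) [of "i + d" "push (\<lambda>i. mat_vec (x i)) i d v"]
      by (simp add: mat_vec_mat_mult [OF y(1)])
  qed
  ultimately show ?case by blast
qed

section \<open>Homomorphisms into and out of a limit of free modules\<close>

context
  fixes P :: "('r, 'p) rmodule" and \<phi>
  assumes lim: "is_dirlim P (\<lambda>i. free_module (n i)) (\<lambda>i. mat_vec (x i)) \<phi>"
begin

text \<open>
  Lifts \<open>l i\<close> of \<open>f \<circ> \<phi> i\<close> are made compatible by the corrections
  \<open>H (j + 1) = l (j + 2) + (H j - l (j + 2) x (j + 1)) y j\<close>: these satisfy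
  \<open>H (j + 1) x (j + 1) x j = H j x j\<close>.
\<close>

lemma limit_lift:
  fixes A :: "('r, 'q) rmodule"
  assumes A: "right_module A" and B: "right_module B" and g: "g \<in> mod_hom A B"
    and surj: "g ` carrier A = carrier B" and f: "f \<in> mod_hom P B"
  shows "\<exists>h\<in>mod_hom P A. \<forall>p\<in>carrier P. g (h p) = f p"
proof -
  obtain y where y: "\<And>i. y i \<in> rect (n (Suc i)) (n (Suc (Suc i)))"
    "\<And>i v. mat_vec (y i) (mat_vec (x (Suc i)) (mat_vec (x i) v)) = mat_vec (x i) v"
    using sized_retraction by metis
  note y_hom = mat_vec_hom [OF y(1)]
  have "\<forall>i. \<exists>l. l \<in> mod_hom (free_module (n i)) A \<and> (\<forall>v\<in>carrier (free_module (n i)). g (l v) = f (\<phi> i v))"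
    using lift_free_module [OF A B g surj mod_hom_comp [OF is_dirlim_hom [OF lim] f]] by blast
  then obtain l where l: "\<And>i. l i \<in> mod_hom (free_module (n i)) A"
    "\<And>i v. v \<in> carrier (free_module (n i)) \<Longrightarrow> g (l i v) = f (\<phi> i v)"
    by metis
  define corr where "corr j Hj w = madd A (Hj w) (act A (l (Suc (Suc j)) (mat_vec (x (Suc j)) w)) (- 1))"
    for j w and Hj :: "(nat \<Rightarrow> 'r) \<Rightarrow> 'q"
  \<comment> \<open>\<open>H j\<close> lives on stage \<open>j + 1\<close> and starts from
    \<open>l 1\<close>: compatibility holds only after composition with \<open>x j\<close>, and it
    is the maps \<open>H j x j\<close> on stage \<open>j\<close> that induce the lift.\<close>
  define H where "H = rec_nat (l 1) (\<lambda>j Hj v. madd A (l (Suc (Suc j)) v) (corr j Hj (mat_vec (y j) v)))"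
  have H_0: "H 0 = l 1"
    and H_Suc: "H (Suc j) = (\<lambda>v. madd A (l (Suc (Suc j)) v) (corr j (H j) (mat_vec (y j) v)))" for j
    by (simp_all add: H_def)
  have H: "H j \<in> mod_hom (free_module (n (Suc j))) A" for j
  proof (induction j)
    case 0
    show ?case using l(1) [of 1] by (simp add: H_0)
  next
    case (Suc j)
    have "corr j (H j) \<in> mod_hom (free_module (n (Suc j))) A"
      unfolding corr_def by (intro mod_hom_diff A Suc mod_hom_comp [OF sized_mat_vec_hom l(1)])
    then show ?case
      unfolding H_Suc by (intro mod_hom_add A l(1) mod_hom_comp [OF y_hom])
  qed
  have gH: "g (H j v) = f (\<phi> (Suc j) v)" if "v \<in> carrier (free_module (n (Suc j)))" for j v
    using that
  proof (induction j arbitrary: v)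
    case 0
    then show ?case using l(2) [of v 1] by (simp add: H_0)
  next
    case (Suc j)
    let ?w = "mat_vec (y j) v" and ?l = "l (Suc (Suc j))"
    have w: "?w \<in> carrier (free_module (n (Suc j)))"
      by (rule mod_hom_closed [OF y_hom Suc.prems])
    note xw = mod_hom_closed [OF sized_mat_vec_hom w]
    have fw: "f (\<phi> (Suc j) ?w) \<in> carrier B" "f (\<phi> (Suc (Suc j)) v) \<in> carrier B"
      using mod_hom_closed [OF f] is_dirlim_closed [OF lim] w Suc.prems by blast+
    \<comment> \<open>The correction is a difference of two lifts of the same map, hence is killed
      by \<open>g\<close>. So adding it keeps \<open>H (j + 1)\<close> a lift.\<close>
    have "g (corr j (H j) ?w) = madd B (f (\<phi> (Suc j) ?w)) (act B (f (\<phi> (Suc j) ?w)) (- 1))"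
      unfolding corr_def
      using mod_hom_closed [OF H w] mod_hom_closed [OF l(1) xw] A Suc.IH [OF w] l(2) [OF xw]
        is_dirlim_compat [OF lim w]
      by (simp add: mod_hom_madd [OF g] mod_hom_act [OF g])
    then have "g (corr j (H j) ?w) = mzero B"
      using fw B by simp
    moreover have "corr j (H j) ?w \<in> carrier A"
      unfolding corr_def using mod_hom_closed [OF H w] mod_hom_closed [OF l(1) xw] A by simp
    ultimately show ?case
      unfolding H_Suc using mod_hom_closed [OF l(1) Suc.prems] l(2) [OF Suc.prems] fw B
      by (simp add: mod_hom_madd [OF g])
  qed
  have compat: "H (Suc i) (mat_vec (x (Suc i)) (mat_vec (x i) v)) = H i (mat_vec (x i) v)"
    if v: "v \<in> carrier (free_module (n i))" for i v
  proof -
    let ?u = "mat_vec (x i) v" and ?l = "l (Suc (Suc i))"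
    have u: "?u \<in> carrier (free_module (n (Suc i)))"
      by (rule mod_hom_closed [OF sized_mat_vec_hom v])
    have "H i ?u \<in> carrier A" "?l (mat_vec (x (Suc i)) ?u) \<in> carrier A"
      using mod_hom_closed [OF H u] mod_hom_closed [OF l(1) mod_hom_closed [OF sized_mat_vec_hom u]]
      by blast+
    then show ?thesis
      unfolding H_Suc corr_def y(2) using A by (simp add: madd_lcomm [OF A])
  qed
  obtain h where h: "h \<in> mod_hom P A"
    "\<And>i v. v \<in> carrier (free_module (n i)) \<Longrightarrow> h (\<phi> i v) = H i (mat_vec (x i) v)"
    using is_dirlim_induced [OF lim, of 0 "\<lambda>i v. H i (mat_vec (x i) v)" A]
      mod_hom_comp [OF sized_mat_vec_hom H] compat by auto
  have "g (h p) = f p" if p: "p \<in> carrier P" for p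
  proof -
    obtain i v where v: "v \<in> carrier (free_module (n i))" "\<phi> i v = p"
      using is_dirlim_eventually_mem [OF lim p] by blast
    have "g (h p) = f (\<phi> (Suc i) (mat_vec (x i) v))"
      using h(2) [OF v(1)] v(2) gH [OF mod_hom_closed [OF sized_mat_vec_hom v(1)]] by simp
    then show ?thesis
      using is_dirlim_compat [OF lim v(1)] v(2) by simp
  qed
  with h(1) show ?thesis by blast
qed

text \<open>On stage \<open>j\<close>, for \<open>j \<ge> i\<close>, take
  \<open>y i y (i + 1) ... y (j - 1) x j\<close>. By \<open>y j x (j + 1) x j = x j\<close> these
  maps are compatible, and the one on stage \<open>i\<close> is \<open>x i\<close> itself.\<close>

lemma limit_partial_inverse:
  "\<exists>a\<in>mod_hom P (free_module (n (Suc i))). \<forall>v\<in>carrier (free_module (n i)). a (\<phi> i v) = mat_vec (x i) v"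
proof -
  obtain y where y: "\<And>i. y i \<in> rect (n (Suc i)) (n (Suc (Suc i)))"
    "\<And>i v. mat_vec (y i) (mat_vec (x (Suc i)) (mat_vec (x i) v)) = mat_vec (x i) v"
    using sized_retraction by metis
  define b where "b = rec_nat (\<lambda>v. v) (\<lambda>d bd v. bd (mat_vec (y (i + d)) v))"
  have b_0: "b 0 v = v" and b_Suc: "b (Suc d) v = b d (mat_vec (y (i + d)) v)" for d v
    by (simp_all add: b_def)
  have b: "b d \<in> mod_hom (free_module (n (Suc (i + d)))) (free_module (n (Suc i)))" for d
  proof (induction d)
    case 0
    show ?case by (simp add: b_0 [abs_def] mod_hom_id)
  next
    case (Suc d)
    then show ?case
      using mod_hom_comp [OF mat_vec_hom [OF y(1)] Suc] by (simp add: b_Suc [abs_def])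
  qed
  define h where "h j v = b (j - i) (mat_vec (x j) v)" for j v
  have "h j \<in> mod_hom (free_module (n j)) (free_module (n (Suc i)))" if "i \<le> j" for j
  proof -
    have "b (j - i) \<in> mod_hom (free_module (n (Suc j))) (free_module (n (Suc i)))"
      using b [of "j - i"] that by simp
    then show ?thesis
      unfolding h_def [abs_def] by (rule mod_hom_comp [OF sized_mat_vec_hom])
  qed
  moreover have "h (Suc j) (mat_vec (x j) v) = h j v" if "i \<le> j" for j v
    using that by (simp add: h_def Suc_diff_le b_Suc y(2))
  ultimately have "\<exists>a\<in>mod_hom P (free_module (n (Suc i))).
      \<forall>j\<ge>i. \<forall>v\<in>carrier (free_module (n j)). a (\<phi> j v) = h j v"
    by (intro is_dirlim_induced [OF lim]; blast)
  then obtain a where "a \<in> mod_hom P (free_module (n (Suc i)))"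
    and "\<And>v. v \<in> carrier (free_module (n i)) \<Longrightarrow> a (\<phi> i v) = h i v"
    by blast
  then show ?thesis
    by (intro bexI [of _ a]) (simp_all add: h_def b_0)
qed

text \<open>The finitely many basis images are all reached at a late stage, and chosen preimages
  form the columns of \<open>t\<close>. Having every late stage available allows the choice of one
  beyond a prescribed index.\<close>

lemma limit_factor_matrix:
  assumes f: "f \<in> mod_hom (free_module k) P"
  shows "\<exists>l0. \<forall>l\<ge>l0. \<exists>t\<in>rect (n l) k. \<forall>v\<in>carrier (free_module k). \<phi> l (mat_vec t v) = f v"
proof -
  note P = is_dirlim_module [OF lim]
  have "\<exists>l0. \<forall>l\<ge>l0. \<forall>j\<in>{..<k}. \<exists>w\<in>carrier (free_module (n l)). \<phi> l w = f (unit_vec j)"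
  proof (rule finite_uniform_bound)
    fix j assume "j \<in> {..<k}"
    then have "f (unit_vec j) \<in> carrier P"
      using mod_hom_closed [OF f] by simp
    then show "\<exists>l0. \<forall>l\<ge>l0. \<exists>w\<in>carrier (free_module (n l)). \<phi> l w = f (unit_vec j)"
      using is_dirlim_eventually_mem [OF lim] by metis
  qed simp
  then obtain l0 where l0: "\<And>l j. l0 \<le> l \<Longrightarrow> j < k \<Longrightarrow>
      \<exists>w\<in>carrier (free_module (n l)). \<phi> l w = f (unit_vec j)"
    by blast
  have "\<exists>t\<in>rect (n l) k. \<forall>v\<in>carrier (free_module k). \<phi> l (mat_vec t v) = f v"
    if l: "l0 \<le> l" for l
  proof -
    obtain w where w: "\<And>j. j < k \<Longrightarrow> w j \<in> carrier (free_module (n l))"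
      "\<And>j. j < k \<Longrightarrow> \<phi> l (w j) = f (unit_vec j)"
      using l0 [OF l] by metis
    let ?t = "\<lambda>i j. if j < k then w j i else 0"
    have t: "?t \<in> rect (n l) k"
      using mat_of_columns(1) w(1) by blast
    have "\<phi> l (mat_vec ?t v) = f v" if "v \<in> carrier (free_module k)" for v
      by (rule mod_hom_free_module_eqI [OF P mod_hom_comp [OF mat_vec_hom [OF t] is_dirlim_hom [OF lim]] f _ that])
        (simp add: w mat_vec_unit_vec)
    with t show ?thesis by blast
  qed
  then show ?thesis by blast
qed

text \<open>Each basis vector has its own stage of agreement; the maximum of finitely many serves
  for all vectors.\<close>

lemma limit_hom_eventually_eq:
  assumes f: "f \<in> mod_hom (free_module k) (free_module (n l))"
    and g: "g \<in> mod_hom (free_module k) (free_module (n l))"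
    and eq: "\<And>v. v \<in> carrier (free_module k) \<Longrightarrow> \<phi> l (f v) = \<phi> l (g v)"
  shows "\<exists>d. \<forall>v\<in>carrier (free_module k).
    push (\<lambda>i. mat_vec (x i)) l d (f v) = push (\<lambda>i. mat_vec (x i)) l d (g v)"
proof -
  note push = push_hom [OF matrix_system [OF sized]]
  have "\<exists>d0. \<forall>d\<ge>d0. \<forall>j\<in>{..<k}.
      push (\<lambda>i. mat_vec (x i)) l d (f (unit_vec j)) = push (\<lambda>i. mat_vec (x i)) l d (g (unit_vec j))"
  proof (rule finite_uniform_bound)
    fix j assume "j \<in> {..<k}"
    then have j: "unit_vec j \<in> carrier (free_module k)" by simp
    show "\<exists>d0. \<forall>d\<ge>d0.
      push (\<lambda>i. mat_vec (x i)) l d (f (unit_vec j)) = push (\<lambda>i. mat_vec (x i)) l d (g (unit_vec j))"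
      using is_dirlim_eventually_eq [OF lim, OF mod_hom_closed [OF f j] mod_hom_closed [OF g j] eq [OF j]]
      by metis
  qed simp
  then obtain d where d: "\<And>j. j < k \<Longrightarrow>
      push (\<lambda>i. mat_vec (x i)) l d (f (unit_vec j)) = push (\<lambda>i. mat_vec (x i)) l d (g (unit_vec j))"
    by blast
  have "push (\<lambda>i. mat_vec (x i)) l d (f v) = push (\<lambda>i. mat_vec (x i)) l d (g v)"
    if "v \<in> carrier (free_module k)" for v
    by (rule mod_hom_free_module_eqI [OF _ mod_hom_comp [OF f push] mod_hom_comp [OF g push] _ that])
      (simp_all add: d)
  then show ?thesis by blast
qed

lemma limit_countably_generated: "countably_generated P"
proof -
  note P = is_dirlim_module [OF lim]
  define G where "G = (\<Union>i. (\<lambda>j. \<phi> i (unit_vec j)) ` {..<n i})"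
  have G: "G \<subseteq> carrier P"
    using is_dirlim_closed [OF lim] by (auto simp: G_def)
  have "carrier P \<subseteq> mspan P G"
  proof
    fix p assume "p \<in> carrier P"
    then obtain i v where v: "v \<in> carrier (free_module (n i))" "\<phi> i v = p"
      using is_dirlim_eventually_mem [OF lim] by blast
    show "p \<in> mspan P G"
      using free_module_hom_image_mspan [OF P is_dirlim_hom [OF lim] v(1), of G] v(2)
      by (auto simp: G_def)
  qed
  moreover have "is_submodule P (carrier P)"
    using P by (simp add: is_submodule_def)
  ultimately have "mspan P G = carrier P"
    using mspan_subset G by blast
  moreover have "countable G"
    by (simp add: G_def)
  ultimately show ?thesis
    unfolding countably_generated_def using G by blast
qed

end

end

section \<open>Comparison of modules and of sequences of matrices\<close>

text \<open>The maps \<alpha> and \<beta> on the submodule generated by stage \<open>i + 1\<close>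
  are lifted to matrices \<open>t\<close> and \<open>r\<close>. Then \<open>r z t\<close> and the
  transition map of \<open>x\<close> agree in \<open>P\<close>, hence agree as matrices after
  \<open>d\<close> further steps, and the retraction \<open>Y\<close> brings the equality back to
  \<open>x i\<close>.\<close>

lemma cp_le_imp_s_le:
  fixes x :: "nat \<Rightarrow> 'r::ring_1 mat"
  assumes sx: "sized_seq n x" and sz: "sized_seq m z"
    and P: "is_dirlim P (\<lambda>i. free_module (n i)) (\<lambda>i. mat_vec (x i)) \<phi>"
    and Q: "is_dirlim Q (\<lambda>i. free_module (m i)) (\<lambda>i. mat_vec (z i)) \<chi>"
    and le: "cp_le P Q"
  shows "s_le x z"
  unfolding s_le_def
proof
  fix i
  note rx = sized_rect [OF sx] and rz = sized_rect [OF sz]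
  let ?push = "push (\<lambda>i. mat_vec (x i))"
  \<comment> \<open>Stage \<open>i + 1\<close> rather than \<open>i\<close>, because
    \<open>Y\<close> undoes transitions only on the image of \<open>x i\<close>.\<close>
  obtain X where fg: "fg_submodule P X"
    and X: "\<And>v. v \<in> carrier (free_module (n (Suc i))) \<Longrightarrow> \<phi> (Suc i) v \<in> X"
  proof
    let ?G = "(\<lambda>j. \<phi> (Suc i) (unit_vec j)) ` {..<n (Suc i)}"
    have "?G \<subseteq> carrier P"
      using is_dirlim_closed [OF P] by auto
    then show "fg_submodule P (mspan P ?G)"
      unfolding fg_submodule_def by blast
    show "\<phi> (Suc i) v \<in> mspan P ?G" if "v \<in> carrier (free_module (n (Suc i)))" for v
      using free_module_hom_image_mspan [OF is_dirlim_module [OF P] is_dirlim_hom [OF P] that] by simp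
  qed
  obtain \<alpha> \<beta> where \<alpha>: "\<alpha> \<in> mod_hom (P\<lparr>carrier := X\<rparr>) Q" and \<beta>: "\<beta> \<in> mod_hom Q P"
    and \<beta>\<alpha>: "\<And>p. p \<in> X \<Longrightarrow> \<beta> (\<alpha> p) = p"
    using le [unfolded cp_le_def, rule_format, OF fg] by blast
  have "\<phi> (Suc i) \<in> mod_hom (free_module (n (Suc i))) (P\<lparr>carrier := X\<rparr>)"
    using is_dirlim_hom [OF P, of "Suc i"] X by (simp add: mod_hom_def)
  note \<alpha>\<phi> = mod_hom_comp [OF this \<alpha>]
  obtain k t where t: "t \<in> rect (m k) (n (Suc i))"
    and \<chi>t: "\<And>v. v \<in> carrier (free_module (n (Suc i))) \<Longrightarrow> \<chi> k (mat_vec t v) = \<alpha> (\<phi> (Suc i) v)"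
    using limit_factor_matrix [OF sz Q \<alpha>\<phi>] by blast
  \<comment> \<open>\<beta> is lifted one stage after \<open>t\<close>: since
    \<open>\<chi> k\<close> is \<open>\<chi> (k + 1)\<close> after \<open>z k\<close>, this puts the
    factor \<open>z k\<close> between \<open>r\<close> and \<open>t\<close>.\<close>
  obtain l0 where "\<And>l. l0 \<le> l \<Longrightarrow> \<exists>r\<in>rect (n l) (m (Suc k)).
      \<forall>w\<in>carrier (free_module (m (Suc k))). \<phi> l (mat_vec r w) = \<beta> (\<chi> (Suc k) w)"
    using limit_factor_matrix [OF sx P mod_hom_comp [OF is_dirlim_hom [OF Q] \<beta>]] by blast
  \<comment> \<open>This stage is at least \<open>l0\<close> and is also reached from stage
    \<open>i + 1\<close> by \<open>l0\<close> transitions.\<close>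
  from this [of "Suc i + l0"] obtain r where r: "r \<in> rect (n (Suc i + l0)) (m (Suc k))"
    and \<phi>r: "\<And>w. w \<in> carrier (free_module (m (Suc k))) \<Longrightarrow>
      \<phi> (Suc i + l0) (mat_vec r w) = \<beta> (\<chi> (Suc k) w)"
    by auto
  note t_hom = mat_vec_hom [OF t] and z_hom = sized_mat_vec_hom [OF sz] and r_hom = mat_vec_hom [OF r]
  have "\<phi> (Suc i + l0) (mat_vec r (mat_vec (z k) (mat_vec t v))) = \<phi> (Suc i + l0) (?push (Suc i) l0 v)"
    if v: "v \<in> carrier (free_module (n (Suc i)))" for v
  proof -
    have tv: "mat_vec t v \<in> carrier (free_module (m k))"
      by (rule mod_hom_closed [OF t_hom v])
    have "\<phi> (Suc i + l0) (mat_vec r (mat_vec (z k) (mat_vec t v))) = \<beta> (\<alpha> (\<phi> (Suc i) v))"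
      using \<phi>r [OF mod_hom_closed [OF z_hom tv]] is_dirlim_compat [OF Q tv] \<chi>t [OF v] by simp
    also have "\<dots> = \<phi> (Suc i + l0) (?push (Suc i) l0 v)"
      using \<beta>\<alpha> [OF X [OF v]] is_dirlim_push [OF P v] by simp
    finally show ?thesis .
  qed
  then obtain d where d: "\<And>v. v \<in> carrier (free_module (n (Suc i))) \<Longrightarrow>
      ?push (Suc i + l0) d (mat_vec r (mat_vec (z k) (mat_vec t v))) =
      ?push (Suc i + l0) d (?push (Suc i) l0 v)"
    using limit_hom_eventually_eq [OF sx P mod_hom_comp [OF mod_hom_comp [OF t_hom z_hom] r_hom]
        push_hom [OF matrix_system [OF sx]]] by blast
  obtain Y where Y: "Y \<in> rect (n (Suc i)) (n (Suc i + (l0 + d)))"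
    "\<And>v. v \<in> carrier (free_module (n i)) \<Longrightarrow>
      mat_vec Y (?push (Suc i) (l0 + d) (mat_vec (x i) v)) = mat_vec (x i) v"
    using push_retraction [OF sx] by metis
  obtain D where D: "D \<in> rect (n (Suc i + l0 + d)) (n (Suc i + l0))"
    "\<And>v. v \<in> carrier (free_module (n (Suc i + l0))) \<Longrightarrow> mat_vec D v = ?push (Suc i + l0) d v"
    using push_matrix [OF sx] by metis
  have YDr: "Y \<odot> D \<odot> r \<in> rect (n (Suc i)) (m (Suc k))"
    using Y(1) D(1) r by blast
  \<comment> \<open>Here \<open>D\<close> is the matrix of the \<open>d\<close> transitions after
    which the maps agree. All factors besides \<open>z k\<close> are collected on its two
    sides.\<close>
  have "x i = (Y \<odot> D \<odot> r) \<odot> z k \<odot> (t \<odot> x i)"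
  proof (rule rect_eqI [OF rx])
    show "(Y \<odot> D \<odot> r) \<odot> z k \<odot> (t \<odot> x i) \<in> rect (n (Suc i)) (n i)"
      using YDr rz [of k] t rx [of i] by blast
    fix v :: "nat \<Rightarrow> 'r" assume v: "v \<in> carrier (free_module (n i))"
    let ?u = "mat_vec (x i) v"
    have u: "?u \<in> carrier (free_module (n (Suc i)))"
      by (rule mod_hom_closed [OF sized_mat_vec_hom [OF sx] v])
    have "mat_vec ((Y \<odot> D \<odot> r) \<odot> z k \<odot> (t \<odot> x i)) v
        = mat_vec Y (mat_vec D (mat_vec r (mat_vec (z k) (mat_vec t ?u))))"
      by (simp add: mat_vec_mat_mult [OF mat_mult_rect [OF t rx]] mat_vec_mat_mult [OF rx]
          mat_vec_mat_mult [OF rz] mat_vec_mat_mult [OF r] mat_vec_mat_mult [OF D(1)])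
    also have "\<dots> = mat_vec Y (?push (Suc i) (l0 + d) ?u)"
      using D(2) [OF mod_hom_closed [OF r_hom mod_hom_closed [OF z_hom mod_hom_closed [OF t_hom u]]]]
        d [OF u] by (simp add: push_add)
    finally show "mat_vec (x i) v = mat_vec ((Y \<odot> D \<odot> r) \<odot> z k \<odot> (t \<odot> x i)) v"
      using Y(2) [OF v] by simp
  qed
  then have "s_le1 (x i) (z k)"
    unfolding s_le1_def using rect_imp_M_infty [OF YDr] rect_imp_M_infty [OF mat_mult_rect [OF t rx]] by blast
  then show "\<exists>k. s_le1 (x i) (z k)" by blast
qed

text \<open>The submodule lies in the image of some \<open>\<phi> i\<close>. From
  \<open>x (i + 1) = r z t\<close> and the partial inverses \<open>a\<close> and \<open>b\<close>
  one gets \<alpha> and \<beta> whose composite sends \<open>\<phi> i v\<close> to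
  \<open>\<phi> (i + 2)\<close> of \<open>r z t x i v = x (i + 1) x i v\<close>, which is
  \<open>\<phi> i v\<close> again. The map \<alpha> is defined on all of \<open>P\<close> and then
  restricted.\<close>

lemma s_le_imp_cp_le:
  fixes x :: "nat \<Rightarrow> 'r::ring_1 mat"
  assumes sx: "sized_seq n x" and sz: "sized_seq m z"
    and P: "is_dirlim P (\<lambda>i. free_module (n i)) (\<lambda>i. mat_vec (x i)) \<phi>"
    and Q: "is_dirlim Q (\<lambda>i. free_module (m i)) (\<lambda>i. mat_vec (z i)) \<chi>"
    and le: "s_le x z"
  shows "cp_le P Q"
  unfolding cp_le_def
proof (intro allI impI)
  fix X assume "fg_submodule P X"
  then obtain G where G: "G \<subseteq> carrier P" "finite G" "X = mspan P G"
    unfolding fg_submodule_def by blast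
  have "\<exists>i0. \<forall>i\<ge>i0. \<forall>g\<in>G. \<exists>v\<in>carrier (free_module (n i)). \<phi> i v = g"
    using G is_dirlim_eventually_mem [OF P] by (intro finite_uniform_bound) (metis subsetD)+
  then obtain i where "\<forall>g\<in>G. \<exists>v\<in>carrier (free_module (n i)). \<phi> i v = g"
    by blast
  then have i: "G \<subseteq> \<phi> i ` carrier (free_module (n i))"
    by (metis image_eqI subsetI)
  have X: "X \<subseteq> \<phi> i ` carrier (free_module (n i))"
    unfolding G(3)
    by (intro mspan_subset image_submodule is_dirlim_module [OF P] is_dirlim_hom [OF P] i) simp
  obtain k where "s_le1 (x (Suc i)) (z k)"
    using le unfolding s_le_def by blast
  then obtain r t where r: "r \<in> rect (n (Suc (Suc i))) (m (Suc k))" and t: "t \<in> rect (m k) (n (Suc i))"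
    and eq: "x (Suc i) = r \<odot> z k \<odot> t"
    using s_le1_rect [OF _ sized_rect [OF sx] sized_rect [OF sz]] by metis
  obtain a where a: "a \<in> mod_hom P (free_module (n (Suc i)))"
    "\<And>v. v \<in> carrier (free_module (n i)) \<Longrightarrow> a (\<phi> i v) = mat_vec (x i) v"
    using limit_partial_inverse [OF sx P] by metis
  obtain b where b: "b \<in> mod_hom Q (free_module (m (Suc k)))"
    "\<And>v. v \<in> carrier (free_module (m k)) \<Longrightarrow> b (\<chi> k v) = mat_vec (z k) v"
    using limit_partial_inverse [OF sz Q] by metis
  \<comment> \<open>On the relevant elements \<open>a\<close> acts as \<open>x i\<close> and
    \<open>b\<close> as \<open>z k\<close>, so the factor \<open>z k\<close> of the product comes
    from \<open>b\<close>.\<close>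
  define \<alpha> \<beta> where "\<alpha> p = \<chi> k (mat_vec t (a p))" and "\<beta> q = \<phi> (Suc (Suc i)) (mat_vec r (b q))" for p q
  have \<alpha>: "\<alpha> \<in> mod_hom P Q"
    unfolding \<alpha>_def [abs_def]
    by (rule mod_hom_comp [OF mod_hom_comp [OF a(1) mat_vec_hom [OF t]] is_dirlim_hom [OF Q]])
  have \<beta>: "\<beta> \<in> mod_hom Q P"
    unfolding \<beta>_def [abs_def]
    by (rule mod_hom_comp [OF mod_hom_comp [OF b(1) mat_vec_hom [OF r]] is_dirlim_hom [OF P]])
  have "\<beta> (\<alpha> p) = p" if p: "p \<in> X" for p
  proof -
    obtain v where v: "v \<in> carrier (free_module (n i))" "p = \<phi> i v"
      using p X by blast
    let ?u = "mat_vec (x i) v"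
    have u: "?u \<in> carrier (free_module (n (Suc i)))"
      by (rule mod_hom_closed [OF sized_mat_vec_hom [OF sx] v(1)])
    have "\<beta> (\<alpha> p) = \<phi> (Suc (Suc i)) (mat_vec r (mat_vec (z k) (mat_vec t ?u)))"
      unfolding \<alpha>_def \<beta>_def using a(2) [OF v(1)] v(2) b(2) [OF mod_hom_closed [OF mat_vec_hom [OF t] u]]
      by simp
    also have "mat_vec r (mat_vec (z k) (mat_vec t ?u)) = mat_vec (x (Suc i)) ?u"
      unfolding eq by (simp add: mat_vec_mat_mult [OF t] mat_vec_mat_mult [OF sized_rect [OF sz]])
    finally show ?thesis
      using is_dirlim_compat [OF P u] is_dirlim_compat [OF P v(1)] v(2) by simp
  qed
  moreover have "X \<subseteq> carrier P"
    using X is_dirlim_closed [OF P] by blast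
  ultimately show "\<exists>\<alpha>\<in>mod_hom (P\<lparr>carrier := X\<rparr>) Q. \<exists>\<beta>\<in>mod_hom Q P. \<forall>p\<in>X. \<beta> (\<alpha> p) = p"
    using mod_hom_restrict [OF \<alpha>] \<beta> by blast
qed

lemma cp_le_iff_s_le:
  "represents P n x \<Longrightarrow> represents Q m z \<Longrightarrow> cp_le P Q \<longleftrightarrow> s_le x z"
  unfolding represents_def using cp_le_imp_s_le s_le_imp_cp_le by blast

section \<open>The preorder on sequences of matrices\<close>

lemma M_infty_imp_common_rect:
  assumes "finite X" "X \<subseteq> M_infty"
  obtains k where "X \<subseteq> rect k k"
proof -
  have "\<exists>k. X \<subseteq> rect k k"
    using assms
  proof (induction rule: finite_induct)
    case (insert x X)
    then obtain k l where "X \<subseteq> rect k k" "x \<in> rect l l"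
      using M_infty_imp_rect by (metis insert_subset)
    then have "insert x X \<subseteq> rect (max k l) (max k l)"
      by (auto intro: rect_mono)
    then show ?case by blast
  qed simp
  with that show ?thesis by blast
qed

lemma s_le1_trans:
  assumes "s_le1 a b" "s_le1 b c" "c \<in> M_infty"
  shows "s_le1 a c"
proof -
  obtain r t r' t' where rt: "r \<in> M_infty" "t \<in> M_infty" "a = r \<odot> b \<odot> t"
    "r' \<in> M_infty" "t' \<in> M_infty" "b = r' \<odot> c \<odot> t'"
    using assms unfolding s_le1_def by blast
  then obtain k where k: "{r, t, r', t', c} \<subseteq> rect k k"
    using M_infty_imp_common_rect [of "{r, t, r', t', c}"] assms(3) by auto
  then have "a = (r \<odot> r') \<odot> c \<odot> (t' \<odot> t)"
    by (simp add: rt mat_mult_assoc [of _ k k] mat_mult_rect [of _ k k _ k k])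
  moreover have "r \<odot> r' \<in> M_infty" "t' \<odot> t \<in> M_infty"
    using k by (auto intro!: rect_imp_M_infty [of _ k k] mat_mult_rect [of _ k k _ k k])
  ultimately show ?thesis
    unfolding s_le1_def by blast
qed

lemma S_objs_M_infty: "x \<in> S_objs \<Longrightarrow> x n \<in> M_infty"
  by (simp add: S_objs_def)

text \<open>The equation \<open>x n = y x (n + 1) x n\<close> is itself a factorization through the
  next term. The index must grow strictly: without a unit \<open>s_le1\<close> need not be
  reflexive, and reflexivity of \<open>s_le\<close> also passes through the next term.\<close>

lemma S_objs_s_le1_later:
  assumes x: "x \<in> S_objs" and "n < m"
  shows "s_le1 (x n) (x m)"
proof -
  have step: "s_le1 (x n) (x (Suc n))" for n
  proof -
    obtain y where y: "y \<in> M_infty" "y \<odot> x (Suc n) \<odot> x n = x n"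
      using x by (auto simp: S_objs_def)
    then have "x n = y \<odot> x (Suc n) \<odot> x n" by simp
    then show ?thesis
      unfolding s_le1_def using y(1) S_objs_M_infty [OF x] by blast
  qed
  show ?thesis
    using \<open>n < m\<close>
  proof (induction m)
    case (Suc m)
    then show ?case
      using step s_le1_trans [OF _ step S_objs_M_infty [OF x]] by (cases "n = m") auto
  qed simp
qed

lemma s_le_refl: "x \<in> S_objs \<Longrightarrow> s_le x x"
  unfolding s_le_def using S_objs_s_le1_later lessI by blast

lemma s_le_trans: "z \<in> S_objs \<Longrightarrow> s_le x y \<Longrightarrow> s_le y z \<Longrightarrow> s_le x z"
  unfolding s_le_def using s_le1_trans S_objs_M_infty by metis

lemma s_class_eq_iff:
  assumes "x \<in> S_objs" "z \<in> S_objs"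
  shows "s_class x = s_class z \<longleftrightarrow> s_le x z \<and> s_le z x"
proof
  assume "s_class x = s_class z"
  moreover have "z \<in> s_class z"
    using assms by (simp add: s_class_def s_le_refl)
  ultimately show "s_le x z \<and> s_le z x"
    by (auto simp: s_class_def)
next
  assume "s_le x z \<and> s_le z x"
  then show "s_class x = s_class z"
    unfolding s_class_def using assms s_le_trans by blast
qed

lemma mem_s_class_iff: "x \<in> S_objs \<Longrightarrow> z \<in> s_class x \<longleftrightarrow> z \<in> S_objs \<and> s_class z = s_class x"
  using s_class_eq_iff by (auto simp: s_class_def)

lemma S_objs_iff_sized: "x \<in> S_objs \<longleftrightarrow> (\<exists>k. sized_seq k x)"
proof
  assume "\<exists>k. sized_seq k x"
  then show "x \<in> S_objs"
    unfolding sized_seq_def S_objs_def using rect_imp_M_infty by blast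
next
  assume x: "x \<in> S_objs"
  then have "\<forall>n. \<exists>y. y \<in> M_infty \<and> y \<odot> x (Suc n) \<odot> x n = x n"
    by (auto simp: S_objs_def)
  then obtain y where y: "\<And>n. y n \<in> M_infty" "\<And>n. y n \<odot> x (Suc n) \<odot> x n = x n"
    by metis
  have "\<forall>n. \<exists>c. x n \<in> rect c c" "\<forall>n. \<exists>d. y n \<in> rect d d"
    using M_infty_imp_rect S_objs_M_infty [OF x] y(1) by metis+
  then obtain c d where c: "\<And>n. x n \<in> rect (c n) (c n)" and d: "\<And>n. y n \<in> rect (d n) (d n)"
    by metis
  \<comment> \<open>Index \<open>i\<close> must bound the columns of \<open>x i\<close>, the rows of
    \<open>x (i - 1)\<close> and \<open>y (i - 1)\<close>, and the columns of
    \<open>y (i - 2)\<close>. Truncated subtraction at small \<open>i\<close> only makes the sum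
    larger.\<close>
  define k where "k i = c i + c (i - 1) + d (i - 1) + d (i - 2)" for i
  have "x i \<in> rect (k (Suc i)) (k i)" "y i \<in> rect (k (Suc i)) (k (Suc (Suc i)))" for i
    by (rule rect_mono [OF c] rect_mono [OF d]; simp add: k_def)+
  then have "sized_seq k x"
    unfolding sized_seq_def using y(2) by blast
  then show "\<exists>k. sized_seq k x" by blast
qed

section \<open>Block sums\<close>

lemma sum_lessThan_add: "(\<Sum>j<l + l'. f j) = (\<Sum>j<l. f j) + (\<Sum>j<l'. f (j + l :: nat) :: 'a::comm_monoid_add)"
  by (induction l') (simp_all add: ac_simps)

lemma block_sum_rect:
  "x \<in> rect k l \<Longrightarrow> y \<in> rect k' l' \<Longrightarrow> block_sum k l x y \<in> rect (k + k') (l + l')"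
  by (rule rectI) (auto simp: block_sum_def intro: rect_zero [of x k l] rect_zero [of y k' l'])

lemma block_sum_mult:
  assumes "x \<in> rect a b" "x' \<in> rect b c" "y \<in> rect a' b'" "y' \<in> rect b' c'"
  shows "block_sum a b x y \<odot> block_sum b c x' y' = block_sum a c (x \<odot> x') (y \<odot> y')"
proof (intro ext)
  fix i j
  have "(block_sum a b x y \<odot> block_sum b c x' y') i j =
      (\<Sum>k<b. block_sum a b x y i k * block_sum b c x' y' k j) +
      (\<Sum>k<b'. block_sum a b x y i (k + b) * block_sum b c x' y' (k + b) j)"
    unfolding mat_mult_left_rect [OF block_sum_rect [OF assms(1,3)]] sum_lessThan_add ..
  also have "\<dots> = block_sum a c (x \<odot> x') (y \<odot> y') i j"
    unfolding block_sum_def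
    by (auto simp: mat_mult_left_rect [OF assms(1)] mat_mult_left_rect [OF assms(3)] not_less)
  finally show "(block_sum a b x y \<odot> block_sum b c x' y') i j = block_sum a c (x \<odot> x') (y \<odot> y') i j" .
qed

abbreviation block_sum_seq ::
    "(nat \<Rightarrow> nat) \<Rightarrow> (nat \<Rightarrow> 'a::ring mat) \<Rightarrow> (nat \<Rightarrow> 'a mat) \<Rightarrow> nat \<Rightarrow> 'a mat" where
  "block_sum_seq k u u' \<equiv> \<lambda>n. block_sum (k (Suc n)) (k n) (u n) (u' n)"

lemma sized_seq_block_sum:
  assumes "sized_seq k u" "sized_seq k' u'"
  shows "sized_seq (\<lambda>i. k i + k' i) (block_sum_seq k u u')"
  unfolding sized_seq_def
proof (intro conjI allI)
  fix i
  obtain y y' where y: "y \<in> rect (k (Suc i)) (k (Suc (Suc i)))" "y \<odot> u (Suc i) \<odot> u i = u i"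
    and y': "y' \<in> rect (k' (Suc i)) (k' (Suc (Suc i)))" "y' \<odot> u' (Suc i) \<odot> u' i = u' i"
    using assms unfolding sized_seq_def by blast
  have u: "u i \<in> rect (k (Suc i)) (k i)" "u' i \<in> rect (k' (Suc i)) (k' i)" for i
    using assms by (auto simp: sized_seq_def)
  show "block_sum_seq k u u' i \<in> rect (k (Suc i) + k' (Suc i)) (k i + k' i)"
    by (intro block_sum_rect u)
  show "\<exists>y\<in>rect (k (Suc i) + k' (Suc i)) (k (Suc (Suc i)) + k' (Suc (Suc i))).
      y \<odot> block_sum_seq k u u' (Suc i) \<odot> block_sum_seq k u u' i = block_sum_seq k u u' i"
  proof
    show "block_sum (k (Suc i)) (k (Suc (Suc i))) y y'
        \<in> rect (k (Suc i) + k' (Suc i)) (k (Suc (Suc i)) + k' (Suc (Suc i)))"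
      by (intro block_sum_rect y y')
    show "block_sum (k (Suc i)) (k (Suc (Suc i))) y y' \<odot> block_sum_seq k u u' (Suc i) \<odot>
        block_sum_seq k u u' i = block_sum_seq k u u' i"
      unfolding block_sum_mult [OF y(1) u(1) y'(1) u(2)]
        block_sum_mult [OF mat_mult_rect [OF y(1) u(1)] u(1) mat_mult_rect [OF y'(1) u(2)] u(2)]
        y(2) y'(2) ..
  qed
qed

lemma s_le_block_sum:
  assumes u: "sized_seq k u" and u': "sized_seq k' u'" and v: "sized_seq l v" and v': "sized_seq l' v'"
    and le: "s_le u v" "s_le u' v'"
  shows "s_le (block_sum_seq k u u') (block_sum_seq l v v')"
  unfolding s_le_def
proof
  fix n
  obtain p p' where p: "s_le1 (u n) (v p)" "s_le1 (u' n) (v' p')"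
    using le unfolding s_le_def by blast
  \<comment> \<open>The two comparisons hold at different indices; both are moved to one index
    strictly beyond them, as \<open>S_objs_s_le1_later\<close> requires.\<close>
  define m where "m = Suc (max p p')"
  have vS: "v \<in> S_objs" "v' \<in> S_objs"
    using v v' S_objs_iff_sized by blast+
  have "s_le1 (v p) (v m)" "s_le1 (v' p') (v' m)"
    using vS by (auto intro!: S_objs_s_le1_later simp: m_def)
  then have "s_le1 (u n) (v m)" "s_le1 (u' n) (v' m)"
    using p s_le1_trans S_objs_M_infty vS by blast+
  moreover have ru: "u n \<in> rect (k (Suc n)) (k n)" "u' n \<in> rect (k' (Suc n)) (k' n)"
    and rv: "v m \<in> rect (l (Suc m)) (l m)" "v' m \<in> rect (l' (Suc m)) (l' m)"
    using u u' v v' by (auto simp: sized_seq_def)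
  ultimately obtain r t r' t' where
      r: "r \<in> rect (k (Suc n)) (l (Suc m))" and t: "t \<in> rect (l m) (k n)" and eq: "u n = r \<odot> v m \<odot> t"
      and r': "r' \<in> rect (k' (Suc n)) (l' (Suc m))" and t': "t' \<in> rect (l' m) (k' n)"
      and eq': "u' n = r' \<odot> v' m \<odot> t'"
    using s_le1_rect by metis
  have "block_sum_seq k u u' n = block_sum (k (Suc n)) (l (Suc m)) r r' \<odot> block_sum_seq l v v' m
      \<odot> block_sum (l m) (k n) t t'"
    unfolding block_sum_mult [OF r rv(1) r' rv(2)]
      block_sum_mult [OF mat_mult_rect [OF r rv(1)] t mat_mult_rect [OF r' rv(2)] t'] eq eq' ..
  then have "s_le1 (block_sum_seq k u u' n) (block_sum_seq l v v' m)"
    unfolding s_le1_def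
    using rect_imp_M_infty [OF block_sum_rect [OF r r']] rect_imp_M_infty [OF block_sum_rect [OF t t']]
    by blast
  then show "\<exists>m. s_le1 (block_sum_seq k u u' n) (block_sum_seq l v v' m)" ..
qed

section \<open>Addition and order on classes of sequences\<close>

lemma S_mon_simps:
  "carrier S_mon = s_class ` S_objs" "\<one>\<^bsub>S_mon\<^esub> = s_class (\<lambda>_ _ _. 0)"
  "leq S_mon C D \<longleftrightarrow> (\<exists>a\<in>C. \<exists>b\<in>D. s_le a b)"
  by (simp_all add: S_mon_def)

text \<open>Block sums are monotone in both arguments, for any admissible sizes. So neither the
  representatives nor their sizes affect the class, and the definite description has a unique
  value.\<close>

lemma S_mon_mult:
  assumes u: "sized_seq k u" and u': "sized_seq k' u'"
  shows "s_class u \<otimes>\<^bsub>S_mon\<^esub> s_class u' = s_class (block_sum_seq k u u')"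
proof -
  have uS: "u \<in> S_objs" "u' \<in> S_objs"
    using u u' S_objs_iff_sized by blast+
  have "(THE E. \<exists>l l' v v'. v \<in> s_class u \<and> sized_seq l v \<and> v' \<in> s_class u' \<and> sized_seq l' v' \<and>
      E = s_class (block_sum_seq l v v')) = s_class (block_sum_seq k u u')"
  proof (rule the_equality)
    have "u \<in> s_class u" "u' \<in> s_class u'"
      using uS by (simp_all add: mem_s_class_iff)
    then show "\<exists>l l' v v'. v \<in> s_class u \<and> sized_seq l v \<and> v' \<in> s_class u' \<and> sized_seq l' v' \<and>
        s_class (block_sum_seq k u u') = s_class (block_sum_seq l v v')"
      using u u' by blast
  next
    fix E assume "\<exists>l l' v v'. v \<in> s_class u \<and> sized_seq l v \<and> v' \<in> s_class u' \<and> sized_seq l' v' \<and>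
      E = s_class (block_sum_seq l v v')"
    then obtain l l' v v' where v: "s_le u v" "s_le v u" "sized_seq l v"
      and v': "s_le u' v'" "s_le v' u'" "sized_seq l' v'" and E: "E = s_class (block_sum_seq l v v')"
      unfolding s_class_def by blast
    have "block_sum_seq l v v' \<in> S_objs" "block_sum_seq k u u' \<in> S_objs"
      using sized_seq_block_sum [OF u u'] sized_seq_block_sum [OF v(3) v'(3)] S_objs_iff_sized by blast+
    then show "E = s_class (block_sum_seq k u u')"
      unfolding E
      using s_class_eq_iff s_le_block_sum [OF u u' v(3) v'(3) v(1) v'(1)]
        s_le_block_sum [OF v(3) v'(3) u u' v(2) v'(2)] by blast
  qed
  then show ?thesis
    by (simp add: S_mon_def)
qed

lemma S_mon_leq:
  assumes "u \<in> S_objs" "v \<in> S_objs"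
  shows "leq S_mon (s_class u) (s_class v) \<longleftrightarrow> s_le u v"
proof
  assume "leq S_mon (s_class u) (s_class v)"
  then obtain a b where "s_le u a" "s_le b v" "s_le a b" "a \<in> S_objs" "b \<in> S_objs"
    by (auto simp: S_mon_simps s_class_def)
  then show "s_le u v"
    using assms s_le_trans by blast
next
  assume "s_le u v"
  then show "leq S_mon (s_class u) (s_class v)"
    using assms mem_s_class_iff unfolding S_mon_simps by blast
qed

section \<open>Direct sums\<close>

lemma direct_sum_simps [simp]:
  "carrier (direct_sum P Q) = carrier P \<times> carrier Q"
  "madd (direct_sum P Q) (p, q) (p', q') = (madd P p p', madd Q q q')"
  "mzero (direct_sum P Q) = (mzero P, mzero Q)"
  "act (direct_sum P Q) (p, q) r = (act P p r, act Q q r)"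
  by (simp_all add: direct_sum_def)

lemma right_module_direct_sum:
  assumes P: "right_module P" and Q: "right_module Q"
  shows "right_module (direct_sum P Q)"
  by (rule right_moduleI)
    (auto simp: P Q madd_assoc act_madd act_add act_mult madd_comm [OF P] madd_comm [OF Q])

definition upper_part :: "nat \<Rightarrow> (nat \<Rightarrow> 'r::ring_1) \<Rightarrow> nat \<Rightarrow> 'r" where
  "upper_part k v i = (if i < k then v i else 0)"

definition lower_part :: "nat \<Rightarrow> (nat \<Rightarrow> 'r::ring_1) \<Rightarrow> nat \<Rightarrow> 'r" where
  "lower_part k v i = v (i + k)"

lemma upper_part_hom: "upper_part k \<in> mod_hom (free_module (k + l)) (free_module k)"
  by (rule mod_homI) (auto simp: carrier_free_module upper_part_def)

lemma lower_part_hom: "lower_part k \<in> mod_hom (free_module (k + l)) (free_module l)"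
  by (rule mod_homI) (auto simp: carrier_free_module lower_part_def)

lemma parts_eqI:
  assumes "upper_part k v = upper_part k w" "lower_part k v = lower_part k w"
  shows "v = w"
proof
  fix i
  show "v i = w i"
    using fun_cong [OF assms(1), of i] fun_cong [OF assms(2), of "i - k"]
    by (cases "i < k") (auto simp: upper_part_def lower_part_def)
qed

lemma parts_exist:
  assumes v: "v \<in> carrier (free_module k)" and w: "w \<in> carrier (free_module l)"
  shows "\<exists>u\<in>carrier (free_module (k + l)). upper_part k u = v \<and> lower_part k u = w"
  by (rule bexI [of _ "\<lambda>i. if i < k then v i else w (i - k)"])
    (use v w in \<open>auto simp: carrier_free_module upper_part_def lower_part_def\<close>)

lemma mat_vec_block_sum:
  fixes x y :: "'r::ring_1 mat"
  assumes x: "x \<in> rect k l" and y: "y \<in> rect k' l'"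
  shows "upper_part k (mat_vec (block_sum k l x y) v) = mat_vec x (upper_part l v)"
    and "lower_part k (mat_vec (block_sum k l x y) v) = mat_vec y (lower_part l v)"
proof -
  have eq: "mat_vec (block_sum k l x y) v i =
      (\<Sum>j<l. block_sum k l x y i j * v j) + (\<Sum>j<l'. block_sum k l x y i (j + l) * v (j + l))" for i
    unfolding mat_vec_rect [OF block_sum_rect [OF x y]] sum_lessThan_add ..
  show "upper_part k (mat_vec (block_sum k l x y) v) = mat_vec x (upper_part l v)"
    by (rule ext)
      (unfold upper_part_def eq mat_vec_rect [OF x], auto simp: block_sum_def rect_zero [OF x])
  show "lower_part k (mat_vec (block_sum k l x y) v) = mat_vec y (lower_part l v)"
    by (rule ext) (unfold lower_part_def eq mat_vec_rect [OF y], simp add: block_sum_def)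
qed

lemma push_block_sum:
  fixes x z :: "nat \<Rightarrow> 'r::ring_1 mat"
  assumes x: "sized_seq n x" and z: "sized_seq m z"
  defines "B \<equiv> \<lambda>i. mat_vec (block_sum_seq n x z i)"
  shows "upper_part (n (i + d)) (push B i d v) = push (\<lambda>i. mat_vec (x i)) i d (upper_part (n i) v)"
    and "lower_part (n (i + d)) (push B i d v) = push (\<lambda>i. mat_vec (z i)) i d (lower_part (n i) v)"
proof -
  have B: "upper_part (n (Suc i)) (B i v) = mat_vec (x i) (upper_part (n i) v)"
    "lower_part (n (Suc i)) (B i v) = mat_vec (z i) (lower_part (n i) v)" for i v
    unfolding B_def by (rule mat_vec_block_sum [OF sized_rect [OF x] sized_rect [OF z]])+
  show "upper_part (n (i + d)) (push B i d v) = push (\<lambda>i. mat_vec (x i)) i d (upper_part (n i) v)"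
    by (induction d) (simp_all add: B)
  show "lower_part (n (i + d)) (push B i d v) = push (\<lambda>i. mat_vec (z i)) i d (lower_part (n i) v)"
    by (induction d) (simp_all add: B)
qed

text \<open>The cocone splits a column into the part for \<open>P\<close> and the part for
  \<open>Q\<close>. The two components of an equality may take different numbers of steps to appear;
  the maximum serves for both.\<close>

lemma represents_direct_sum:
  fixes P :: "('r::ring_1, 'p) rmodule"
  assumes P: "represents P n x" and Q: "represents Q m z"
  shows "represents (direct_sum P Q) (\<lambda>i. n i + m i) (block_sum_seq n x z)"
proof -
  have x: "sized_seq n x" and z: "sized_seq m z"
    using P Q by (auto simp: represents_def)
  obtain \<phi> \<chi> where \<phi>: "is_dirlim P (\<lambda>i. free_module (n i)) (\<lambda>i. mat_vec (x i)) \<phi>"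
    and \<chi>: "is_dirlim Q (\<lambda>i. free_module (m i)) (\<lambda>i. mat_vec (z i)) \<chi>"
    using P Q by (auto simp: represents_def)
  note sized = sized_seq_block_sum [OF x z]
  note block = mat_vec_block_sum [OF sized_rect [OF x] sized_rect [OF z]]
  note upper = mod_hom_closed [OF upper_part_hom] and lower = mod_hom_closed [OF lower_part_hom]
  let ?B = "\<lambda>i. mat_vec (block_sum_seq n x z i)"
  define \<theta> where "\<theta> i v = (\<phi> i (upper_part (n i) v), \<chi> i (lower_part (n i) v))" for i v
  have "is_dirlim (direct_sum P Q) (\<lambda>i. free_module (n i + m i)) ?B \<theta>"
  proof (rule is_dirlimI)
    show "right_module (direct_sum P Q)"
      by (intro right_module_direct_sum is_dirlim_module [OF \<phi>] is_dirlim_module [OF \<chi>])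
    show "directed_system (\<lambda>i. free_module (n i + m i)) ?B"
      by (rule matrix_system [OF sized])
    fix i
    have hom: "(\<lambda>v. \<phi> i (upper_part (n i) v)) \<in> mod_hom (free_module (n i + m i)) P"
      "(\<lambda>v. \<chi> i (lower_part (n i) v)) \<in> mod_hom (free_module (n i + m i)) Q"
      by (rule mod_hom_comp [OF upper_part_hom is_dirlim_hom [OF \<phi>]]
          mod_hom_comp [OF lower_part_hom is_dirlim_hom [OF \<chi>]])+
    show "\<theta> i \<in> mod_hom (free_module (n i + m i)) (direct_sum P Q)"
      unfolding \<theta>_def [abs_def]
      using mod_hom_closed [OF hom(1)] mod_hom_closed [OF hom(2)]
        mod_hom_madd [OF hom(1)] mod_hom_madd [OF hom(2)] mod_hom_act [OF hom(1)] mod_hom_act [OF hom(2)]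
      by (intro mod_homI) simp_all
    fix v :: "nat \<Rightarrow> 'r" assume v: "v \<in> carrier (free_module (n i + m i))"
    show "\<theta> (Suc i) (?B i v) = \<theta> i v"
      using is_dirlim_compat [OF \<phi> upper [OF v]] is_dirlim_compat [OF \<chi> lower [OF v]]
      by (simp add: \<theta>_def block)
    fix w :: "nat \<Rightarrow> 'r" assume w: "w \<in> carrier (free_module (n i + m i))" and eq: "\<theta> i v = \<theta> i w"
    obtain d where d: "\<And>e. d \<le> e \<Longrightarrow> push (\<lambda>i. mat_vec (x i)) i e (upper_part (n i) v)
        = push (\<lambda>i. mat_vec (x i)) i e (upper_part (n i) w)"
      using is_dirlim_eventually_eq [OF \<phi>, OF upper [OF v] upper [OF w]] eq by (auto simp: \<theta>_def)
    obtain d' where d': "\<And>e. d' \<le> e \<Longrightarrow> push (\<lambda>i. mat_vec (z i)) i e (lower_part (n i) v)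
        = push (\<lambda>i. mat_vec (z i)) i e (lower_part (n i) w)"
      using is_dirlim_eventually_eq [OF \<chi>, OF lower [OF v] lower [OF w]] eq by (auto simp: \<theta>_def)
    have "upper_part (n (i + max d d')) (push ?B i (max d d') v)
        = upper_part (n (i + max d d')) (push ?B i (max d d') w)"
      unfolding push_block_sum(1) [OF x z] by (rule d) simp
    moreover have "lower_part (n (i + max d d')) (push ?B i (max d d') v)
        = lower_part (n (i + max d d')) (push ?B i (max d d') w)"
      unfolding push_block_sum(2) [OF x z] by (rule d') simp
    ultimately have "push ?B i (max d d') v = push ?B i (max d d') w"
      by (rule parts_eqI)
    then show "\<exists>d. push ?B i d v = push ?B i d w"
      by (intro exI [of _ "max d d'"])
  next
    fix pq assume "pq \<in> carrier (direct_sum P Q)"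
    then obtain p q where pq: "pq = (p, q)" "p \<in> carrier P" "q \<in> carrier Q"
      by auto
    obtain i where i: "\<And>k. i \<le> k \<Longrightarrow> \<exists>v\<in>carrier (free_module (n k)). \<phi> k v = p"
      using is_dirlim_eventually_mem [OF \<phi> pq(2)] by blast
    obtain j where j: "\<And>k. j \<le> k \<Longrightarrow> \<exists>v\<in>carrier (free_module (m k)). \<chi> k v = q"
      using is_dirlim_eventually_mem [OF \<chi> pq(3)] by blast
    let ?k = "max i j"
    obtain v w where vw: "v \<in> carrier (free_module (n ?k))" "\<phi> ?k v = p"
      "w \<in> carrier (free_module (m ?k))" "\<chi> ?k w = q"
      using i [of ?k] j [of ?k] by auto
    obtain u where "u \<in> carrier (free_module (n ?k + m ?k))" "upper_part (n ?k) u = v" "lower_part (n ?k) u = w"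
      using parts_exist [OF vw(1,3)] by blast
    then have "\<theta> ?k u = pq"
      by (simp add: \<theta>_def vw pq)
    with \<open>u \<in> _\<close> show "\<exists>i. \<exists>v\<in>carrier (free_module (n i + m i)). \<theta> i v = pq"
      by blast
  qed
  then show ?thesis
    unfolding represents_def using sized by blast
qed

lemma sized_seq_zero: "sized_seq (\<lambda>_. 0) (\<lambda>_ _ _. 0)"
  by (auto simp: sized_seq_def rect_def mat_mult_def fun_eq_iff)

lemma represents_zero_module:
  "represents (zero_module :: ('r::ring_1, unit) rmodule) (\<lambda>_. 0) (\<lambda>_ _ _. 0)"
proof -
  have "is_dirlim (zero_module :: ('r, unit) rmodule) (\<lambda>i. free_module 0) (\<lambda>i. mat_vec (\<lambda>_ _. 0)) (\<lambda>_ _. ())"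
  proof (rule is_dirlimI)
    show "right_module (zero_module :: ('r, unit) rmodule)"
      by (rule right_moduleI) (simp_all add: zero_module_def)
    show "directed_system (\<lambda>i. free_module 0) (\<lambda>i. mat_vec (\<lambda>_ _. 0 :: 'r))"
      using matrix_system [OF sized_seq_zero] by simp
    show "(\<lambda>_. ()) \<in> mod_hom (free_module 0) (zero_module :: ('r, unit) rmodule)"
      by (rule mod_homI) (simp_all add: zero_module_def)
    show "\<exists>i. \<exists>v\<in>carrier (free_module 0 :: 'r seq_module). () = p" for p
      by (rule exI, rule bexI [of _ "\<lambda>_. 0"]) (simp_all add: carrier_free_module)
    fix i and v w :: "nat \<Rightarrow> 'r"
    assume "v \<in> carrier (free_module 0)" "w \<in> carrier (free_module 0)"
    then have "v = w"
      by (auto simp: carrier_free_module)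
    then show "\<exists>d. push (\<lambda>i. mat_vec (\<lambda>_ _. 0)) i d v = push (\<lambda>i. mat_vec (\<lambda>_ _. 0)) i d w"
      by simp
  qed simp
  then show ?thesis
    unfolding represents_def using sized_seq_zero by blast
qed

section \<open>Countably generated projective modules\<close>

text \<open>The underlying set of the free module of countable rank.\<close>

definition fin_seqs :: "(nat \<Rightarrow> 'r::ring_1) set" where
  "fin_seqs = (\<Union>n. carrier (free_module n))"

lemma free_module_mono: "n \<le> m \<Longrightarrow> v \<in> carrier (free_module n) \<Longrightarrow> v \<in> carrier (free_module m)"
  by (simp add: carrier_free_module)

lemma fin_seqs_common:
  assumes "v \<in> fin_seqs" "w \<in> fin_seqs"
  obtains n where "v \<in> carrier (free_module n)" "w \<in> carrier (free_module n)"
proof -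
  obtain n m where "v \<in> carrier (free_module n)" "w \<in> carrier (free_module m)"
    using assms by (auto simp: fin_seqs_def)
  then show ?thesis
    using that [of "max n m"] free_module_mono [of n "max n m" v] free_module_mono [of m "max n m" w]
    by simp
qed

lemma free_module_fin_seqs: "v \<in> carrier (free_module n) \<Longrightarrow> v \<in> fin_seqs"
  by (auto simp: fin_seqs_def)

lemma fin_seqs_closed:
  "v \<in> fin_seqs \<Longrightarrow> w \<in> fin_seqs \<Longrightarrow> (\<lambda>i. v i + w i) \<in> fin_seqs"
  "(\<lambda>_. 0) \<in> fin_seqs"
  "v \<in> fin_seqs \<Longrightarrow> (\<lambda>i. v i * r) \<in> fin_seqs"
proof -
  show "(\<lambda>i. v i + w i) \<in> fin_seqs" if vw: "v \<in> fin_seqs" "w \<in> fin_seqs"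
  proof -
    obtain n where "v \<in> carrier (free_module n)" "w \<in> carrier (free_module n)"
      using fin_seqs_common [OF vw] by blast
    then show ?thesis
      by (intro free_module_fin_seqs [of _ n]) (simp add: carrier_free_module)
  qed
  show "(\<lambda>i. v i * r) \<in> fin_seqs" if v: "v \<in> fin_seqs"
  proof -
    obtain n where "v \<in> carrier (free_module n)"
      using fin_seqs_common [OF v v] by blast
    then show ?thesis
      by (intro free_module_fin_seqs [of _ n]) (simp add: carrier_free_module)
  qed
  show "(\<lambda>_. 0) \<in> fin_seqs"
    by (intro free_module_fin_seqs [of _ 0]) (simp add: carrier_free_module)
qed

lemma right_module_fin_seqs [simp]: "right_module (fun_module fin_seqs)"
  by (intro right_module_fun_module fin_seqs_closed)

lemma hom_from_fin_seqs: "f \<in> mod_hom (fun_module fin_seqs) M \<Longrightarrow> f \<in> mod_hom (free_module n) M"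
  by (auto simp: mod_hom_def Pi_iff free_module_fin_seqs)

lemma hom_to_fin_seqs: "f \<in> mod_hom M (free_module n) \<Longrightarrow> f \<in> mod_hom M (fun_module fin_seqs)"
  by (auto simp: mod_hom_def Pi_iff intro: free_module_fin_seqs)

lemma countably_generated_surjection:
  fixes P :: "('r::ring_1, 'p) rmodule"
  assumes P: "right_module P" and "countably_generated P"
  shows "\<exists>\<pi>\<in>mod_hom (fun_module fin_seqs) P. \<pi> ` fin_seqs = carrier P"
proof -
  obtain G where G: "G \<subseteq> carrier P" "countable G" "mspan P G = carrier P"
    using assms(2) by (auto simp: countably_generated_def)
  \<comment> \<open>Zero is added so that the set is nonempty and \<open>from_nat_into\<close>
    enumerates exactly its elements.\<close>
  define g where "g = from_nat_into (insert (mzero P) G)"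
  have range_g: "range g = insert (mzero P) G"
    unfolding g_def using G(2) by (intro range_from_nat_into) auto
  have g: "g j \<in> carrier P" for j
  proof -
    have "g j \<in> insert (mzero P) G" unfolding range_g [symmetric] by (rule rangeI)
    then show ?thesis using G(1) P by auto
  qed
  \<comment> \<open>A finitely supported sequence fits many lengths. The least one is a choice,
    shown next to give the same value as any other.\<close>
  define \<pi> where "\<pi> v = lin_comb P g v (LEAST n. v \<in> carrier (free_module n))" for v
  have \<pi>: "\<pi> v = lin_comb P g v n" if "v \<in> carrier (free_module n)" for v n
  proof -
    define m where "m = (LEAST n. v \<in> carrier (free_module n))"
    have "v \<in> carrier (free_module m)"
      unfolding m_def by (rule LeastI [of "\<lambda>n. v \<in> carrier (free_module n)", OF that])
    moreover have "m \<le> n"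
      unfolding m_def by (rule Least_le [of "\<lambda>n. v \<in> carrier (free_module n)", OF that])
    moreover have "\<pi> v = lin_comb P g v m"
      by (simp add: \<pi>_def m_def)
    ultimately show ?thesis
      using lin_comb_extend [of P g m v n] P g by (simp add: carrier_free_module)
  qed
  have hom: "\<pi> \<in> mod_hom (fun_module fin_seqs) P"
  proof (rule mod_homI; simp)
    fix v w :: "nat \<Rightarrow> 'r" and r
    assume v: "v \<in> fin_seqs"
    then obtain n where n: "v \<in> carrier (free_module n)"
      using fin_seqs_common by blast
    show "\<pi> v \<in> carrier P"
      unfolding \<pi> [OF n] by (intro lin_comb_closed P g)
    have "(\<lambda>i. v i * r) \<in> carrier (free_module n)"
      using n by (simp add: carrier_free_module)
    then show "\<pi> (\<lambda>i. v i * r) = act P (\<pi> v) r"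
      using \<pi> [OF n] by (simp add: \<pi> lin_comb_act P g)
    assume w: "w \<in> fin_seqs"
    obtain n where n: "v \<in> carrier (free_module n)" "w \<in> carrier (free_module n)"
      using fin_seqs_common [OF v w] by blast
    have "(\<lambda>i. v i + w i) \<in> carrier (free_module n)"
      using n by (simp add: carrier_free_module)
    then show "\<pi> (\<lambda>i. v i + w i) = madd P (\<pi> v) (\<pi> w)"
      using \<pi> [OF n(1)] \<pi> [OF n(2)] by (simp add: \<pi> lin_comb_add P g)
  qed
  have "\<pi> (unit_vec j) = g j" for j
    using \<pi> [of "unit_vec j" "Suc j"] lin_comb_at_unit_vec [of P "Suc j" g j] P g by simp
  then have "g j \<in> \<pi> ` fin_seqs" for j
    using free_module_fin_seqs [OF unit_vec_closed [of j "Suc j"]] by (metis image_eqI lessI)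
  then have "range g \<subseteq> \<pi> ` fin_seqs"
    by blast
  then have "G \<subseteq> \<pi> ` fin_seqs"
    unfolding range_g by simp
  then have "mspan P G \<subseteq> \<pi> ` fin_seqs"
    using image_submodule [OF right_module_fin_seqs P hom] by (intro mspan_subset) simp_all
  then have "\<pi> ` fin_seqs = carrier P"
    using G(3) mod_hom_closed [OF hom] by auto
  with hom show ?thesis by blast
qed

text \<open>Lets the position \<open>j\<close> be recovered from the unit vector, which is how
  positions are encoded as sequences below.\<close>

lemma inj_unit_vec: "inj (unit_vec :: nat \<Rightarrow> nat \<Rightarrow> 'r::ring_1)"
proof (rule injI)
  fix j k assume "(unit_vec j :: nat \<Rightarrow> 'r) = unit_vec k"
  from fun_cong [OF this, of j] show "j = k"
    by (simp add: unit_vec_def split: if_splits)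
qed

text \<open>
  The test module \<open>A\<close> is a copy of the module of finitely supported sequences inside the type that
  \<^const>\<open>projective\<close> admits: \<open>v\<close> is encoded as a function on sequences, with \<open>v j\<close> being the
  value at the \<open>j\<close>-th unit vector.
\<close>

lemma projective_section:
  fixes P :: "'r::ring_1 seq_module"
  assumes P: "right_module P" "countably_generated P" "projective P"
  shows "\<exists>\<pi>\<in>mod_hom (fun_module fin_seqs) P. \<exists>s\<in>mod_hom P (fun_module fin_seqs).
    \<forall>p\<in>carrier P. \<pi> (s p) = p"
proof -
  obtain \<pi> where \<pi>: "\<pi> \<in> mod_hom (fun_module fin_seqs) P" "\<pi> ` fin_seqs = carrier P"
    using countably_generated_surjection [OF P(1,2)] by blast
  define J :: "(nat \<Rightarrow> 'r) \<Rightarrow> nat" where "J = inv_into UNIV unit_vec"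
  have J: "J (unit_vec j) = j" for j
    unfolding J_def by (rule inv_f_f [OF inj_unit_vec])
  define enc :: "(nat \<Rightarrow> 'r) \<Rightarrow> (nat \<Rightarrow> 'r) \<Rightarrow> 'r" where "enc v m = v (J m)" for v m
  define dec :: "((nat \<Rightarrow> 'r) \<Rightarrow> 'r) \<Rightarrow> nat \<Rightarrow> 'r" where "dec a i = a (unit_vec i)" for a i
  define A where "A = fun_module (enc ` fin_seqs)"
  have dec_enc: "dec (enc v) = v" for v
    by (simp add: dec_def enc_def J fun_eq_iff)
  have A: "right_module A"
    unfolding A_def
  proof (rule right_module_fun_module)
    fix a b r assume a: "a \<in> enc ` fin_seqs"
    then obtain v where v: "v \<in> fin_seqs" "a = enc v" by blast
    have "(\<lambda>m. a m * r) = enc (\<lambda>i. v i * r)"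
      by (simp add: v(2) enc_def fun_eq_iff)
    then show "(\<lambda>m. a m * r) \<in> enc ` fin_seqs"
      using fin_seqs_closed(3) [OF v(1)] by blast
    assume b: "b \<in> enc ` fin_seqs"
    then obtain w where w: "w \<in> fin_seqs" "b = enc w" by blast
    have "(\<lambda>m. a m + b m) = enc (\<lambda>i. v i + w i)"
      by (simp add: v(2) w(2) enc_def fun_eq_iff)
    then show "(\<lambda>m. a m + b m) \<in> enc ` fin_seqs"
      using fin_seqs_closed(1) [OF v(1) w(1)] by blast
  next
    have "(\<lambda>_. 0) = enc (\<lambda>_. 0)"
      by (simp add: enc_def fun_eq_iff)
    then show "(\<lambda>_. 0) \<in> enc ` fin_seqs"
      using fin_seqs_closed(2) by blast
  qed
  have dec: "dec \<in> mod_hom A (fun_module fin_seqs)"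
    by (rule mod_homI) (auto simp: A_def dec_enc, simp_all add: dec_def enc_def J fun_eq_iff)
  have g: "(\<lambda>a. \<pi> (dec a)) \<in> mod_hom A P"
    by (rule mod_hom_comp [OF dec \<pi>(1)])
  have "(\<lambda>a. \<pi> (dec a)) ` carrier A = carrier P"
    by (simp add: A_def image_image dec_enc \<pi>(2))
  then obtain h where h: "h \<in> mod_hom P A" "\<forall>p\<in>carrier P. \<pi> (dec (h p)) = p"
    using P(3) [unfolded projective_def, rule_format, OF A P(1) g mod_hom_id] by blast
  show ?thesis
    by (rule bexI [OF _ \<pi>(1)], rule bexI [OF _ mod_hom_comp [OF h(1) dec]], rule h(2))
qed

section \<open>Presentation of a retract of a free module as a limit\<close>

lemma mat_vec_mat_trunc: "mat_vec (mat_trunc k l e) v i = (if i < k then \<Sum>j<l. e i j * v j else 0)"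
  unfolding mat_vec_rect [OF mat_trunc_rect] by (simp add: mat_trunc_def)

text \<open>
  The matrices \<open>x i\<close> are finite corners of the matrix \<open>e\<close> of the idempotent \<open>s \<circ> \<pi>\<close>, so that
  \<open>x (i + 1) x i = x i\<close>.
\<close>

lemma retract_is_dirlim:
  fixes P :: "('r::ring_1, 'p) rmodule"
  assumes P: "right_module P" and \<pi>: "\<pi> \<in> mod_hom (fun_module fin_seqs) P"
    and s: "s \<in> mod_hom P (fun_module fin_seqs)" and \<pi>s': "\<forall>p\<in>carrier P. \<pi> (s p) = p"
    and T: "0 \<in> T" "\<forall>p\<in>carrier P. \<forall>i. s p i \<in> T"
  shows "\<exists>n x y \<phi>. (\<forall>i. x i \<in> rect (n (Suc i)) (n i)) \<and>
    (\<forall>i. y i \<in> rect (n (Suc i)) (n (Suc (Suc i)))) \<and> (\<forall>i. y i \<odot> x (Suc i) \<odot> x i = x i) \<and>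
    (\<forall>i j k. x i j k \<in> T \<and> y i j k \<in> T) \<and>
    is_dirlim P (\<lambda>i. free_module (n i)) (\<lambda>i. mat_vec (x i)) \<phi>"
proof -
  have \<pi>s: "\<pi> (s p) = p" if "p \<in> carrier P" for p
    using \<pi>s' that by blast
  have unit: "unit_vec j \<in> fin_seqs" for j
    using free_module_fin_seqs [OF unit_vec_closed [of j "Suc j"]] by simp
  have s_fin: "s p \<in> fin_seqs" if "p \<in> carrier P" for p
    using mod_hom_closed [OF s that] by simp
  have \<pi>_closed: "\<pi> v \<in> carrier P" if "v \<in> fin_seqs" for v
    using mod_hom_closed [OF \<pi>] that by simp
  define e where "e i j = s (\<pi> (unit_vec j)) i" for i j
  \<comment> \<open>Columns of \<open>e\<close> are values of \<open>s\<close>. The set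
    \<open>T\<close> records where the coefficients lie: it will be the whole ring, or the ideal R
    in the unitization.\<close>
  have eT: "e i j \<in> T" for i j
    unfolding e_def using T(2) \<pi>_closed [OF unit] by blast
  have "\<forall>j. \<exists>c. \<forall>i\<ge>c. e i j = 0"
  proof
    fix j
    obtain c where "s (\<pi> (unit_vec j)) \<in> carrier (free_module c)"
      using fin_seqs_common [OF s_fin s_fin, OF \<pi>_closed \<pi>_closed, OF unit unit] by blast
    then show "\<exists>c. \<forall>i\<ge>c. e i j = 0"
      unfolding e_def carrier_free_module by blast
  qed
  then obtain c where c: "\<And>i j. c j \<le> i \<Longrightarrow> e i j = 0"
    by metis
  \<comment> \<open>Adding the bounds \<open>c j\<close> makes row size \<open>n (i + 1)\<close>
    contain the whole support of the columns \<open>j < n i\<close>, so \<open>x i\<close> loses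
    nothing of them. The successor forces \<open>n i \<ge> i\<close>, so every finite sequence fits
    some stage.\<close>
  define n where "n = rec_nat 0 (\<lambda>_ k. Suc (k + (\<Sum>j<k. c j)))"
  have n_Suc: "n (Suc i) = Suc (n i + (\<Sum>j<n i. c j))" for i
    by (simp add: n_def)
  have n_ge: "i \<le> n i" for i
    by (induction i) (simp_all add: n_Suc)
  have n_mono: "n i \<le> n (Suc i)" for i
    by (simp add: n_Suc)
  have c_n: "c j \<le> n (Suc i)" if "j < n i" for i j
    using that member_le_sum [of j "{..<n i}" c] by (simp add: n_Suc)
  define x where "x i = mat_trunc (n (Suc i)) (n i) e" for i
  define y where "y i = mat_trunc (n (Suc i)) (n (Suc (Suc i))) e" for i
  have rx: "x i \<in> rect (n (Suc i)) (n i)" and ry: "y i \<in> rect (n (Suc i)) (n (Suc (Suc i)))" for i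
    by (simp_all add: x_def y_def mat_trunc_rect)
  note x_hom = mat_vec_hom [OF rx] and \<pi>_hom = hom_from_fin_seqs [OF \<pi>]
  have x_eq: "mat_vec (x i) v = s (\<pi> v)" if v: "v \<in> carrier (free_module (n i))" for i v
  proof (rule mod_hom_free_module_eqI [OF right_module_fin_seqs hom_to_fin_seqs [OF x_hom] mod_hom_comp [OF \<pi>_hom s] _ v])
    fix j assume "j < n i"
    then show "mat_vec (x i) (unit_vec j) = s (\<pi> (unit_vec j))"
      using c c_n [of j i] unfolding mat_vec_unit_vec
      by (auto simp: fun_eq_iff x_def mat_trunc_def e_def [symmetric])
  qed
  have yxx: "y i \<odot> x (Suc i) \<odot> x i = x i" for i
  proof (rule rect_eqI)
    show "y i \<odot> x (Suc i) \<odot> x i \<in> rect (n (Suc i)) (n i)"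
      by (rule mat_mult_rect [OF mat_mult_rect [OF ry rx] rx])
    show "x i \<in> rect (n (Suc i)) (n i)" by (rule rx)
    fix v :: "nat \<Rightarrow> 'r" assume v: "v \<in> carrier (free_module (n i))"
    let ?w = "mat_vec (x i) v"
    have w: "?w \<in> carrier (free_module (n (Suc i)))"
      by (rule mod_hom_closed [OF x_hom v])
    then have w': "?w \<in> carrier (free_module (n (Suc (Suc i))))"
      using free_module_mono [OF n_mono] by blast
    have sw: "s (\<pi> ?w) = ?w"
      unfolding x_eq [OF v] using \<pi>s \<pi>_closed free_module_fin_seqs [OF v] by simp
    have x_w: "mat_vec (x (Suc i)) ?w = ?w" "mat_vec (x (Suc (Suc i))) ?w = ?w"
      using x_eq [OF w] x_eq [OF w'] sw by simp_all
    have "mat_vec (y i) ?w = ?w"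
    proof
      fix k
      \<comment> \<open>\<open>y i\<close> is the corner \<open>x (i + 2)\<close> with fewer rows.
        The rows cut off are those where \<open>?w\<close>, which is fixed by
        \<open>x (i + 2)\<close>, vanishes anyway.\<close>
      have "mat_vec (y i) ?w k = (if k < n (Suc i) then mat_vec (x (Suc (Suc i))) ?w k else 0)"
        using n_mono [of "Suc i"] n_mono [of "Suc (Suc i)"] by (simp add: y_def x_def mat_vec_mat_trunc)
      also have "\<dots> = ?w k"
        unfolding x_w(2) using w by (simp add: carrier_free_module)
      finally show "mat_vec (y i) ?w k = ?w k" .
    qed
    then have "mat_vec (y i) (mat_vec (x (Suc i)) ?w) = ?w"
      unfolding x_w(1) .
    then show "mat_vec (y i \<odot> x (Suc i) \<odot> x i) v = mat_vec (x i) v"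
      by (simp add: mat_vec_mat_mult [OF rx])
  qed
  have sized: "sized_seq n x"
    unfolding sized_seq_def using rx ry yxx by blast
  \<comment> \<open>The cocone is the map \<pi> at every stage. Since
    \<open>x i v = s (\<pi> v)\<close>, vectors with the same image coincide after one step.\<close>
  have "is_dirlim P (\<lambda>i. free_module (n i)) (\<lambda>i. mat_vec (x i)) (\<lambda>i. \<pi>)"
  proof (rule is_dirlimI)
    fix i
    fix v :: "nat \<Rightarrow> 'r" assume v: "v \<in> carrier (free_module (n i))"
    show "\<pi> (mat_vec (x i) v) = \<pi> v"
      unfolding x_eq [OF v] by (intro \<pi>s \<pi>_closed free_module_fin_seqs [OF v])
    fix w :: "nat \<Rightarrow> 'r" assume w: "w \<in> carrier (free_module (n i))" and "\<pi> v = \<pi> w"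
    then have "push (\<lambda>i. mat_vec (x i)) i 1 v = push (\<lambda>i. mat_vec (x i)) i 1 w"
      using x_eq [OF v] x_eq [OF w] by simp
    then show "\<exists>d. push (\<lambda>i. mat_vec (x i)) i d v = push (\<lambda>i. mat_vec (x i)) i d w"
      by (intro exI [of _ 1])
  next
    fix p assume p: "p \<in> carrier P"
    obtain k where "s p \<in> carrier (free_module k)"
      using fin_seqs_common [OF s_fin [OF p] s_fin [OF p]] by blast
    then have "s p \<in> carrier (free_module (n k))"
      using free_module_mono [OF n_ge] by blast
    then show "\<exists>i. \<exists>v\<in>carrier (free_module (n i)). \<pi> v = p"
      using \<pi>s [OF p] by blast
  qed (use P matrix_system [OF sized] \<pi>_hom in simp_all)
  moreover have "x i j k \<in> T" "y i j k \<in> T" for i j k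
    using T(1) eT by (simp_all add: x_def y_def mat_trunc_def)
  ultimately show ?thesis
    using rx ry yxx by blast
qed

lemma CP_unital_objs_represented:
  assumes "P \<in> CP_unital_objs"
  shows "\<exists>n x. represents P n x"
proof -
  have P: "right_module P" "countably_generated P" "projective P"
    using assms by (auto simp: CP_unital_objs_def)
  obtain \<pi> s where ps: "\<pi> \<in> mod_hom (fun_module fin_seqs) P" "s \<in> mod_hom P (fun_module fin_seqs)"
    "\<forall>p\<in>carrier P. \<pi> (s p) = p"
    using projective_section [OF P] by blast
  obtain n x y \<phi> where "\<And>i. x i \<in> rect (n (Suc i)) (n i)"
    "\<And>i. y i \<in> rect (n (Suc i)) (n (Suc (Suc i)))" "\<And>i. y i \<odot> x (Suc i) \<odot> x i = x i"
    "is_dirlim P (\<lambda>i. free_module (n i)) (\<lambda>i. mat_vec (x i)) \<phi>"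
    using retract_is_dirlim [OF P(1) ps, of UNIV] by auto
  then show ?thesis
    unfolding represents_def sized_seq_def by blast
qed

text \<open>The limit has elements of the wrong type. It is countably generated and has the lifting
  property, so a surjection from the free module of countable rank has a section \<open>s\<close>;
  the image of \<open>s\<close> is an isomorphic copy made of sequences.\<close>

lemma sized_seq_represents_CP_unital:
  fixes x :: "nat \<Rightarrow> 'r::ring_1 mat"
  assumes sized: "sized_seq n x"
  shows "\<exists>P\<in>CP_unital_objs. represents P n x"
proof -
  let ?L = "mat_lim n x"
  obtain \<phi> where lim: "is_dirlim ?L (\<lambda>i. free_module (n i)) (\<lambda>i. mat_vec (x i)) \<phi>"
    unfolding mat_lim_def using is_dirlim_dirlim [OF matrix_system [OF sized]] by blast
  note L = is_dirlim_module [OF lim]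
  obtain \<pi> where \<pi>: "\<pi> \<in> mod_hom (fun_module fin_seqs) ?L" "\<pi> ` fin_seqs = carrier ?L"
    using countably_generated_surjection [OF L limit_countably_generated [OF sized lim]] by blast
  obtain s where s: "s \<in> mod_hom ?L (fun_module fin_seqs)" "\<And>p. p \<in> carrier ?L \<Longrightarrow> \<pi> (s p) = p"
    using limit_lift [OF sized lim right_module_fin_seqs L \<pi>(1) _ mod_hom_id] \<pi>(2) by auto
  define P where "P = fun_module (s ` carrier ?L)"
  have "is_submodule (fun_module fin_seqs) (s ` carrier ?L)"
    by (rule image_submodule [OF L right_module_fin_seqs s(1)])
  then have P: "right_module P"
    unfolding P_def by (intro right_module_fun_module) (auto simp: is_submodule_def)
  have "s \<in> mod_hom ?L P"
    using mod_hom_madd [OF s(1)] mod_hom_act [OF s(1)] by (intro mod_homI) (simp_all add: P_def)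
  moreover have "bij_betw s (carrier ?L) (carrier P)"
    unfolding bij_betw_def P_def using s(2) by (auto intro: inj_on_inverseI)
  ultimately have limP: "is_dirlim P (\<lambda>i. free_module (n i)) (\<lambda>i. mat_vec (x i)) (\<lambda>i v. s (\<phi> i v))"
    using is_dirlim_iso [OF lim] P by blast
  have "projective P"
    unfolding projective_def using limit_lift [OF sized limP] by blast
  then have "P \<in> CP_unital_objs"
    using P limit_countably_generated [OF sized limP] by (simp add: CP_unital_objs_def)
  moreover have "represents P n x"
    unfolding represents_def using sized limP by blast
  ultimately show ?thesis by blast
qed

section \<open>The comparison of ordered monoids\<close>

lemma represents_S_objs: "represents P n x \<Longrightarrow> x \<in> S_objs"
  unfolding represents_def S_objs_iff_sized by blast

text \<open>Transitivity of \<open>cp_le\<close> is borrowed from \<open>s_le\<close> through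
  representing sequences. \<open>P\<close> and \<open>Q\<close> may come from outside
  \<open>K\<close>, as direct sums and \<open>zero_module\<close> do.\<close>

lemma cp_class_cong:
  assumes K: "\<And>R. R \<in> K \<Longrightarrow> \<exists>l w. represents R l w"
    and P: "represents P n x" and Q: "represents Q m z" and le: "s_le x z" "s_le z x"
  shows "cp_class K P = cp_class K Q"
proof -
  have "cp_le P R \<and> cp_le R P \<longleftrightarrow> cp_le Q R \<and> cp_le R Q" if RK: "R \<in> K" for R
  proof -
    obtain l w where R: "represents R l w"
      using K [OF RK] by blast
    show ?thesis
      unfolding cp_le_iff_s_le [OF P R] cp_le_iff_s_le [OF R P] cp_le_iff_s_le [OF Q R] cp_le_iff_s_le [OF R Q]
      using le s_le_trans [OF represents_S_objs [OF P]] s_le_trans [OF represents_S_objs [OF Q]]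
        s_le_trans [OF represents_S_objs [OF R]] by blast
  qed
  then show ?thesis
    by (auto simp: cp_class_def)
qed

lemma cp_class_self:
  "P \<in> K \<Longrightarrow> represents P n x \<Longrightarrow> P \<in> cp_class K P"
  by (simp add: cp_class_def cp_le_iff_s_le s_le_refl represents_S_objs)

lemma cp_classE:
  assumes "P' \<in> cp_class K P" and K: "\<And>R. R \<in> K \<Longrightarrow> \<exists>l w. represents R l w" and P: "represents P n x"
  obtains n' x' where "P' \<in> K" "represents P' n' x'" "s_le x x'" "s_le x' x"
proof -
  have P': "P' \<in> K" "cp_le P P'" "cp_le P' P"
    using assms(1) by (auto simp: cp_class_def)
  obtain n' x' where x': "represents P' n' x'"
    using K [OF P'(1)] by blast
  show ?thesis
    using that [OF P'(1) x'] P' cp_le_iff_s_le [OF P x'] cp_le_iff_s_le [OF x' P] by blast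
qed

lemma cp_monoid_leq:
  assumes K: "\<And>R. R \<in> K \<Longrightarrow> \<exists>l w. represents R l w"
    and P: "P \<in> K" "represents P n x" and Q: "Q \<in> K" "represents Q m z"
  shows "leq (cp_monoid K) (cp_class K P) (cp_class K Q) \<longleftrightarrow> s_le x z"
proof
  assume "leq (cp_monoid K) (cp_class K P) (cp_class K Q)"
  then obtain P' Q' where PQ: "P' \<in> cp_class K P" "Q' \<in> cp_class K Q" "cp_le P' Q'"
    by (auto simp: cp_monoid_def)
  obtain n' x' where x': "represents P' n' x'" "s_le x x'"
    using cp_classE [OF PQ(1) K P(2)] by metis
  obtain m' z' where z': "represents Q' m' z'" "s_le z' z"
    using cp_classE [OF PQ(2) K Q(2)] by metis
  have "s_le x' z'"
    using PQ(3) cp_le_iff_s_le [OF x'(1) z'(1)] by blast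
  then show "s_le x z"
    using s_le_trans represents_S_objs x' z' Q(2) by metis
next
  assume "s_le x z"
  then show "leq (cp_monoid K) (cp_class K P) (cp_class K Q)"
    using cp_class_self [OF P] cp_class_self [OF Q] cp_le_iff_s_le [OF P(2) Q(2)]
    by (auto simp: cp_monoid_def)
qed

text \<open>The direct sum consists of pairs; any \<open>R\<close> represented by the block sum
  stands in for it. Other representatives of the two classes give equivalent block sums, so the
  definite description is well defined.\<close>

lemma cp_monoid_mult:
  assumes K: "\<And>R. R \<in> K \<Longrightarrow> \<exists>l w. represents R l w"
    and P: "P \<in> K" "represents P n x" and Q: "Q \<in> K" "represents Q m z"
    and R: "represents R (\<lambda>i. n i + m i) (block_sum_seq n x z)"
  shows "cp_class K P \<otimes>\<^bsub>cp_monoid K\<^esub> cp_class K Q = cp_class K R"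
proof -
  have "(THE E. \<exists>P'\<in>cp_class K P. \<exists>Q'\<in>cp_class K Q. E = cp_class K (direct_sum P' Q')) = cp_class K R"
  proof (rule the_equality)
    have "cp_class K R = cp_class K (direct_sum P Q)"
      using cp_class_cong [OF K R represents_direct_sum [OF P(2) Q(2)]]
        s_le_refl [OF represents_S_objs [OF R]] by blast
    then show "\<exists>P'\<in>cp_class K P. \<exists>Q'\<in>cp_class K Q. cp_class K R = cp_class K (direct_sum P' Q')"
      using cp_class_self [OF P] cp_class_self [OF Q] by blast
  next
    fix E assume "\<exists>P'\<in>cp_class K P. \<exists>Q'\<in>cp_class K Q. E = cp_class K (direct_sum P' Q')"
    then obtain P' Q' where PQ: "P' \<in> cp_class K P" "Q' \<in> cp_class K Q"
      and E: "E = cp_class K (direct_sum P' Q')"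
      by blast
    obtain n' x' where x': "represents P' n' x'" "s_le x x'" "s_le x' x"
      using cp_classE [OF PQ(1) K P(2)] by metis
    obtain m' z' where z': "represents Q' m' z'" "s_le z z'" "s_le z' z"
      using cp_classE [OF PQ(2) K Q(2)] by metis
    have sized: "sized_seq n x" "sized_seq m z" "sized_seq n' x'" "sized_seq m' z'"
      using P(2) Q(2) x'(1) z'(1) by (auto simp: represents_def)
    show "E = cp_class K R"
      unfolding E
      by (rule cp_class_cong [OF K represents_direct_sum [OF x'(1) z'(1)] R
            s_le_block_sum [OF sized(3,4,1,2) x'(3) z'(3)] s_le_block_sum [OF sized x'(2) z'(2)]])
  qed
  then show ?thesis
    by (simp add: cp_monoid_def)
qed

text \<open>Sequences on the matrix side parametrize \<open>K\<close> through \<open>E\<close>.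
  Monotonicity and injectivity of \<open>f\<close> come from \<open>e_le\<close>, surjectivity from
  \<open>ex\<close>, and additivity because \<open>e 0 = 0\<close> makes \<open>E\<close> commute
  with block sums.\<close>

lemma cp_monoid_iso:
  fixes K :: "'r::ring_1 seq_module set" and e :: "'a::ring \<Rightarrow> 'r"
  defines "E \<equiv> \<lambda>(u :: nat \<Rightarrow> 'a mat) n i j. e (u n i j)"
  assumes e0: "e 0 = 0"
    and e_le: "\<And>u v. u \<in> S_objs \<Longrightarrow> v \<in> S_objs \<Longrightarrow> s_le (E u) (E v) \<longleftrightarrow> s_le u v"
    and rep: "\<And>P. P \<in> K \<Longrightarrow> \<exists>n u. sized_seq n u \<and> represents P n (E u)"
    and ex: "\<And>n u. sized_seq n u \<Longrightarrow> \<exists>P\<in>K. represents P n (E u)"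
    and f: "\<And>P n u. P \<in> K \<Longrightarrow> sized_seq n u \<Longrightarrow> represents P n (E u) \<Longrightarrow> f (cp_class K P) = s_class u"
  shows "ord_monoid_iso (cp_monoid K) (S_mon :: (nat \<Rightarrow> 'a mat) set ord_monoid) f"
proof -
  have K: "\<And>R. R \<in> K \<Longrightarrow> \<exists>l w. represents R l w"
    using rep by blast
  have carrier: "carrier (cp_monoid K) = cp_class K ` K"
    by (simp add: cp_monoid_def)
  have repE: thesis if C: "C \<in> carrier (cp_monoid K)"
    and *: "\<And>P n u. P \<in> K \<Longrightarrow> C = cp_class K P \<Longrightarrow> sized_seq n u \<Longrightarrow> u \<in> S_objs \<Longrightarrow> represents P n (E u) \<Longrightarrow>
      f C = s_class u \<Longrightarrow> thesis" for C thesis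
  proof -
    obtain P where P: "P \<in> K" "C = cp_class K P"
      using C unfolding carrier by blast
    then obtain n u where u: "sized_seq n u" "represents P n (E u)"
      using rep by blast
    show thesis
      using * [OF P u(1) _ u(2)] f [OF P(1) u] P(2) u(1) S_objs_iff_sized by blast
  qed
  have E_block: "E (block_sum_seq n u v) = block_sum_seq n (E u) (E v)" for n u v
    by (simp add: E_def block_sum_def fun_eq_iff e0)
  have mult: "f (C \<otimes>\<^bsub>cp_monoid K\<^esub> D) = f C \<otimes>\<^bsub>S_mon\<^esub> f D \<and> C \<otimes>\<^bsub>cp_monoid K\<^esub> D \<in> carrier (cp_monoid K)"
    if C: "C \<in> carrier (cp_monoid K)" and D: "D \<in> carrier (cp_monoid K)" for C D
  proof -
    obtain P n u where P: "P \<in> K" "C = cp_class K P" "sized_seq n u" "represents P n (E u)" "f C = s_class u"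
      using repE [OF C] by metis
    obtain Q m v where Q: "Q \<in> K" "D = cp_class K Q" "sized_seq m v" "represents Q m (E v)" "f D = s_class v"
      using repE [OF D] by metis
    note sized = sized_seq_block_sum [OF P(3) Q(3)]
    obtain R where R: "R \<in> K" "represents R (\<lambda>i. n i + m i) (E (block_sum_seq n u v))"
      using ex [OF sized] by blast
    have "C \<otimes>\<^bsub>cp_monoid K\<^esub> D = cp_class K R"
      unfolding P(2) Q(2) by (rule cp_monoid_mult [OF K P(1,4) Q(1,4) R(2) [unfolded E_block]])
    then show ?thesis
      using f [OF R(1) sized R(2)] P(5) Q(5) S_mon_mult [OF P(3) Q(3)] R(1) carrier by simp
  qed
  have mem: "f C \<in> carrier S_mon" if C: "C \<in> carrier (cp_monoid K)" for C
    by (rule repE [OF C]) (simp add: S_mon_simps)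
  have leq: "leq (cp_monoid K) C D \<longleftrightarrow> leq S_mon (f C) (f D)"
    if C: "C \<in> carrier (cp_monoid K)" and D: "D \<in> carrier (cp_monoid K)" for C D
  proof -
    obtain P n u where P: "P \<in> K" "C = cp_class K P" "u \<in> S_objs" "represents P n (E u)" "f C = s_class u"
      using repE [OF C] by metis
    obtain Q m v where Q: "Q \<in> K" "D = cp_class K Q" "v \<in> S_objs" "represents Q m (E v)" "f D = s_class v"
      using repE [OF D] by metis
    show ?thesis
      using cp_monoid_leq [OF K P(1,4) Q(1,4)] e_le [OF P(3) Q(3)] S_mon_leq [OF P(3) Q(3)] P(2,5) Q(2,5)
      by simp
  qed
  have inj: "inj_on f (carrier (cp_monoid K))"
  proof (rule inj_onI)
    fix C D assume C: "C \<in> carrier (cp_monoid K)" and D: "D \<in> carrier (cp_monoid K)" and eq: "f C = f D"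
    obtain P n u where P: "P \<in> K" "C = cp_class K P" "u \<in> S_objs" "represents P n (E u)" "f C = s_class u"
      using repE [OF C] by metis
    obtain Q m v where Q: "Q \<in> K" "D = cp_class K Q" "v \<in> S_objs" "represents Q m (E v)" "f D = s_class v"
      using repE [OF D] by metis
    have "s_le u v" "s_le v u"
      using eq P(5) Q(5) s_class_eq_iff [OF P(3) Q(3)] by auto
    then show "C = D"
      unfolding P(2) Q(2)
      using cp_class_cong [OF K P(4) Q(4)] e_le [OF P(3) Q(3)] e_le [OF Q(3) P(3)] by blast
  qed
  have surj: "carrier S_mon \<subseteq> f ` carrier (cp_monoid K)"
  proof
    fix s :: "(nat \<Rightarrow> 'a mat) set" assume "s \<in> carrier S_mon"
    then obtain u n where u: "s = s_class u" "sized_seq n u"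
      by (auto simp: S_mon_simps S_objs_iff_sized)
    then obtain P where "P \<in> K" "represents P n (E u)"
      using ex by blast
    then show "s \<in> f ` carrier (cp_monoid K)"
      unfolding carrier using f [OF _ u(2)] u(1) by blast
  qed
  have one: "f \<one>\<^bsub>cp_monoid K\<^esub> = \<one>\<^bsub>S_mon\<^esub>"
  proof -
    let ?z = "\<lambda>_ _ _. 0 :: 'a"
    obtain P where P: "P \<in> K" "represents P (\<lambda>_. 0) (E ?z)"
      using ex [OF sized_seq_zero] by blast
    have zero: "represents (zero_module :: ('r, unit) rmodule) (\<lambda>_. 0) (E ?z)"
      using represents_zero_module by (simp add: E_def e0)
    \<comment> \<open>\<open>zero_module\<close> has elements of the unit type; a member of
      \<open>K\<close> with the same zero sequence has the same class, and on it \<open>f\<close> is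
      known.\<close>
    have "cp_class K zero_module = cp_class K P"
      using cp_class_cong [OF K zero P(2)] s_le_refl [OF represents_S_objs [OF P(2)]] by blast
    then show ?thesis
      using f [OF P(1) sized_seq_zero P(2)] by (simp add: S_mon_simps cp_monoid_def)
  qed
  have "f \<in> iso (cp_monoid K) S_mon"
    unfolding iso_def hom_def bij_betw_def using mult mem inj surj by blast
  then show ?thesis
    unfolding ord_monoid_iso_def using one leq by blast
qed

section \<open>Matrices over the unitization\<close>

text \<open>\<open>int_part\<close> is the ring homomorphism onto the integers with kernel R; its
  vanishing is the test for lying in R used below.\<close>

lemma int_part_simps [simp]:
  "int_part (0 :: 'a::ring unitization) = 0" "int_part (emb r) = 0"
  "int_part (a + b :: 'a unitization) = int_part a + int_part b"
  "int_part (a * b :: 'a unitization) = int_part a * int_part b"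
  "int_part (- a) = - int_part a"
  by (simp_all add: uminus_unitization_def zero_unitization_def emb_def plus_unitization_def times_unitization_def)

lemma int_part_sum: "int_part (sum f A :: 'a::ring unitization) = (\<Sum>i\<in>A. int_part (f i))"
  by (induction A rule: infinite_finite_induct) simp_all

lemma emb_simps [simp]:
  "emb (0 :: 'a::ring) = 0" "emb (r + s :: 'a) = emb r + emb s" "emb (r * s :: 'a) = emb r * emb s"
  by (simp_all add: zero_unitization_def emb_def plus_unitization_def times_unitization_def)

lemma emb_eq_iff [simp]: "emb r = emb s \<longleftrightarrow> r = s"
  by (simp add: emb_def)

lemma emb_eq_0_iff [simp]: "emb r = 0 \<longleftrightarrow> r = 0"
  using emb_eq_iff [of r 0] by simp

lemma emb_ring_part: "int_part z = 0 \<Longrightarrow> emb (ring_part z) = z"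
  by (simp add: emb_def unitization.expand)

lemma emb_sum: "emb (sum f A) = (\<Sum>i\<in>A. emb (f i))"
  by (induction A rule: infinite_finite_induct) simp_all

definition emb_mat :: "'a::ring mat \<Rightarrow> 'a unitization mat" where
  "emb_mat x = (\<lambda>i j. emb (x i j))"

lemma emb_mat_rect [simp]: "emb_mat x \<in> rect k l \<longleftrightarrow> x \<in> rect k l"
  by (simp add: emb_mat_def rect_def)

lemma emb_mat_mult: "x \<in> rect a b \<Longrightarrow> emb_mat (x \<odot> y) = emb_mat x \<odot> emb_mat y"
  using mat_mult_left_rect [of "emb_mat x" a b "emb_mat y"] mat_mult_left_rect [of x a b y]
  by (simp add: fun_eq_iff) (simp add: emb_mat_def emb_sum)

lemma emb_mat_eq_iff [simp]: "emb_mat x = emb_mat y \<longleftrightarrow> x = y"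
  by (simp add: emb_mat_def fun_eq_iff)

lemma emb_matE:
  assumes "z \<in> rect k l" "\<And>i j. int_part (z i j) = 0"
  obtains x where "x \<in> rect k l" "z = emb_mat x"
proof -
  have "z = emb_mat (\<lambda>i j. ring_part (z i j))"
    using assms(2) by (simp add: emb_mat_def emb_ring_part)
  then show ?thesis
    using that assms(1) emb_mat_rect by metis
qed

lemma sized_seq_emb:
  assumes "sized_seq n u"
  shows "sized_seq n (\<lambda>k. emb_mat (u k))"
  unfolding sized_seq_def
proof (intro conjI allI)
  fix i
  have u: "u i \<in> rect (n (Suc i)) (n i)" for i
    using assms by (simp add: sized_seq_def)
  then show "emb_mat (u i) \<in> rect (n (Suc i)) (n i)"
    by simp
  obtain y where y: "y \<in> rect (n (Suc i)) (n (Suc (Suc i)))" "y \<odot> u (Suc i) \<odot> u i = u i"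
    using assms unfolding sized_seq_def by blast
  have "emb_mat y \<odot> emb_mat (u (Suc i)) \<odot> emb_mat (u i) = emb_mat (u i)"
    unfolding emb_mat_mult [OF y(1), symmetric] emb_mat_mult [OF mat_mult_rect [OF y(1) u], symmetric]
      y(2) ..
  then show "\<exists>y\<in>rect (n (Suc i)) (n (Suc (Suc i))).
      y \<odot> emb_mat (u (Suc i)) \<odot> emb_mat (u i) = emb_mat (u i)"
    using y(1) by (intro bexI [of _ "emb_mat y"]) simp_all
qed

text \<open>
  From \<open>u n = y u (n + 1) u n\<close> and \<open>u (n + 1) = r v m t\<close> over the unitization,
  \<open>u n = (y r) v m (t u n)\<close>, and the outer factors have entries in the ideal \<open>R\<close>.
\<close>

lemma s_le_emb_iff:
  assumes u: "u \<in> S_objs" and v: "v \<in> S_objs"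
  shows "s_le (\<lambda>n. emb_mat (u n)) (\<lambda>n. emb_mat (v n)) \<longleftrightarrow> s_le u v"
proof
  assume le: "s_le u v"
  show "s_le (\<lambda>n. emb_mat (u n)) (\<lambda>n. emb_mat (v n))"
    unfolding s_le_def
  proof
    fix n
    obtain m r t where rt: "r \<in> M_infty" "t \<in> M_infty" "u n = r \<odot> v m \<odot> t"
      using le unfolding s_le_def s_le1_def by blast
    obtain k where "{r, t, v m} \<subseteq> rect k k"
      using M_infty_imp_common_rect [of "{r, t, v m}"] rt S_objs_M_infty [OF v] by auto
    then have k: "r \<in> rect k k" "t \<in> rect k k" "v m \<in> rect k k"
      by auto
    have "emb_mat (u n) = emb_mat r \<odot> emb_mat (v m) \<odot> emb_mat t"
      unfolding rt(3) by (simp add: emb_mat_mult [OF k(1)] emb_mat_mult [OF mat_mult_rect [OF k(1,3)]])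
    moreover have "emb_mat r \<in> M_infty" "emb_mat t \<in> M_infty"
      using k by (auto intro!: rect_imp_M_infty [of _ k k])
    ultimately show "\<exists>m. s_le1 (emb_mat (u n)) (emb_mat (v m))"
      unfolding s_le1_def by blast
  qed
next
  assume le: "s_le (\<lambda>n. emb_mat (u n)) (\<lambda>n. emb_mat (v n))"
  show "s_le u v"
    unfolding s_le_def
  proof
    fix n
    obtain y where y: "y \<in> M_infty" "y \<odot> u (Suc n) \<odot> u n = u n"
      using u unfolding S_objs_def by blast
    obtain m r t where rt: "r \<in> M_infty" "t \<in> M_infty" "emb_mat (u (Suc n)) = r \<odot> emb_mat (v m) \<odot> t"
      using le unfolding s_le_def s_le1_def by blast
    obtain k1 where k1: "{y, u n, u (Suc n), v m} \<subseteq> rect k1 k1"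
      using M_infty_imp_common_rect [of "{y, u n, u (Suc n), v m}"] y(1) S_objs_M_infty [OF u] S_objs_M_infty [OF v]
      by auto
    obtain k2 where k2: "{r, t} \<subseteq> rect k2 k2"
      using M_infty_imp_common_rect [of "{r, t}"] rt by auto
    define k where "k = max k1 k2"
    have k: "y \<in> rect k k" "u n \<in> rect k k" "u (Suc n) \<in> rect k k" "v m \<in> rect k k" "r \<in> rect k k" "t \<in> rect k k"
      using k1 k2 rect_mono [of _ k1 k1 k k] rect_mono [of _ k2 k2 k k] by (auto simp: k_def)
    have "emb_mat y \<odot> r \<in> rect k k" "t \<odot> emb_mat (u n) \<in> rect k k"
      by (rule mat_mult_rect [of _ k k _ k k]; simp add: k)+
    moreover have "int_part ((emb_mat y \<odot> r) i j) = 0" "int_part ((t \<odot> emb_mat (u n)) i j) = 0" for i j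
      using k by (simp_all add: mat_mult_left_rect [of _ k k] int_part_sum) (simp_all add: emb_mat_def)
    ultimately obtain r' t' where r': "r' \<in> rect k k" "emb_mat y \<odot> r = emb_mat r'"
      and t': "t' \<in> rect k k" "t \<odot> emb_mat (u n) = emb_mat t'"
      using emb_matE by metis
    have "emb_mat (u n) = emb_mat (y \<odot> u (Suc n) \<odot> u n)"
      using y(2) by simp
    also have "\<dots> = emb_mat y \<odot> (r \<odot> emb_mat (v m) \<odot> t) \<odot> emb_mat (u n)"
      unfolding rt(3) [symmetric] by (simp add: emb_mat_mult [OF k(1)] emb_mat_mult [OF mat_mult_rect [OF k(1,3)]])
    also have "\<dots> = (emb_mat y \<odot> r) \<odot> emb_mat (v m) \<odot> (t \<odot> emb_mat (u n))"
      by (simp add: k mat_mult_assoc [of _ k k] mat_mult_rect [of _ k k _ k k])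
    also have "\<dots> = emb_mat (r' \<odot> v m \<odot> t')"
      unfolding r'(2) t'(2)
      by (simp add: emb_mat_mult [OF r'(1)] emb_mat_mult [OF mat_mult_rect [OF r'(1) k(4)]])
    finally have "u n = r' \<odot> v m \<odot> t'"
      by simp
    then show "\<exists>m. s_le1 (u n) (v m)"
      unfolding s_le1_def using rect_imp_M_infty r'(1) t'(1) by blast
  qed
qed

section \<open>The inclusion of S(R)\<close>

lemma S_objs_emb: "u \<in> S_objs \<Longrightarrow> (\<lambda>n. emb_mat (u n)) \<in> S_objs"
  unfolding S_objs_iff_sized using sized_seq_emb by blast

lemma S_incl_s_class:
  assumes u: "u \<in> S_objs"
  shows "S_incl (s_class u) = s_class (\<lambda>n. emb_mat (u n))"
  unfolding S_incl_def emb_mat_def [symmetric]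
proof (rule the_equality)
  show "\<exists>v\<in>s_class u. s_class (\<lambda>n. emb_mat (u n)) = s_class (\<lambda>n. emb_mat (v n))"
    using u mem_s_class_iff by blast
  fix D assume "\<exists>v\<in>s_class u. D = s_class (\<lambda>n. emb_mat (v n))"
  then obtain v where v: "v \<in> S_objs" "s_le u v" "s_le v u" "D = s_class (\<lambda>n. emb_mat (v n))"
    by (auto simp: s_class_def)
  then show "D = s_class (\<lambda>n. emb_mat (u n))"
    using s_class_eq_iff [OF S_objs_emb S_objs_emb] s_le_emb_iff u by blast
qed

text \<open>Makes \<open>inv_into\<close> in \<open>psi_restr\<close> a true inverse on the image.
  It rests on the half of \<open>s_le_emb_iff\<close> that brings comparisons back to R.\<close>

lemma inj_on_S_incl: "inj_on S_incl (carrier S_mon)"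
proof (rule inj_onI)
  fix C D :: "(nat \<Rightarrow> 'a::ring mat) set"
  assume "C \<in> carrier S_mon" "D \<in> carrier S_mon" and eq: "S_incl C = S_incl D"
  then obtain u v where u: "u \<in> S_objs" "C = s_class u" and v: "v \<in> S_objs" "D = s_class v"
    by (auto simp: S_mon_simps)
  have "s_class (\<lambda>n. emb_mat (u n)) = s_class (\<lambda>n. emb_mat (v n))"
    using eq unfolding u(2) v(2) S_incl_s_class [OF u(1)] S_incl_s_class [OF v(1)] .
  then show "C = D"
    unfolding u(2) v(2)
    using s_class_eq_iff [OF S_objs_emb [OF u(1)] S_objs_emb [OF v(1)]] s_class_eq_iff [OF u(1) v(1)]
      s_le_emb_iff [OF u(1) v(1)] s_le_emb_iff [OF v(1) u(1)] by blast
qed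

section \<open>Modules with \<open>P = PR\<close> and matrices over R\<close>

lemma mod_times_ring_coefficients:
  fixes P :: "('a::ring unitization, 'p) rmodule"
  assumes P: "right_module P" and s: "s \<in> mod_hom P (fun_module V)" and V: "right_module (fun_module V)"
    and p: "p \<in> mod_times_ring P"
  shows "int_part (s p i) = 0"
proof -
  \<comment> \<open>The coefficients of \<open>s (q r)\<close> are those of \<open>s q\<close> times
    \<open>r\<close>, hence in the ideal R. Membership in the carrier is carried through the
    induction because \<open>s\<close> respects the operations only there.\<close>
  have "p \<in> carrier P \<and> int_part (s p i) = 0"
    using p unfolding mod_times_ring_def
  proof (induction rule: generate.induct)
    case one
    then show ?case using mod_hom_mzero [OF P V s] P by simp
  next
    case (incl h)
    then show ?case using mod_hom_act [OF s] P by auto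
  next
    case (inv h)
    then obtain q r where q: "q \<in> carrier P" "h = act P q (emb r)" by blast
    then have "h \<in> carrier P" "s h i = s q i * emb r"
      using mod_hom_act [OF s] P by simp_all
    then show ?case
      using mod_hom_act [OF s, of h "- 1"] P by (simp add: add_group_inv)
  next
    case (eng h1 h2)
    then show ?case using mod_hom_madd [OF s] P by simp
  qed
  then show ?thesis ..
qed

lemma mod_times_ring_subset:
  assumes P: "right_module P"
  shows "mod_times_ring P \<subseteq> carrier P"
proof -
  have "p \<in> carrier P" if "p \<in> mod_times_ring P" for p
    using that unfolding mod_times_ring_def
    by (induction rule: generate.induct) (use P in \<open>auto simp: add_group_inv\<close>)
  then show ?thesis by blast
qed

lemma CP_objs_represented:
  fixes P :: "'a::ring unitization seq_module"
  assumes "P \<in> CP_objs"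
  shows "\<exists>n u. sized_seq n u \<and> represents P n (\<lambda>k. emb_mat (u k))"
proof -
  have P: "right_module P" "countably_generated P" "projective P" and PR: "mod_times_ring P = carrier P"
    using assms by (auto simp: CP_objs_def CP_unital_objs_def)
  obtain \<pi> s where ps: "\<pi> \<in> mod_hom (fun_module fin_seqs) P" "s \<in> mod_hom P (fun_module fin_seqs)"
    "\<forall>p\<in>carrier P. \<pi> (s p) = p"
    using projective_section [OF P] by blast
  \<comment> \<open>Taking \<open>T\<close> to be R puts the witnesses \<open>y\<close> into R
    together with the \<open>x\<close>; the descended sequence needs both to be sized over
    R.\<close>
  let ?T = "{z :: 'a unitization. int_part z = 0}"
  have T: "\<forall>p\<in>carrier P. \<forall>i. s p i \<in> ?T"
    using mod_times_ring_coefficients [OF P(1) ps(2) right_module_fin_seqs] PR by simp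
  have T0: "0 \<in> ?T"
    by simp
  obtain n x y \<phi> where rx: "\<And>i. x i \<in> rect (n (Suc i)) (n i)"
    and ry: "\<And>i. y i \<in> rect (n (Suc i)) (n (Suc (Suc i)))" and yxx: "\<And>i. y i \<odot> x (Suc i) \<odot> x i = x i"
    and R: "\<And>i j k. x i j k \<in> ?T" "\<And>i j k. y i j k \<in> ?T"
    and lim: "is_dirlim P (\<lambda>i. free_module (n i)) (\<lambda>i. mat_vec (x i)) \<phi>"
    using retract_is_dirlim [OF P(1) ps T0 T] by blast
  have "\<forall>i. \<exists>u. u \<in> rect (n (Suc i)) (n i) \<and> x i = emb_mat u"
    "\<forall>i. \<exists>w. w \<in> rect (n (Suc i)) (n (Suc (Suc i))) \<and> y i = emb_mat w"
    using emb_matE [OF rx] emb_matE [OF ry] R by (metis mem_Collect_eq)+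
  then obtain u w where u: "\<And>i. u i \<in> rect (n (Suc i)) (n i)" "\<And>i. x i = emb_mat (u i)"
    and w: "\<And>i. w i \<in> rect (n (Suc i)) (n (Suc (Suc i)))" "\<And>i. y i = emb_mat (w i)"
    by metis
  have "emb_mat (w i \<odot> u (Suc i) \<odot> u i) = emb_mat (u i)" for i
    using yxx [of i] by (simp add: emb_mat_mult [OF w(1)] emb_mat_mult [OF mat_mult_rect [OF w(1) u(1)]] u(2) w(2))
  then have sized: "sized_seq n u"
    unfolding sized_seq_def using u(1) w(1) by auto
  moreover have "x = (\<lambda>k. emb_mat (u k))"
    by (simp add: u(2) fun_eq_iff)
  then have "represents P n (\<lambda>k. emb_mat (u k))"
    unfolding represents_def using lim sized_seq_emb [OF sized] by blast
  ultimately show ?thesis by blast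
qed

lemma sized_seq_represents_CP:
  assumes sized: "sized_seq n u"
  shows "\<exists>P\<in>CP_objs. represents P n (\<lambda>k. emb_mat (u k))"
proof -
  obtain P where P: "P \<in> CP_unital_objs" and rep: "represents P n (\<lambda>k. emb_mat (u k))"
    using sized_seq_represents_CP_unital [OF sized_seq_emb [OF sized]] by blast
  obtain \<phi> where lim: "is_dirlim P (\<lambda>i. free_module (n i)) (\<lambda>i. mat_vec (emb_mat (u i))) \<phi>"
    using rep by (auto simp: represents_def)
  note mP = is_dirlim_module [OF lim]
  have ru: "emb_mat (u i) \<in> rect (n (Suc i)) (n i)" for i
    using sized by (simp add: sized_seq_def)
  have "p \<in> mod_times_ring P" if p: "p \<in> carrier P" for p
  proof -
    obtain i v where v: "v \<in> carrier (free_module (n i))" "\<phi> i v = p"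
      using is_dirlim_eventually_mem [OF lim p] by blast
    define w where "w = mat_vec (emb_mat (u i)) v"
    have w: "w \<in> carrier (free_module (n (Suc i)))"
      unfolding w_def by (rule mod_hom_closed [OF mat_vec_hom [OF ru] v(1)])
    have "int_part (w j) = 0" for j
      unfolding w_def mat_vec_rect [OF ru] by (simp add: int_part_sum) (simp add: emb_mat_def)
    then have wj: "w j = emb (ring_part (w j))" for j
      by (simp add: emb_ring_part)
    have "p = \<phi> (Suc i) w"
      using is_dirlim_compat [OF lim v(1)] v(2) by (simp add: w_def)
    \<comment> \<open>Expanded over the basis, each summand is an element of \<open>P\<close> times
      an entry of \<open>w\<close>, and these entries lie in R.\<close>
    also have "\<dots> = lin_comb P (\<lambda>j. \<phi> (Suc i) (unit_vec j)) w (n (Suc i))"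
      by (rule mod_hom_free_module_expand [OF mP is_dirlim_hom [OF lim] w])
    also have "\<dots> \<in> mod_times_ring P"
    proof -
      have "lin_comb P (\<lambda>j. \<phi> (Suc i) (unit_vec j)) w k \<in> mod_times_ring P" if "k \<le> n (Suc i)" for k
        using that
      proof (induction k)
        case 0
        show ?case
          using generate.one [of "add_group P"] by (simp add: mod_times_ring_def)
      next
        case (Suc k)
        have "\<phi> (Suc i) (unit_vec k) \<in> carrier P"
          using is_dirlim_closed [OF lim] Suc.prems by simp
        then have "\<exists>q r. act P (\<phi> (Suc i) (unit_vec k)) (w k) = act P q (emb r) \<and> q \<in> carrier P"
          using wj [of k] by metis
        then have "act P (\<phi> (Suc i) (unit_vec k)) (w k) \<in> mod_times_ring P"
          unfolding mod_times_ring_def by (intro generate.incl CollectI)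
        then show ?case
          using generate.eng [of _ "add_group P"] Suc by (simp add: mod_times_ring_def)
      qed
      then show ?thesis by blast
    qed
    finally show ?thesis .
  qed
  then have "P \<in> CP_objs"
    unfolding CP_objs_def using P mod_times_ring_subset [OF mP] by blast
  with rep show ?thesis by blast
qed

section \<open>The isomorphism and its restriction\<close>

text \<open>Equivalent modules have equivalent sequences by \<open>cp_le_iff_s_le\<close>, whichever
  module of the class and whichever presentation as a limit is chosen. So the description in
  \<open>psi\<close> has one value.\<close>

lemma psi_cp_class:
  assumes P: "P \<in> CP_unital_objs" and rep: "represents P n x"
  shows "psi (cp_class CP_unital_objs P) = s_class x"
  unfolding psi_def
proof (rule the_equality)
  have mod: "right_module Q" if "Q \<in> CP_unital_objs" for Q :: "'a seq_module"
    using that by (simp add: CP_unital_objs_def)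
  show "\<exists>P'\<in>cp_class CP_unital_objs P. \<exists>n x'. sized_seq n x' \<and> mod_isomorphic P' (mat_lim n x') \<and>
      s_class x = s_class x'"
    using cp_class_self [OF P rep] rep represents_iff_mat_lim [OF mod [OF P]] by blast
  fix s assume "\<exists>P'\<in>cp_class CP_unital_objs P. \<exists>n x'. sized_seq n x' \<and> mod_isomorphic P' (mat_lim n x') \<and>
      s = s_class x'"
  then obtain P' n' x' where P': "P' \<in> CP_unital_objs" "cp_le P P'" "cp_le P' P"
    and x': "sized_seq n' x'" "mod_isomorphic P' (mat_lim n' x')" "s = s_class x'"
    by (auto simp: cp_class_def)
  have rep': "represents P' n' x'"
    using x' represents_iff_mat_lim [OF mod [OF P'(1)]] by blast
  show "s = s_class x"
    unfolding x'(3)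
    using P' cp_le_iff_s_le [OF rep rep'] cp_le_iff_s_le [OF rep' rep]
      s_class_eq_iff [OF represents_S_objs [OF rep'] represents_S_objs [OF rep]] by blast
qed

text \<open>Both classes are formed with the same relation, with members drawn from a smaller or a
  larger set; any member of the smaller class determines the larger one.\<close>

lemma CP_incl_cp_class:
  assumes P: "P \<in> CP_objs"
  shows "CP_incl (cp_class CP_objs P) = cp_class CP_unital_objs P"
  unfolding CP_incl_def
proof (rule the_equality)
  obtain n x where rep: "represents P n x"
    using CP_objs_represented [OF P] by blast
  show "\<exists>P'\<in>cp_class CP_objs P. cp_class CP_unital_objs P = cp_class CP_unital_objs P'"
    using cp_class_self [OF P rep] by blast
  fix D assume "\<exists>P'\<in>cp_class CP_objs P. D = cp_class CP_unital_objs P'"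
  then obtain P' where P': "P' \<in> cp_class CP_objs P" "D = cp_class CP_unital_objs P'"
    by blast
  obtain n' x' where "represents P' n' x'" "s_le x x'" "s_le x' x"
    using cp_classE [OF P'(1) _ rep] CP_objs_represented by metis
  then show "D = cp_class CP_unital_objs P"
    unfolding P'(2) using cp_class_cong [OF CP_unital_objs_represented _ rep] by blast
qed

text \<open>A presentation over R shows that the value of \<open>psi\<close> lies in the image of
  \<open>S_incl\<close>, and there \<open>inv_into\<close> undoes \<open>S_incl\<close>.\<close>

lemma psi_restr_cp_class:
  assumes P: "P \<in> CP_objs" and sized: "sized_seq n u" and rep: "represents P n (\<lambda>k. emb_mat (u k))"
  shows "psi_restr (cp_class CP_objs P) = s_class u"
    and "psi (CP_incl (cp_class CP_objs P)) = S_incl (s_class u)"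
proof -
  have u: "u \<in> S_objs"
    using sized S_objs_iff_sized by blast
  have "P \<in> CP_unital_objs"
    using P by (simp add: CP_objs_def)
  then show eq: "psi (CP_incl (cp_class CP_objs P)) = S_incl (s_class u)"
    unfolding CP_incl_cp_class [OF P] S_incl_s_class [OF u] by (rule psi_cp_class [OF _ rep])
  show "psi_restr (cp_class CP_objs P) = s_class u"
    unfolding psi_restr_def eq by (rule inv_into_f_f [OF inj_on_S_incl]) (simp add: S_mon_simps u)
qed

theorem theorem4p13:
  shows "ord_monoid_iso (CP_unital :: 'a::ring unitization seq_module set ord_monoid) S_mon psi \<and>
      (\<forall>P \<in> (CP_unital_objs :: 'a unitization seq_module set). \<forall>n x.
        sized_seq n x \<longrightarrow> mod_isomorphic P (mat_lim n x) \<longrightarrow>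
        psi (cp_class CP_unital_objs P) = s_class x) \<and>
      ord_monoid_iso (CP :: 'a unitization seq_module set ord_monoid)
        (S_mon :: (nat \<Rightarrow> 'a mat) set ord_monoid) psi_restr \<and>
      (\<forall>C \<in> carrier (CP :: 'a unitization seq_module set ord_monoid).
        S_incl (psi_restr C) = psi (CP_incl C))"
proof (intro conjI)
  show "ord_monoid_iso (CP_unital :: 'a unitization seq_module set ord_monoid) S_mon psi"
    unfolding CP_unital_def
  \<comment> \<open>With the identity on coefficients, the conditions on \<open>e\<close> are
    trivial and only the representation of modules by sequences remains.\<close>
  proof (rule cp_monoid_iso [where e = "\<lambda>z. z"])
    fix P :: "'a unitization seq_module" assume "P \<in> CP_unital_objs"
    then obtain n x where "represents P n x"
      using CP_unital_objs_represented by blast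
    then show "\<exists>n u. sized_seq n u \<and> represents P n (\<lambda>n i j. u n i j)"
      unfolding represents_def by blast
  qed (simp_all add: sized_seq_represents_CP_unital psi_cp_class)
  show "\<forall>P \<in> (CP_unital_objs :: 'a unitization seq_module set). \<forall>n x.
      sized_seq n x \<longrightarrow> mod_isomorphic P (mat_lim n x) \<longrightarrow> psi (cp_class CP_unital_objs P) = s_class x"
  proof (intro ballI allI impI)
    fix P :: "'a unitization seq_module" and n x
    assume P: "P \<in> CP_unital_objs" and "sized_seq n x" "mod_isomorphic P (mat_lim n x)"
    then have "represents P n x"
      using represents_iff_mat_lim [of P n x] by (simp add: CP_unital_objs_def)
    then show "psi (cp_class CP_unital_objs P) = s_class x"
      by (rule psi_cp_class [OF P])
  qed
  show "ord_monoid_iso (CP :: 'a unitization seq_module set ord_monoid)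
      (S_mon :: (nat \<Rightarrow> 'a mat) set ord_monoid) psi_restr"
    unfolding CP_def
  \<comment> \<open>The condition on the order is now \<open>s_le_emb_iff\<close>, and the set of
    modules is matched with sequences over R in both directions.\<close>
  proof (rule cp_monoid_iso [where e = emb], unfold emb_mat_def [symmetric])
    show "emb 0 = (0 :: 'a unitization)" by simp
    show "s_le (\<lambda>n. emb_mat (u n)) (\<lambda>n. emb_mat (v n)) \<longleftrightarrow> s_le u v"
      if "u \<in> S_objs" "v \<in> S_objs" for u v :: "nat \<Rightarrow> 'a mat"
      by (rule s_le_emb_iff [OF that])
  qed (use CP_objs_represented sized_seq_represents_CP psi_restr_cp_class(1) in blast)+
  show "\<forall>C \<in> carrier (CP :: 'a unitization seq_module set ord_monoid). S_incl (psi_restr C) = psi (CP_incl C)"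
  proof
    fix C :: "'a unitization seq_module set" assume "C \<in> carrier CP"
    then obtain P where P: "P \<in> CP_objs" "C = cp_class CP_objs P"
      by (auto simp: CP_def cp_monoid_def)
    then obtain n u where "sized_seq n u" "represents P n (\<lambda>k. emb_mat (u k))"
      using CP_objs_represented by blast
    then show "S_incl (psi_restr C) = psi (CP_incl C)"
      unfolding P(2) using psi_restr_cp_class [OF P(1)] by metis
  qed
qed

end
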